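(* Let $A=B=C=\mathbb{C}^3$ and let $T\in A\otimes B\otimes C$ be a tensor of border rank five. Then $$\dim\underline{VSP}_{A\otimes B\otimes C}(T)\geq 8.$$
   Context: All vector spaces are over $\mathbb{C}$. The border rank $\underline{\mathbf{R}}(T)$ of $T\in A\otimes B\otimes C$ is the smallest $r$ such that $T$ is a limit of sums of $r$ rank one tensors $a\otimes b\otimes c$. With $r=\underline{\mathbf{R}}(T)$, $\underline{VSP}_{A\otimes B\otimes C}(T)\subset G(r,A\otimes B\otimes C)$ is the variety of $r$-planes giving rise to a border rank $r$ decomposition of $T$. Precisely, let $X=Seg(\mathbb{P}A\times\mathbb{P}B\times\mathbb{P}C)\subset\mathbb{P}(A\otimes B\otimes C)$ be the Segre variety of rank one tensors, let $$S_r(X)=\overline{\{((x_1,\dots,x_r),y,E)\in X^{\times r}\times\mathbb{P}(A\otimes B\otimes C)\times G(r,A\otimes B\otimes C)\mid y\in\langle x_1,\dots,x_r\rangle\subseteq E\}},$$ with projections $\pi_G$ to $G(r,A\otimes B\otimes C)$ and $\pi_\sigma$ to the secant variety $\sigma_r(X)$ (the closure of the union of the spans of $r$ points of $X$). Then $\underline{VSP}_{A\otimes B\otimes C}(T)=\pi_G(\pi_\sigma^{-1}([T]))$. (In the definition of $S_r(X)$ the generic points are those with $x_1,\dots,x_r$ linearly independent, so that $E$ is their span.) *)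

theory Defs
  imports "HOL-Analysis.Analysis" "HOL-Library.Extended_Nat"
begin

section \<open>Tensors and border rank\<close>

text \<open>
  The space \<open>A \<otimes> B \<otimes> C\<close> for \<open>A = complex ^ 'a\<close>, \<open>B = complex ^ 'b\<close>, \<open>C = complex ^ 'c\<close>, in
  coordinates. A product index type is used instead of nested vectors so that complex-linear
  algebra is available as \<open>vec.span\<close>, \<open>vec.dim\<close>, etc.
\<close>

type_synonym ('a, 'b, 'c) tensor = "complex ^ ('a \<times> 'b \<times> 'c)"

definition tensor_prod ::
  "complex ^ 'a \<Rightarrow> complex ^ 'b \<Rightarrow> complex ^ 'c \<Rightarrow> ('a::finite, 'b::finite, 'c::finite) tensor" where
  "tensor_prod a b c = (\<chi> t. a $ fst t * b $ fst (snd t) * c $ snd (snd t))"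

definition rank_one :: "('a::finite, 'b::finite, 'c::finite) tensor set" where
  "rank_one = {tensor_prod a b c | a b c. a \<noteq> 0 \<and> b \<noteq> 0 \<and> c \<noteq> 0}"

definition rank_one_sums :: "nat \<Rightarrow> ('a::finite, 'b::finite, 'c::finite) tensor set" where
  "rank_one_sums r = {\<Sum>i<r. t i | t. \<forall>i<r. t i \<in> rank_one}"

definition border_rank :: "('a::finite, 'b::finite, 'c::finite) tensor \<Rightarrow> nat" where
  "border_rank T = (LEAST r. \<exists>S :: nat \<Rightarrow> ('a, 'b, 'c) tensor.
     (\<forall>n. S n \<in> rank_one_sums r) \<and> S \<longlonglongrightarrow> T)"

section \<open>Zariski topologies\<close>

text \<open>The algebra of functions generated over the complex numbers by a set of coordinate functions.\<close>

inductive_set polyfuns :: "('p \<Rightarrow> complex) set \<Rightarrow> ('p \<Rightarrow> complex) set" for C where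
  coord: "f \<in> C \<Longrightarrow> f \<in> polyfuns C"
| const: "(\<lambda>_. c) \<in> polyfuns C"
| add: "f \<in> polyfuns C \<Longrightarrow> g \<in> polyfuns C \<Longrightarrow> (\<lambda>p. f p + g p) \<in> polyfuns C"
| mult: "f \<in> polyfuns C \<Longrightarrow> g \<in> polyfuns C \<Longrightarrow> (\<lambda>p. f p * g p) \<in> polyfuns C"

text \<open>The closed sets are the common zero sets of sets of polynomial functions.\<close>

definition zariski :: "('p \<Rightarrow> complex) set \<Rightarrow> 'p topology" where
  "zariski C = topology (\<lambda>U. \<exists>F \<subseteq> polyfuns C. U = {p. \<exists>f\<in>F. f p \<noteq> 0})"

definition final_topology :: "'p topology \<Rightarrow> ('p \<Rightarrow> 'q) \<Rightarrow> 'q topology" where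
  "final_topology X q =
     topology (\<lambda>U. U \<subseteq> q ` topspace X \<and> openin X {p \<in> topspace X. q p \<in> U})"

lemma openin_zariski:
  "openin (zariski C) U \<longleftrightarrow> (\<exists>F \<subseteq> polyfuns C. U = {p. \<exists>f\<in>F. f p \<noteq> 0})"
proof -
  have "istopology (\<lambda>U. \<exists>F \<subseteq> polyfuns C. U = {p. \<exists>f\<in>F. f p \<noteq> 0})"
    unfolding istopology_def
  proof (intro conjI allI impI)
    fix S T
    assume "\<exists>F \<subseteq> polyfuns C. S = {p. \<exists>f\<in>F. f p \<noteq> 0}" "\<exists>F \<subseteq> polyfuns C. T = {p. \<exists>f\<in>F. f p \<noteq> 0}"
    then obtain F G where FG: "F \<subseteq> polyfuns C" "G \<subseteq> polyfuns C"
      "S = {p. \<exists>f\<in>F. f p \<noteq> 0}" "T = {p. \<exists>f\<in>G. f p \<noteq> 0}" by blast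
    let ?H = "(\<lambda>(f, g) p. f p * g p) ` (F \<times> G)"
    have "?H \<subseteq> polyfuns C" using FG(1,2) by (auto intro!: polyfuns.mult)
    moreover have "S \<inter> T = {p. \<exists>h\<in>?H. h p \<noteq> 0}"
      unfolding FG(3,4) by (simp add: set_eq_iff)
    ultimately show "\<exists>F \<subseteq> polyfuns C. S \<inter> T = {p. \<exists>f\<in>F. f p \<noteq> 0}" by blast
  next
    fix K
    assume "\<forall>S\<in>K. \<exists>F \<subseteq> polyfuns C. S = {p. \<exists>f\<in>F. f p \<noteq> 0}"
    then have "\<forall>S\<in>K. \<exists>F. F \<subseteq> polyfuns C \<and> (\<forall>p. p \<in> S \<longleftrightarrow> (\<exists>f\<in>F. f p \<noteq> 0))"
      by (simp add: set_eq_iff)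
    then obtain F where F: "\<forall>S\<in>K. F S \<subseteq> polyfuns C \<and> (\<forall>p. p \<in> S \<longleftrightarrow> (\<exists>f\<in>F S. f p \<noteq> 0))"
      by (rule bchoice[THEN exE])
    then have "(\<Union>S\<in>K. F S) \<subseteq> polyfuns C" by (simp add: UN_subset_iff)
    moreover have "\<Union>K = {p. \<exists>f\<in>(\<Union>S\<in>K. F S). f p \<noteq> 0}" using F by (simp add: set_eq_iff)
    ultimately show "\<exists>F \<subseteq> polyfuns C. \<Union>K = {p. \<exists>f\<in>F. f p \<noteq> 0}" by blast
  qed
  then show ?thesis unfolding zariski_def by (simp add: topology_inverse')
qed

lemma topspace_zariski [simp]: "topspace (zariski C) = UNIV"
proof -
  have "openin (zariski C) UNIV"
    unfolding openin_zariski by (rule exI[of _ "{\<lambda>_. 1}"]) (auto intro: polyfuns.const)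
  then show ?thesis using openin_subset by blast
qed

lemma openin_final_topology:
  "openin (final_topology X q) U \<longleftrightarrow>
     U \<subseteq> q ` topspace X \<and> openin X {p \<in> topspace X. q p \<in> U}"
proof -
  have "istopology (\<lambda>U. U \<subseteq> q ` topspace X \<and> openin X {p \<in> topspace X. q p \<in> U})"
    unfolding istopology_def
  proof (intro conjI allI impI)
    fix S T
    assume "S \<subseteq> q ` topspace X \<and> openin X {p \<in> topspace X. q p \<in> S}"
      and "T \<subseteq> q ` topspace X \<and> openin X {p \<in> topspace X. q p \<in> T}"
    moreover have "{p \<in> topspace X. q p \<in> S \<inter> T} =
        {p \<in> topspace X. q p \<in> S} \<inter> {p \<in> topspace X. q p \<in> T}" by blast
    ultimately show "S \<inter> T \<subseteq> q ` topspace X" "openin X {p \<in> topspace X. q p \<in> S \<inter> T}"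
      by auto
  next
    fix K
    assume K: "\<forall>S\<in>K. S \<subseteq> q ` topspace X \<and> openin X {p \<in> topspace X. q p \<in> S}"
    then show "\<Union>K \<subseteq> q ` topspace X" by blast
    have "{p \<in> topspace X. q p \<in> \<Union>K} = \<Union>((\<lambda>S. {p \<in> topspace X. q p \<in> S}) ` K)" by blast
    then show "openin X {p \<in> topspace X. q p \<in> \<Union>K}" using K by auto
  qed
  then show ?thesis unfolding final_topology_def by (simp add: topology_inverse')
qed

lemma topspace_final_topology [simp]: "topspace (final_topology X q) = q ` topspace X"
proof -
  have "{p \<in> topspace X. q p \<in> q ` topspace X} = topspace X" by blast
  then have "openin (final_topology X q) (q ` topspace X)"
    by (simp add: openin_final_topology)
  moreover have "topspace (final_topology X q) \<subseteq> q ` topspace X"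
    using openin_topspace[of "final_topology X q"] unfolding openin_final_topology by (rule conjunct1)
  ultimately show ?thesis by (blast dest: openin_subset)
qed

section \<open>Grassmannians and the Segre variety\<close>

definition grassmannian :: "nat \<Rightarrow> (complex ^ 'n) set set" where
  "grassmannian r = {E. vec.subspace E \<and> vec.dim E = r}"

text \<open>
  Points of projective space are the elements of \<open>grassmannian 1\<close>, so that a nonzero
  vector \<open>v\<close> represents the point \<open>vec.span {v}\<close>.
\<close>

abbreviation proj_point :: "complex ^ 'n \<Rightarrow> (complex ^ 'n) set" where
  "proj_point v \<equiv> vec.span {v}"

text \<open>Only the values at indices below \<open>r\<close> matter for membership in \<open>frames r\<close>.\<close>

definition frames :: "nat \<Rightarrow> (nat \<Rightarrow> complex ^ 'n) set" where
  "frames r = {v. inj_on v {..<r} \<and> vec.independent (v ` {..<r})}"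

definition frame_span :: "nat \<Rightarrow> (nat \<Rightarrow> complex ^ 'n) \<Rightarrow> (complex ^ 'n) set" where
  "frame_span r v = vec.span (v ` {..<r})"

text \<open>
  The Zariski topology of \<open>G(r, V)\<close> is the quotient topology for the map sending a frame to its
  span, where the frames form a (Zariski open) subspace of the affine space \<open>V^r\<close>: this map is the
  quotient by \<open>GL(r)\<close>, an open surjective morphism of varieties.
\<close>

definition grassmannian_zariski :: "nat \<Rightarrow> (complex ^ 'n) set topology" where
  "grassmannian_zariski r =
     final_topology
       (subtopology (zariski {\<lambda>v. v j $ i | j i. j < r}) (frames r))
       (frame_span r)"

definition segre :: "('a::finite, 'b::finite, 'c::finite) tensor set set" where
  "segre = proj_point ` rank_one"

text \<open>
  The Zariski topology of the product \<open>X^r \<times> P(V) \<times> G(r, V)\<close>, with \<open>X\<close> the Segre variety. It is not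
  the product of the Zariski topologies of the factors. As for \<open>grassmannian_zariski\<close>, it is the
  quotient topology, here from a Zariski-locally closed subset of the affine space
  \<open>V^r \<times> V \<times> V^r\<close>. Elements of \<open>X^r\<close> are represented by functions in \<open>{..<r} \<rightarrow>\<^sub>E X\<close>.
\<close>

definition incidence_zariski ::
  "nat \<Rightarrow> ((nat \<Rightarrow> ('a::finite, 'b::finite, 'c::finite) tensor set)
            \<times> ('a, 'b, 'c) tensor set \<times> ('a, 'b, 'c) tensor set) topology" where
  "incidence_zariski r =
     final_topology
       (subtopology
         (zariski ({\<lambda>(x, y, v). x j $ i | j i. j < r} \<union> {\<lambda>(x, y, v). y $ i | i. True}
                   \<union> {\<lambda>(x, y, v). v j $ i | j i. j < r}))
         {(x, y, v). (\<forall>j<r. x j \<in> rank_one) \<and> y \<noteq> 0 \<and> v \<in> frames r})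
       (\<lambda>(x, y, v). (restrict (\<lambda>j. proj_point (x j)) {..<r}, proj_point y, frame_span r v))"

section \<open>The border variety of sums of powers\<close>

text \<open>
  The condition \<open>vec.dim (\<Union>j<r. x j) = r\<close> says that \<open>x_1, ..., x_r\<close> are linearly independent,
  so that \<open>E\<close> is their span. Without it the closure would acquire further components consisting of
  points with dependent \<open>x_1, ..., x_r\<close> and an arbitrary \<open>E\<close> containing them; since these lie over
  tensors of border rank less than \<open>r\<close>, they would not affect \<open>border_vsp\<close>.
\<close>

definition S_incidence ::
  "nat \<Rightarrow> ((nat \<Rightarrow> ('a::finite, 'b::finite, 'c::finite) tensor set)
            \<times> ('a, 'b, 'c) tensor set \<times> ('a, 'b, 'c) tensor set) set" where
  "S_incidence r = incidence_zariski r closure_of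
     {(x, y, E). x \<in> {..<r} \<rightarrow>\<^sub>E segre \<and> y \<in> grassmannian 1 \<and> E \<in> grassmannian r \<and>
        vec.dim (\<Union>j<r. x j) = r \<and>
        y \<subseteq> vec.span (\<Union>j<r. x j) \<and> vec.span (\<Union>j<r. x j) \<subseteq> E}"

definition border_vsp ::
  "('a::finite, 'b::finite, 'c::finite) tensor \<Rightarrow> ('a, 'b, 'c) tensor set set" where
  "border_vsp T = {E. \<exists>x. (x, proj_point T, E) \<in> S_incidence (border_rank T)}"

section \<open>Dimension\<close>

definition irreducible_closedin :: "'p topology \<Rightarrow> 'p set \<Rightarrow> bool" where
  "irreducible_closedin X Z \<longleftrightarrow> closedin X Z \<and> Z \<noteq> {} \<and>
     (\<forall>A B. closedin X A \<longrightarrow> closedin X B \<longrightarrow> Z \<subseteq> A \<union> B \<longrightarrow> Z \<subseteq> A \<or> Z \<subseteq> B)"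

text \<open>The dimension of the empty space is 0 with this definition, as \<open>enat\<close> has no negative value.\<close>

definition krull_dim :: "'p topology \<Rightarrow> enat" where
  "krull_dim X = Sup {enat n | n. \<exists>Z :: nat \<Rightarrow> 'p set.
     (\<forall>i\<le>n. irreducible_closedin X (Z i)) \<and> (\<forall>i<n. Z i \<subset> Z (Suc i))}"

section \<open>Underlying sets of the topologies\<close>

lemma frame_span_image_frames: "frame_span r ` frames r = (grassmannian r :: (complex ^ 'n) set set)"
proof (intro equalityI subsetI)
  fix E :: "(complex ^ 'n) set"
  assume "E \<in> frame_span r ` frames r"
  then obtain v where v: "v \<in> frames r" "E = vec.span (v ` {..<r})"
    by (auto simp: frame_span_def)
  then have "vec.dim E = card (v ` {..<r})"
    by (simp add: frames_def vec.dim_eq_card_independent)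
  then show "E \<in> grassmannian r"
    using v by (simp add: grassmannian_def frames_def card_image)
next
  fix E :: "(complex ^ 'n) set"
  assume "E \<in> grassmannian r"
  then have E: "vec.subspace E" "vec.dim E = r" by (auto simp: grassmannian_def)
  obtain B where B: "B \<subseteq> E" "vec.independent B" "E \<subseteq> vec.span B" "card B = vec.dim E"
    using vec.basis_exists by blast
  have "finite B" using B(2) vec.independent_bound_general by blast
  then obtain v where v: "bij_betw v {..<r} B"
    using B(4) E(2) by (metis card_lessThan finite_lessThan finite_same_card_bij)
  have "E = vec.span B"
    using B(1,3) E(1) vec.span_minimal by blast
  then show "E \<in> frame_span r ` frames r"
    using v B(2) by (auto simp: frame_span_def frames_def bij_betw_def intro!: image_eqI[of _ _ v])
qed

lemma topspace_grassmannian_zariski: "topspace (grassmannian_zariski r) = grassmannian r"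
  by (simp add: grassmannian_zariski_def frame_span_image_frames)

lemma proj_points: "proj_point ` {v. v \<noteq> 0} = (grassmannian 1 :: (complex ^ 'n) set set)"
proof -
  have "frame_span 1 ` frames 1 = proj_point ` {v :: complex ^ 'n. v \<noteq> 0}"
  proof (intro equalityI subsetI)
    fix E :: "(complex ^ 'n) set"
    assume "E \<in> proj_point ` {v. v \<noteq> 0}"
    then obtain v where "v \<noteq> 0" "E = vec.span {v}" by blast
    then have "(\<lambda>_. v) \<in> frames 1" "E = frame_span 1 (\<lambda>_. v)"
      by (simp_all add: frame_span_def frames_def lessThan_Suc)
    then show "E \<in> frame_span 1 ` frames 1" by blast
  next
    fix E :: "(complex ^ 'n) set"
    assume "E \<in> frame_span 1 ` frames 1"
    then obtain v where "v \<in> frames 1" "E = frame_span 1 v" by blast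
    then have "v 0 \<noteq> 0" "E = vec.span {v 0}"
      by (simp_all add: frame_span_def frames_def lessThan_Suc)
    then show "E \<in> proj_point ` {v. v \<noteq> 0}" by blast
  qed
  then show ?thesis by (simp only: frame_span_image_frames)
qed

lemma topspace_incidence_zariski:
  "topspace (incidence_zariski r) = ({..<r} \<rightarrow>\<^sub>E segre) \<times> grassmannian 1 \<times> grassmannian r"
proof -
  let ?q = "\<lambda>(x, y, v). (restrict (\<lambda>j. proj_point (x j)) {..<r}, proj_point y, frame_span r v)"
  let ?P = "{(x, y, v). (\<forall>j<r. x j \<in> rank_one) \<and> y \<noteq> 0 \<and> v \<in> frames r}"
  have "?q ` ?P = ({..<r} \<rightarrow>\<^sub>E segre) \<times> (proj_point ` {v. v \<noteq> 0}) \<times> (frame_span r ` frames r)"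
    (is "?L = ?R")
  proof (intro equalityI subsetI)
    fix p assume "p \<in> ?L"
    then show "p \<in> ?R" by (auto simp: segre_def)
  next
    fix p assume "p \<in> ?R"
    then obtain l y v where p: "p = (l, proj_point y, frame_span r v)"
      and l: "l \<in> {..<r} \<rightarrow>\<^sub>E segre" and y: "y \<noteq> 0" and v: "v \<in> frames r"
      by blast
    have "\<forall>j. \<exists>t. j < r \<longrightarrow> t \<in> rank_one \<and> l j = proj_point t"
    proof
      fix j
      show "\<exists>t. j < r \<longrightarrow> t \<in> rank_one \<and> l j = proj_point t"
      proof (cases "j < r")
        case True
        then have "l j \<in> segre" using PiE_mem[OF l, of j] by simp
        then show ?thesis unfolding segre_def by blast
      qed blast
    qed
    then obtain x where x: "\<forall>j. j < r \<longrightarrow> x j \<in> rank_one \<and> l j = proj_point (x j)"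
      by (rule choice[THEN exE])
    have "l j = restrict (\<lambda>j. proj_point (x j)) {..<r} j" for j
      using x PiE_arb[OF l, of j] by (cases "j < r") simp_all
    then have "p = ?q (x, y, v)" using p by (simp add: fun_eq_iff)
    moreover have "(x, y, v) \<in> ?P" using x y v by simp
    ultimately show "p \<in> ?L" by (rule image_eqI)
  qed
  then show ?thesis
    unfolding incidence_zariski_def topspace_final_topology topspace_subtopology topspace_zariski
      Int_UNIV_left proj_points frame_span_image_frames .
qed

end

theory Submission
  imports Defs
    "HOL-Computational_Algebra.Fundamental_Theorem_Algebra"
    "HOL-Library.Function_Algebras"
begin

text \<open>Eight is the dimension of a general fibre: five points of the Segre variety and a point
  of their span have 5 * 6 + 4 = 34 parameters, and tensors up to scale have 26. That a special
  tensor has no smaller fibre is classically the theorem on fibre dimensions. Sections replace it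
  because meeting eight of them survives limits and produces the very chain that
  \<open>krull_dim\<close> measures. The data \<open>(L, u)\<close> of the sections belong to the
  target so that tensor and sections can be perturbed together; apart from \<open>L\<close> and from
  scalings inside a rank one tensor, both sides then have 35 + 8 * 5 = 27 + 8 * 6 parameters. The
  limit is taken in the usual topology, so the image must be dense there, whereas an interior point
  of the image only shows that no nonzero polynomial vanishes on it. Extending characters closes
  this gap in the manner of Chevalley's theorem: the image contains the complement of the zero set
  of a nonzero polynomial, and such a set is dense in the usual topology too.\<close>

text \<open>
  By induction on \<open>n\<close>, a Noetherian space that meets any \<open>n\<close> hyperplane sections has a chain of
  irreducible closed sets of length \<open>n\<close>: a general section contains none of the irreducible
  components. So it suffices that \<open>border_vsp T\<close> meets any eight hyperplane sections of the
  Grassmannian. Pairs of five rank one tensors and eight sections through their span depend on as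
  many parameters as pairs of a tensor and eight sections. The polynomial map taking the sum of the
  five tensors is a submersion at an explicit point, so its image has an interior point and, being
  the image of a polynomial map, is dense. Hence the claim holds for a dense set of tensors and
  sections, and by compactness of the Grassmannian it passes to the limit.
\<close>

section \<open>Noetherian spaces\<close>

definition noetherian_space :: "'a topology \<Rightarrow> bool" where
  "noetherian_space X \<longleftrightarrow> (\<forall>A :: nat \<Rightarrow> 'a set.
     (\<forall>n. closedin X (A n)) \<longrightarrow> (\<forall>n. A (Suc n) \<subseteq> A n) \<longrightarrow> (\<exists>n. A (Suc n) = A n))"

lemma noetherian_spaceD:
  assumes "noetherian_space X" "\<And>n. closedin X (A n)" "\<And>n. A (Suc n) \<subseteq> A n"
  shows "\<exists>n. A (Suc n) = A n"
  using assms unfolding noetherian_space_def by blast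

lemma noetherian_space_subtopology:
  assumes "noetherian_space X"
  shows "noetherian_space (subtopology X S)"
  unfolding noetherian_space_def
proof (intro allI impI)
  fix B :: "nat \<Rightarrow> 'a set"
  assume cl: "\<forall>n. closedin (subtopology X S) (B n)" and dec: "\<forall>n. B (Suc n) \<subseteq> B n"
  from cl obtain T where T: "\<And>n. closedin X (T n)" "\<And>n. B n = T n \<inter> S"
    unfolding closedin_subtopology by metis
  \<comment> \<open>The lifts \<open>T n\<close> of a decreasing sequence need not decrease, but
    their partial intersections do and have the same traces on \<open>S\<close>.\<close>
  define A where "A n = (\<Inter>i\<le>n. T i)" for n
  have AB: "A n \<inter> S = B n" for n
  proof
    show "A n \<inter> S \<subseteq> B n" by (auto simp: A_def T(2))
    have "B n \<subseteq> B i" if "i \<le> n" for i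
      using dec that by (simp add: lift_Suc_antimono_le)
    then show "B n \<subseteq> A n \<inter> S" using T(2) by (auto simp: A_def)
  qed
  have "closedin X (A n)" for n
    unfolding A_def by (rule closedin_Inter) (auto simp: T(1))
  moreover have "A (Suc n) \<subseteq> A n" for n by (auto simp: A_def)
  ultimately obtain n where "A (Suc n) = A n" using noetherian_spaceD[OF assms] by blast
  then show "\<exists>n. B (Suc n) = B n" using AB by metis
qed

lemma closedin_final_topology:
  "closedin (final_topology X q) B \<longleftrightarrow>
     B \<subseteq> q ` topspace X \<and> closedin X {p \<in> topspace X. q p \<in> B}"
proof -
  have "{p \<in> topspace X. q p \<in> q ` topspace X - B} = topspace X - {p \<in> topspace X. q p \<in> B}"
    by auto
  then show ?thesis
    by (auto simp: closedin_def openin_final_topology)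
qed

lemma noetherian_space_final_topology:
  assumes "noetherian_space X"
  shows "noetherian_space (final_topology X q)"
  unfolding noetherian_space_def
proof (intro allI impI)
  fix B :: "nat \<Rightarrow> 'b set"
  assume cl: "\<forall>n. closedin (final_topology X q) (B n)" and dec: "\<forall>n. B (Suc n) \<subseteq> B n"
  have "\<exists>n. {p \<in> topspace X. q p \<in> B (Suc n)} = {p \<in> topspace X. q p \<in> B n}"
    by (rule noetherian_spaceD[OF assms]) (use cl dec in \<open>auto simp: closedin_final_topology\<close>)
  then obtain n where n: "{p \<in> topspace X. q p \<in> B (Suc n)} = {p \<in> topspace X. q p \<in> B n}" ..
  \<comment> \<open>Closed sets of the final topology lie in the image of \<open>q\<close>, so their
    preimages determine them.\<close>
  have "B k = q ` {p \<in> topspace X. q p \<in> B k}" for k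
    using cl by (auto simp: closedin_final_topology)
  with n show "\<exists>n. B (Suc n) = B n" by metis
qed

text \<open>Infinite descent: a closed set that is no finite union of irreducible ones is reducible,
  and one of its two pieces is again no such union. The empty set is covered by the empty
  family.\<close>

lemma noetherian_space_irreducible_decomposition:
  assumes X: "noetherian_space X" and "closedin X A"
  shows "\<exists>\<Z>. finite \<Z> \<and> (\<forall>Z\<in>\<Z>. irreducible_closedin X Z) \<and> A = \<Union>\<Z>"
proof (rule ccontr)
  define P where "P A \<longleftrightarrow> (\<exists>\<Z>. finite \<Z> \<and> (\<forall>Z\<in>\<Z>. irreducible_closedin X Z) \<and> A = \<Union>\<Z>)" for A
  have PI: "P (\<Union>\<Z>)" if "finite \<Z>" "\<forall>Z\<in>\<Z>. irreducible_closedin X Z" for \<Z>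
    using that unfolding P_def by blast
  assume "\<not> ?thesis"
  then have "\<not> P A" by (simp add: P_def)
  have step: "\<exists>B. (closedin X B \<and> \<not> P B) \<and> B \<subset> A" if A: "closedin X A" "\<not> P A" for A
  proof -
    have "A \<noteq> {}" using A(2) PI[of "{}"] by auto
    moreover have "\<not> irreducible_closedin X A"
      using A(2) PI[of "{A}"] by auto
    ultimately obtain B C where BC: "closedin X B" "closedin X C" "A \<subseteq> B \<union> C" "\<not> A \<subseteq> B" "\<not> A \<subseteq> C"
      using A(1) unfolding irreducible_closedin_def by metis
    have "\<not> (P (A \<inter> B) \<and> P (A \<inter> C))"
    proof
      assume "P (A \<inter> B) \<and> P (A \<inter> C)"
      then obtain Y Z where YZ: "finite Y \<and> (\<forall>Z\<in>Y. irreducible_closedin X Z) \<and> A \<inter> B = \<Union>Y"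
        "finite Z \<and> (\<forall>Z\<in>Z. irreducible_closedin X Z) \<and> A \<inter> C = \<Union>Z"
        unfolding P_def by metis
      have "\<Union>(Y \<union> Z) = A"
        using YZ BC(3) by (metis Union_Un_distrib inf.absorb1 Int_Un_distrib)
      moreover have "\<forall>W\<in>Y \<union> Z. irreducible_closedin X W" using YZ by (metis UnE)
      ultimately show False using A(2) PI[of "Y \<union> Z"] YZ by (metis finite_UnI)
    qed
    moreover have "A \<inter> B \<subset> A" "A \<inter> C \<subset> A" using BC(4,5) by auto
    moreover have "closedin X (A \<inter> B)" "closedin X (A \<inter> C)" using A(1) BC(1,2) by auto
    ultimately show ?thesis by blast
  qed
  have "\<exists>f. \<forall>n. (closedin X (f n) \<and> \<not> P (f n)) \<and> f (Suc n) \<subset> f n"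
  proof (rule dependent_nat_choice)
    show "\<exists>B. closedin X B \<and> \<not> P B" using \<open>\<not> P A\<close> \<open>closedin X A\<close> by blast
  next
    fix B and n :: nat assume "closedin X B \<and> \<not> P B"
    then show "\<exists>B'. (closedin X B' \<and> \<not> P B') \<and> B' \<subset> B" using step[of B] by blast
  qed
  then obtain f where f: "\<forall>n. (closedin X (f n) \<and> \<not> P (f n)) \<and> f (Suc n) \<subset> f n" ..
  then have "\<exists>n. f (Suc n) = f n" by (intro noetherian_spaceD[OF X]) (simp_all add: less_imp_le)
  then show False using f by (metis psubset_eq)
qed

lemma irreducible_closedin_finite_Union:
  assumes "irreducible_closedin X Z" "finite \<Y>" "\<And>Y. Y \<in> \<Y> \<Longrightarrow> closedin X Y" "Z \<subseteq> \<Union>\<Y>"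
  shows "\<exists>Y\<in>\<Y>. Z \<subseteq> Y"
  using assms(2,3,4)
proof (induction \<Y>)
  case empty
  then show ?case using assms(1) by (auto simp: irreducible_closedin_def)
next
  case (insert Y \<Y>)
  then have "closedin X (\<Union>\<Y>)" by (intro closedin_Union) auto
  then have "Z \<subseteq> Y \<or> Z \<subseteq> \<Union>\<Y>"
    using insert.prems assms(1) unfolding irreducible_closedin_def by (metis Union_insert insertI1)
  then show ?case using insert by blast
qed

text \<open>
  A general member \<open>H\<close> of \<open>\<H>\<close> contains no irreducible component of \<open>Y\<close>, so each chain in
  \<open>Y \<inter> H\<close> can be extended by a component of \<open>Y\<close>.
\<close>

lemma irreducible_chain_if_sections_meet:
  assumes X: "noetherian_space X"
    and closed: "\<And>H. H \<in> \<H> \<Longrightarrow> closedin X (topspace X \<inter> H)"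
    and avoid: "\<And>S. finite S \<Longrightarrow> S \<subseteq> topspace X \<Longrightarrow> \<exists>H\<in>\<H>. H \<inter> S = {}"
    and "closedin X Y"
    and meet: "\<And>H. (\<And>i::nat. i < n \<Longrightarrow> H i \<in> \<H>) \<Longrightarrow> Y \<inter> (\<Inter>i<n. H i) \<noteq> {}"
  shows "\<exists>Z :: nat \<Rightarrow> 'a set. (\<forall>i\<le>n. irreducible_closedin X (Z i) \<and> Z i \<subseteq> Y) \<and> (\<forall>i<n. Z i \<subset> Z (Suc i))"
  using assms(4,5)
proof (induction n arbitrary: Y)
  case 0
  then obtain \<Z> where \<Z>: "\<forall>Z\<in>\<Z>. irreducible_closedin X Z" "Y = \<Union>\<Z>"
    using noetherian_space_irreducible_decomposition[OF X] by blast
  from 0 \<Z> obtain Z where "Z \<in> \<Z>" by fastforce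
  then show ?case using \<Z> by (auto intro!: exI[of _ "\<lambda>_. Z"])
next
  case (Suc n)
  obtain \<Z> where \<Z>: "finite \<Z>" "\<forall>Z\<in>\<Z>. irreducible_closedin X Z" "Y = \<Union>\<Z>"
    using noetherian_space_irreducible_decomposition[OF X Suc.prems(1)] by blast
  then have "\<forall>Z\<in>\<Z>. \<exists>p. p \<in> Z" unfolding irreducible_closedin_def by blast
  \<comment> \<open>One point of each component: a section that misses all of them contains no
    component.\<close>
  then obtain pt where pt: "\<And>Z. Z \<in> \<Z> \<Longrightarrow> pt Z \<in> Z" by metis
  have "pt ` \<Z> \<subseteq> topspace X"
    using pt \<Z>(2) closedin_subset unfolding irreducible_closedin_def by blast
  then obtain H where H: "H \<in> \<H>" "H \<inter> pt ` \<Z> = {}" using avoid \<Z>(1) by (metis finite_imageI)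
  have "Y \<inter> H = Y \<inter> (topspace X \<inter> H)"
    using closedin_subset[OF Suc.prems(1)] by blast
  then have "closedin X (Y \<inter> H)" using closed[OF H(1)] Suc.prems(1) by (metis closedin_Int)
  moreover have "(Y \<inter> H) \<inter> (\<Inter>i<n. H' i) \<noteq> {}" if "\<And>i. i < n \<Longrightarrow> H' i \<in> \<H>" for H'
  proof -
    \<comment> \<open>The chosen \<open>H\<close> takes the last of the \<open>Suc n\<close> places,
      and the other \<open>n\<close> sections are arbitrary.\<close>
    have "Y \<inter> (\<Inter>i<Suc n. if i < n then H' i else H) \<noteq> {}"
      using that H(1) by (intro Suc.prems(2)) auto
    moreover have "(\<Inter>i<Suc n. if i < n then H' i else H) \<subseteq> H \<inter> (\<Inter>i<n. H' i)"
      by (force simp: lessThan_Suc)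
    ultimately show ?thesis by blast
  qed
  ultimately obtain Z where Z: "\<And>i. i \<le> n \<Longrightarrow> irreducible_closedin X (Z i) \<and> Z i \<subseteq> Y \<inter> H"
      "\<And>i. i < n \<Longrightarrow> Z i \<subset> Z (Suc i)"
    using Suc.IH by metis
  obtain Z' where Z': "Z' \<in> \<Z>" "Z n \<subseteq> Z'"
    using irreducible_closedin_finite_Union[of X "Z n" \<Z>] Z(1)[of n] \<Z>
    unfolding irreducible_closedin_def by blast
  have "Z n \<noteq> Z'" using Z(1)[of n] H(2) pt[OF Z'(1)] Z'(1) by blast
  then have "Z n \<subset> Z'" using Z'(2) by blast
  moreover have "Z' \<subseteq> Y" using Z'(1) \<Z>(3) by blast
  ultimately show ?case
    using Z Z'(1) \<Z>(2) by (intro exI[of _ "Z(Suc n := Z')"]) (auto simp: le_Suc_eq less_Suc_eq)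
qed

section \<open>The Hilbert basis theorem\<close>

definition ideal_upto :: "'a::comm_ring_1 set \<Rightarrow> (nat \<Rightarrow> 'a) \<Rightarrow> nat \<Rightarrow> 'a set" where
  "ideal_upto R f n = {\<Sum>i<n. r i * f i | r. \<forall>i<n. r i \<in> R}"

definition subring :: "'a::comm_ring_1 set \<Rightarrow> bool" where
  "subring R \<longleftrightarrow> 1 \<in> R \<and> (\<forall>x\<in>R. \<forall>y\<in>R. x - y \<in> R) \<and> (\<forall>x\<in>R. \<forall>y\<in>R. x * y \<in> R)"

text \<open>Rings are carriers inside a type because \<open>polyfuns C\<close> is a set of
  functions. For a subring the condition amounts to the ascending chain condition on ideals, in the
  form that applies directly to descending chains of zero sets.\<close>

definition noetherian_subring :: "'a::comm_ring_1 set \<Rightarrow> bool" where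
  "noetherian_subring R \<longleftrightarrow> (\<forall>f. range f \<subseteq> R \<longrightarrow> (\<exists>n. f n \<in> ideal_upto R f n))"

definition polys_over :: "'a::comm_ring_1 set \<Rightarrow> 'a poly set" where
  "polys_over R = {p. \<forall>i. coeff p i \<in> R}"

lemma subringD:
  assumes "subring R"
  shows "1 \<in> R" "0 \<in> R" "x \<in> R \<Longrightarrow> y \<in> R \<Longrightarrow> x - y \<in> R" "x \<in> R \<Longrightarrow> y \<in> R \<Longrightarrow> x * y \<in> R"
    "x \<in> R \<Longrightarrow> - x \<in> R" "x \<in> R \<Longrightarrow> y \<in> R \<Longrightarrow> x + y \<in> R"
proof -
  show 0: "0 \<in> R" using assms unfolding subring_def by (metis diff_self)
  have m: "- x \<in> R" if "x \<in> R" for x using that 0 assms unfolding subring_def by (metis diff_0)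
  show "x \<in> R \<Longrightarrow> y \<in> R \<Longrightarrow> x + y \<in> R" using m assms unfolding subring_def by (metis diff_minus_eq_add)
  show "1 \<in> R" "x \<in> R \<Longrightarrow> y \<in> R \<Longrightarrow> x - y \<in> R" "x \<in> R \<Longrightarrow> y \<in> R \<Longrightarrow> x * y \<in> R"
    using assms by (simp_all add: subring_def)
  show "x \<in> R \<Longrightarrow> - x \<in> R" by (fact m)
qed

lemma subring_sum:
  assumes "subring R" "\<And>i. i \<in> I \<Longrightarrow> f i \<in> R"
  shows "sum f I \<in> R"
  using assms(2) by (induction I rule: infinite_finite_induct) (auto simp: subringD[OF assms(1)])

lemma subring_polys_over:
  assumes "subring R"
  shows "subring (polys_over R)"
  unfolding subring_def polys_over_def
  by (auto simp: coeff_mult subringD[OF assms] intro!: subring_sum[OF assms])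

lemma ideal_upto_diff:
  assumes "subring R" "x \<in> ideal_upto R f n" "y \<in> ideal_upto R f n"
  shows "x - y \<in> ideal_upto R f n"
proof -
  obtain r s where "\<forall>i<n. r i \<in> R" "\<forall>i<n. s i \<in> R" "x = (\<Sum>i<n. r i * f i)" "y = (\<Sum>i<n. s i * f i)"
    using assms unfolding ideal_upto_def by blast
  then show ?thesis unfolding ideal_upto_def
    by (auto intro!: exI[of _ "\<lambda>i. r i - s i"] simp: subringD[OF assms(1)] algebra_simps sum_subtractf)
qed

lemma ideal_upto_0: "subring R \<Longrightarrow> 0 \<in> ideal_upto R f n"
  by (auto simp: ideal_upto_def subringD intro!: exI[of _ "\<lambda>_. 0"])

lemma ideal_upto_add:
  assumes "subring R" "x \<in> ideal_upto R f n" "y \<in> ideal_upto R f n"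
  shows "x + y \<in> ideal_upto R f n"
  using ideal_upto_diff[OF assms(1,2) ideal_upto_diff[OF assms(1) ideal_upto_0[OF assms(1)] assms(3)]]
  by simp

lemma ideal_upto_mult:
  assumes "subring R" "a \<in> R" "x \<in> ideal_upto R f n"
  shows "a * x \<in> ideal_upto R f n"
proof -
  obtain r where "\<forall>i<n. r i \<in> R" "x = (\<Sum>i<n. r i * f i)"
    using assms unfolding ideal_upto_def by blast
  then show ?thesis unfolding ideal_upto_def
    by (auto intro!: exI[of _ "\<lambda>i. a * r i"] simp: assms(2) subringD[OF assms(1)] sum_distrib_left mult.assoc)
qed

lemma ideal_upto_sum:
  assumes "subring R" "\<And>i. i \<in> I \<Longrightarrow> g i \<in> ideal_upto R f n"
  shows "sum g I \<in> ideal_upto R f n"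
  using assms(2)
  by (induction I rule: infinite_finite_induct) (auto simp: ideal_upto_0[OF assms(1)] ideal_upto_add[OF assms(1)])

lemma ideal_upto_mono:
  assumes "subring R" "m \<le> n"
  shows "ideal_upto R f m \<subseteq> ideal_upto R f n"
proof
  fix x assume "x \<in> ideal_upto R f m"
  then obtain r where r: "\<forall>i<m. r i \<in> R" "x = (\<Sum>i<m. r i * f i)"
    unfolding ideal_upto_def by blast
  have "x = (\<Sum>i<n. (if i < m then r i else 0) * f i)"
    unfolding r(2) using assms(2) by (intro sum.mono_neutral_cong_left) auto
  then show "x \<in> ideal_upto R f n"
    unfolding ideal_upto_def using r(1) subringD(2)[OF assms(1)]
    by (auto intro!: exI[of _ "\<lambda>i. if i < m then r i else 0"])
qed

lemma ideal_upto_generator: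
  assumes "subring R" "i < n"
  shows "f i \<in> ideal_upto R f n"
proof -
  have "f i = (\<Sum>k<n. (if k = i then 1 else 0) * f k)" using assms(2) by (simp add: if_distrib if_distribR cong: if_cong)
  then show ?thesis unfolding ideal_upto_def using subringD(1,2)[OF assms(1)]
    by (auto intro!: exI[of _ "\<lambda>k. if k = i then 1 else 0"])
qed

lemma ideal_upto_subset:
  assumes "subring R" "\<And>i. i < m \<Longrightarrow> g i \<in> ideal_upto R f n"
  shows "ideal_upto R g m \<subseteq> ideal_upto R f n"
proof
  fix x assume "x \<in> ideal_upto R g m"
  then obtain r where r: "\<forall>i<m. r i \<in> R" "x = (\<Sum>i<m. r i * g i)"
    unfolding ideal_upto_def by blast
  show "x \<in> ideal_upto R f n"
    unfolding r(2) by (intro ideal_upto_sum ideal_upto_mult assms) (use r(1) in auto)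
qed

text \<open>Let \<open>J\<close> be an ideal without finite generation and choose \<open>f n\<close>
  of least degree in \<open>J\<close> outside the ideal of the earlier choices. If the leading
  coefficient of \<open>f n\<close> is a combination of the earlier ones, the leading term of
  \<open>f n\<close> can be cancelled inside \<open>J\<close>, against the choice of
  \<open>f n\<close>.\<close>

theorem noetherian_subring_polys_over:
  assumes R: "subring R" and N: "noetherian_subring R"
  shows "noetherian_subring (polys_over R)"
proof (rule ccontr)
  let ?P = "polys_over R"
  note P = subring_polys_over[OF R]
  assume "\<not> noetherian_subring ?P"
  then obtain g where g: "\<And>n. g n \<in> ?P" "\<And>n. g n \<notin> ideal_upto ?P g n"
    unfolding noetherian_subring_def by blast
  define J where "J = (\<Union>n. ideal_upto ?P g n)"
  have Jfin: "\<exists>n. \<forall>i<m. f i \<in> ideal_upto ?P g n" if "\<forall>i<m. f i \<in> J" for f and m :: nat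
    using that
  proof (induction m)
    case (Suc m)
    then obtain n k where "\<forall>i<m. f i \<in> ideal_upto ?P g n" "f m \<in> ideal_upto ?P g k"
      unfolding J_def by auto
    then have "\<forall>i<Suc m. f i \<in> ideal_upto ?P g (max n k)"
      using ideal_upto_mono[OF P, of n "max n k" g] ideal_upto_mono[OF P, of k "max n k" g]
      by (auto simp: less_Suc_eq)
    then show ?case by blast
  qed auto
  have Jproper: "\<exists>h. h \<in> J \<and> h \<notin> ideal_upto ?P f m" if f: "\<forall>i<m. f i \<in> J" for f and m :: nat
  proof -
    obtain n where "\<forall>i<m. f i \<in> ideal_upto ?P g n" using Jfin[OF f] by blast
    then have "ideal_upto ?P f m \<subseteq> ideal_upto ?P g n" by (intro ideal_upto_subset[OF P]) auto
    moreover have "g n \<in> J" unfolding J_def using ideal_upto_generator[OF P, of n "Suc n" g] by blast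
    ultimately show ?thesis using g(2) by blast
  qed
  have JP: "J \<subseteq> ?P"
    unfolding J_def ideal_upto_def by (auto intro!: subring_sum[OF P] subringD(4)[OF P] g(1))
  define new where "new xs p \<longleftrightarrow> p \<in> J \<and> p \<notin> ideal_upto ?P (\<lambda>i. xs ! i) (length xs)" for xs p
  define Pick where "Pick xs = arg_min degree (new xs)" for xs
  have Pick: "new xs (Pick xs)" "\<And>h. new xs h \<Longrightarrow> degree (Pick xs) \<le> degree h" if "set xs \<subseteq> J" for xs
  proof -
    have "\<exists>h. new xs h" unfolding new_def using that by (intro Jproper) auto
    then show "new xs (Pick xs)" unfolding Pick_def by (metis arg_min_natI)
    show "\<And>h. new xs h \<Longrightarrow> degree (Pick xs) \<le> degree h"
      unfolding Pick_def by (rule arg_min_nat_le)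
  qed
  \<comment> \<open>Every choice depends on all earlier ones, so the recursion carries their
    list.\<close>
  define xs where "xs n = rec_nat [] (\<lambda>_ ys. ys @ [Pick ys]) n" for n
  define f where "f n = Pick (xs n)" for n
  have xs_Suc: "xs (Suc n) = xs n @ [f n]" "xs 0 = []" for n by (simp_all add: xs_def f_def)
  have xs: "xs n = map f [0..<n]" for n by (induction n) (simp_all add: xs_Suc)
  have setxs: "set (xs n) \<subseteq> J" for n
    by (induction n) (use Pick(1) in \<open>auto simp: xs_Suc f_def new_def\<close>)
  have new_xs: "new (xs n) p \<longleftrightarrow> p \<in> J \<and> p \<notin> ideal_upto ?P f n" for n p
    unfolding new_def ideal_upto_def by (simp add: xs)
  have fJ: "f n \<in> J" and fn: "f n \<notin> ideal_upto ?P f n" for n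
    using Pick(1)[OF setxs[of n]] unfolding new_xs f_def by blast+
  have fmin: "degree (f n) \<le> degree h" if "h \<in> J" "h \<notin> ideal_upto ?P f n" for n h
    using Pick(2)[OF setxs[of n]] that unfolding new_xs f_def by blast
  have "range (\<lambda>n. lead_coeff (f n)) \<subseteq> R" using fJ JP unfolding polys_over_def by auto
  then obtain n where "lead_coeff (f n) \<in> ideal_upto R (\<lambda>n. lead_coeff (f n)) n"
    using N unfolding noetherian_subring_def by blast
  then obtain r where r: "\<And>i. i < n \<Longrightarrow> r i \<in> R" "lead_coeff (f n) = (\<Sum>i<n. r i * lead_coeff (f i))"
    unfolding ideal_upto_def by blast
  define d where "d = degree (f n)"
  \<comment> \<open>\<open>f n\<close> was already a candidate when \<open>f i\<close> was chosen.
    Hence multiplication by the monomial \<open>q i\<close> can lift the leading term of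
    \<open>f i\<close> to degree \<open>d\<close>.\<close>
  have d: "degree (f i) \<le> d" if "i < n" for i
    unfolding d_def using that fn[of n] ideal_upto_mono[OF P, of i n f] by (intro fmin fJ) auto
  define q where "q i = monom (r i) (d - degree (f i))" for i
  have qP: "q i \<in> ?P" if "i < n" for i
    using r(1)[OF that] subringD(2)[OF R] by (simp add: q_def polys_over_def)
  define c where "c = (\<Sum>i<n. q i * f i)"
  define h where "h = f n - c"
  have c: "c \<in> ideal_upto ?P f n" unfolding c_def ideal_upto_def using qP by blast
  obtain k where "\<forall>i<Suc n. f i \<in> ideal_upto ?P g k" using Jfin[of "Suc n" f] fJ by blast
  then have k: "f n \<in> ideal_upto ?P g k" "ideal_upto ?P f n \<subseteq> ideal_upto ?P g k"
    using ideal_upto_subset[OF P, of n f g k] by auto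
  then have "h \<in> J" unfolding h_def J_def using ideal_upto_diff[OF P] c by blast
  moreover have hn: "h \<notin> ideal_upto ?P f n"
    using ideal_upto_add[OF P _ c, of h] fn[of n] by (auto simp: h_def)
  ultimately have deg: "d \<le> degree h" unfolding d_def by (rule fmin)
  have cf: "coeff (q i * f i) d = r i * lead_coeff (f i)" if "i < n" for i
    using d[OF that] coeff_monom_mult[of "r i" "d - degree (f i)" "f i" d] by (simp add: q_def)
  have "coeff h d = 0"
    using r(2) cf unfolding h_def c_def coeff_diff coeff_sum d_def by simp
  moreover have "degree (q i * f i) \<le> d" if "i < n" for i
    using degree_mult_le[of "q i" "f i"] degree_monom_le[of "r i" "d - degree (f i)"] d[OF that]
    unfolding q_def by linarith
  then have "degree h \<le> d" unfolding h_def c_def d_def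
    by (intro degree_diff_le degree_sum_le) auto
  \<comment> \<open>\<open>h\<close> has degree at least \<open>d\<close> by the choice of
    \<open>f n\<close> and at most \<open>d\<close> by construction, but its coefficient at
    \<open>d\<close> vanishes.\<close>
  ultimately have "h = 0" using deg by (metis le_antisym leading_coeff_0_iff)
  then show False using hn ideal_upto_0[OF P] by simp
qed

lemma noetherian_subring_image:
  fixes \<phi> :: "'a::comm_ring_1 \<Rightarrow> 'b::comm_ring_1"
  assumes "noetherian_subring R"
    and "\<And>x y. \<phi> (x * y) = \<phi> x * \<phi> y" "\<And>x y. \<phi> (x + y) = \<phi> x + \<phi> y" "\<phi> 0 = 0"
  shows "noetherian_subring (\<phi> ` R)"
  unfolding noetherian_subring_def
proof (intro allI impI)
  fix f :: "nat \<Rightarrow> 'b" assume "range f \<subseteq> \<phi> ` R"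
  then have "\<forall>n. \<exists>x. x \<in> R \<and> f n = \<phi> x" by blast
  then obtain g where g: "\<And>n. g n \<in> R" "\<And>n. f n = \<phi> (g n)" by metis
  then have "range g \<subseteq> R" by blast
  then obtain n r where r: "\<forall>i<n. r i \<in> R" "g n = (\<Sum>i<n. r i * g i)"
    using assms(1) unfolding noetherian_subring_def ideal_upto_def by blast
  have "\<phi> (\<Sum>i\<in>I. r i * g i) = (\<Sum>i\<in>I. \<phi> (r i) * f i)" if "finite I" for I
    using that by induction (simp_all add: assms g(2))
  then have "f n = (\<Sum>i<n. \<phi> (r i) * f i)" using g(2)[of n] r(2) by simp
  then show "\<exists>n. f n \<in> ideal_upto (\<phi> ` R) f n"
    unfolding ideal_upto_def using r(1) by (intro exI[of _ n] CollectI exI[of _ "\<lambda>i. \<phi> (r i)"]) simp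
qed

section \<open>Finitely generated algebras of functions and their Zariski topology\<close>

lemma polyfuns_uminus: "f \<in> polyfuns C \<Longrightarrow> (\<lambda>p. - f p) \<in> polyfuns C"
  using polyfuns.mult[OF polyfuns.const[of "-1"]] by fastforce

lemma subring_polyfuns: "subring (polyfuns C)"
proof -
  have "f - g \<in> polyfuns C" if "f \<in> polyfuns C" "g \<in> polyfuns C" for f g
    using polyfuns.add[OF that(1) polyfuns_uminus[OF that(2)]] by (simp add: fun_diff_def)
  then show ?thesis
    unfolding subring_def by (auto simp: one_fun_def times_fun_def intro: polyfuns.intros)
qed

text \<open>This reduces inductions over the generators to polynomials in one variable over the
  smaller algebra, both for the Noetherian property and for the extension of characters.\<close>

lemma polyfuns_insert: "polyfuns (insert x C) = (\<lambda>p. poly p x) ` polys_over (polyfuns C)" (is "?L = ?R")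
proof
  note P = subring_polys_over[OF subring_polyfuns[of C]]
  note S = subringD[OF subring_polyfuns[of C]]
  have const: "f \<in> ?R" if "f \<in> polyfuns C" for f
    by (rule image_eqI[of _ _ "[:f:]"]) (use that S in \<open>auto simp: polys_over_def coeff_pCons split: nat.split\<close>)
  show "?L \<subseteq> ?R"
  proof
    fix f assume "f \<in> ?L"
    then show "f \<in> ?R"
    proof induction
      case (coord f)
      have "x \<in> ?R"
        by (rule image_eqI[of _ _ "[:0, 1:]"]) (use S in \<open>auto simp: polys_over_def coeff_pCons split: nat.split\<close>)
      then show ?case using coord const polyfuns.coord by blast
    next
      case (const c)
      then show ?case using polyfuns.const \<open>\<And>f. f \<in> polyfuns C \<Longrightarrow> f \<in> ?R\<close> by blast
    next
      case (add f g)
      then obtain p q where "p \<in> polys_over (polyfuns C)" "q \<in> polys_over (polyfuns C)" "f = poly p x" "g = poly q x" by blast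
      then show ?case using subringD(6)[OF P, of p q] by (intro image_eqI[of _ _ "p + q"]) (auto simp: plus_fun_def)
    next
      case (mult f g)
      then obtain p q where "p \<in> polys_over (polyfuns C)" "q \<in> polys_over (polyfuns C)" "f = poly p x" "g = poly q x" by blast
      then show ?case using subringD(4)[OF P, of p q] by (intro image_eqI[of _ _ "p * q"]) (auto simp: times_fun_def)
    qed
  qed
  show "?R \<subseteq> ?L"
  proof
    fix f assume "f \<in> ?R"
    then obtain p where p: "p \<in> polys_over (polyfuns C)" "f = poly p x" by blast
    have mono: "h \<in> polyfuns (insert x C)" if "h \<in> polyfuns C" for h
      using that by induction (auto intro: polyfuns.intros)
    note S' = subringD[OF subring_polyfuns[of "insert x C"]]
    have "x ^ i \<in> polyfuns (insert x C)" for i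
      by (induction i) (simp_all add: one_fun_def times_fun_def polyfuns.const polyfuns.mult polyfuns.coord)
    moreover have "coeff p i \<in> polyfuns (insert x C)" for i
      using p(1) by (intro mono) (simp add: polys_over_def)
    ultimately show "f \<in> ?L"
      unfolding p(2) poly_altdef by (intro subring_sum[OF subring_polyfuns] S'(4))
  qed
qed

lemma noetherian_subring_polyfuns: "finite C \<Longrightarrow> noetherian_subring (polyfuns C)"
proof (induction C rule: finite_induct)
  case empty
  have const: "\<exists>c. f = (\<lambda>_. c)" if "f \<in> polyfuns {}" for f :: "'a \<Rightarrow> complex"
    using that by induction auto
  show ?case
    unfolding noetherian_subring_def
  proof (intro allI impI)
    fix f :: "nat \<Rightarrow> 'a \<Rightarrow> complex" assume f: "range f \<subseteq> polyfuns {}"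
    have "f n \<in> polyfuns {}" for n using f by blast
    then obtain a b where ab: "f 0 = (\<lambda>_. a)" "f 1 = (\<lambda>_. b)" using const by metis
    \<comment> \<open>The constants form a field: either \<open>f 0\<close> is zero and lies in the
      ideal of no generators, or it divides \<open>f 1\<close>.\<close>
    show "\<exists>n. f n \<in> ideal_upto (polyfuns {}) f n"
    proof (cases "a = 0")
      case True
      then have "f 0 \<in> ideal_upto (polyfuns {}) f 0"
        using ab ideal_upto_0[OF subring_polyfuns] by (simp add: zero_fun_def)
      then show ?thesis ..
    next
      case False
      then have "f 1 = (\<lambda>_. b / a) * f 0" using ab by (simp add: times_fun_def)
      also have "\<dots> \<in> ideal_upto (polyfuns {}) f 1"
        by (intro ideal_upto_mult ideal_upto_generator subring_polyfuns polyfuns.const) simp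
      finally show ?thesis ..
    qed
  qed
next
  case (insert x C)
  show ?case unfolding polyfuns_insert
    by (intro noetherian_subring_image noetherian_subring_polys_over subring_polyfuns insert.IH) auto
qed

lemma closedin_zariski:
  fixes A :: "'a set"
  shows "closedin (zariski C) A \<longleftrightarrow> (\<exists>F \<subseteq> polyfuns C. A = {p. \<forall>f\<in>F. f p = 0})"
proof -
  have "UNIV - A = {p. \<exists>f\<in>F. f p \<noteq> 0} \<longleftrightarrow> A = {p. \<forall>f\<in>F. f p = 0}" for F :: "('a \<Rightarrow> complex) set"
    by (auto simp: set_eq_iff)
  then show ?thesis by (simp add: closedin_def openin_zariski)
qed

text \<open>A strict descent yields functions \<open>f n\<close> that vanish on
  \<open>A (Suc n)\<close> but not at a point \<open>p n\<close> of \<open>A n\<close>. All earlier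
  functions vanish at \<open>p n\<close>, so no \<open>f n\<close> is a combination of them.\<close>

lemma noetherian_space_zariski:
  assumes "finite C"
  shows "noetherian_space (zariski C)"
  unfolding noetherian_space_def
proof (intro allI impI, rule ccontr)
  fix A :: "nat \<Rightarrow> 'a set"
  assume cl: "\<forall>n. closedin (zariski C) (A n)" and dec: "\<forall>n. A (Suc n) \<subseteq> A n"
    and neq: "\<nexists>n. A (Suc n) = A n"
  have "\<forall>n. \<exists>f p. f \<in> polyfuns C \<and> p \<in> A n \<and> f p \<noteq> 0 \<and> (\<forall>x\<in>A (Suc n). f x = 0)"
  proof
    fix n
    obtain F where F: "F \<subseteq> polyfuns C" "A (Suc n) = {p. \<forall>f\<in>F. f p = 0}"
      using cl unfolding closedin_zariski by blast
    moreover obtain p where "p \<in> A n" "p \<notin> A (Suc n)" using dec neq by blast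
    ultimately show "\<exists>f p. f \<in> polyfuns C \<and> p \<in> A n \<and> f p \<noteq> 0 \<and> (\<forall>x\<in>A (Suc n). f x = 0)" by blast
  qed
  then obtain f p where f: "\<And>n. f n \<in> polyfuns C" "\<And>n. p n \<in> A n" "\<And>n. f n (p n) \<noteq> 0"
      "\<And>n x. x \<in> A (Suc n) \<Longrightarrow> f n x = 0" by metis
  then have "range f \<subseteq> polyfuns C" by blast
  then obtain n where "f n \<in> ideal_upto (polyfuns C) f n"
    using noetherian_subring_polyfuns[OF assms] unfolding noetherian_subring_def by blast
  then obtain r where r: "f n = (\<Sum>i<n. r i * f i)" unfolding ideal_upto_def by blast
  have "f i (p n) = 0" if "i < n" for i
  proof -
    have "A n \<subseteq> A (Suc i)" using dec that by (simp add: lift_Suc_antimono_le)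
    then show ?thesis using f(2,4) by blast
  qed
  moreover have "(\<Sum>i\<in>I. r i * f i) x = (\<Sum>i\<in>I. r i x * f i x)" if "finite I" for I x
    using that by induction (auto simp: zero_fun_def)
  ultimately have "f n (p n) = 0" unfolding r by simp
  then show False using f(3) by blast
qed

section \<open>Polynomial functions\<close>

lemma polyfuns_sum:
  assumes "\<And>i. i \<in> I \<Longrightarrow> f i \<in> polyfuns C"
  shows "(\<lambda>p. \<Sum>i\<in>I. f i p) \<in> polyfuns C"
  using assms by (induction I rule: infinite_finite_induct) (auto intro: polyfuns.intros)

lemma polyfuns_prod:
  assumes "\<And>i. i \<in> I \<Longrightarrow> f i \<in> polyfuns C"
  shows "(\<lambda>p. \<Prod>i\<in>I. f i p) \<in> polyfuns C"
  using assms by (induction I rule: infinite_finite_induct) (auto intro: polyfuns.intros)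

lemma polyfuns_diff: "f \<in> polyfuns C \<Longrightarrow> g \<in> polyfuns C \<Longrightarrow> (\<lambda>p. f p - g p) \<in> polyfuns C"
  using subringD(3)[OF subring_polyfuns, of f C g] by (simp add: fun_diff_def)

lemma polyfuns_det:
  assumes "\<And>i j. (\<lambda>p. A p $ i $ j) \<in> polyfuns C"
  shows "(\<lambda>p. det (A p :: complex^'n^'n)) \<in> polyfuns C"
  unfolding det_def by (intro polyfuns_sum polyfuns.mult polyfuns.const polyfuns_prod assms)

lemma polyfuns_compose:
  assumes "f \<in> polyfuns D" "\<And>c. c \<in> D \<Longrightarrow> (\<lambda>x. c (F x)) \<in> polyfuns C"
  shows "(\<lambda>x. f (F x)) \<in> polyfuns C"
  using assms(1) by induction (auto intro: polyfuns.intros assms(2))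

lemma polyfuns_mono: "f \<in> polyfuns C \<Longrightarrow> C \<subseteq> D \<Longrightarrow> f \<in> polyfuns D"
  using polyfuns_compose[of f C "\<lambda>x. x" D] by (auto intro: polyfuns.coord)

lemma polyfuns_tendsto:
  assumes "f \<in> polyfuns C" "\<And>c. c \<in> C \<Longrightarrow> ((\<lambda>n. c (p n)) \<longlongrightarrow> c q) G"
  shows "((\<lambda>n. f (p n)) \<longlongrightarrow> f q) G"
  using assms(1) by induction (auto intro: assms(2) tendsto_intros)

text \<open>The parameter spaces are treated as real vector spaces, so lines are real; a nonzero
  polynomial has only finitely many zeros on real parameters as well.\<close>

lemma polyfuns_line:
  fixes x y :: "'a::real_vector"
  assumes "f \<in> polyfuns C" "\<And>c. c \<in> C \<Longrightarrow> linear c"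
  shows "\<exists>P. \<forall>r::real. f (x + r *\<^sub>R (y - x)) = poly P (of_real r)"
  using assms(1)
proof induction
  case (coord c)
  have "c (x + r *\<^sub>R (y - x)) = poly [:c x, c (y - x):] (of_real r)" for r
    using assms(2)[OF coord] by (simp add: linear_add linear_scale scaleR_conv_of_real)
  then show ?case by blast
next
  case (const c)
  then show ?case by (intro exI[of _ "[:c:]"]) simp
next
  case (add f g)
  then obtain P Q where "\<forall>r::real. f (x + r *\<^sub>R (y - x)) = poly P (of_real r)"
    "\<forall>r::real. g (x + r *\<^sub>R (y - x)) = poly Q (of_real r)" by blast
  then show ?case by (intro exI[of _ "P + Q"]) simp
next
  case (mult f g)
  then obtain P Q where "\<forall>r::real. f (x + r *\<^sub>R (y - x)) = poly P (of_real r)"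
    "\<forall>r::real. g (x + r *\<^sub>R (y - x)) = poly Q (of_real r)" by blast
  then show ?case by (intro exI[of _ "P * Q"]) simp
qed

lemma polyfuns_line_finite_zeros:
  fixes x y :: "'a::real_vector"
  assumes "f \<in> polyfuns C" "\<And>c. c \<in> C \<Longrightarrow> linear c" "f y \<noteq> 0"
  shows "finite {r::real. f (x + r *\<^sub>R (y - x)) = 0}"
proof -
  obtain P where P: "\<forall>r::real. f (x + r *\<^sub>R (y - x)) = poly P (of_real r)"
    using polyfuns_line[OF assms(1,2)] by blast
  from P[rule_format, of 1] assms(3) have "P \<noteq> 0" by auto
  then have "finite ((of_real :: real \<Rightarrow> complex) -` {z. poly P z = 0})"
    by (intro finite_vimageI poly_roots_finite) (auto simp: inj_on_def)
  then show ?thesis using P by (simp add: vimage_def)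
qed

lemma polyfuns_no_zero_divisors:
  fixes f g :: "'a::real_vector \<Rightarrow> complex"
  assumes lin: "\<And>c. c \<in> C \<Longrightarrow> linear c" and fg: "f \<in> polyfuns C" "g \<in> polyfuns C"
    and nz: "f x \<noteq> 0" "g y \<noteq> 0"
  shows "\<exists>z. f z \<noteq> 0 \<and> g z \<noteq> 0"
proof -
  have "finite {r::real. f (y + r *\<^sub>R (x - y)) = 0}" "finite {r::real. g (x + r *\<^sub>R (y - x)) = 0}"
    using polyfuns_line_finite_zeros[OF _ lin] fg nz by blast+
  \<comment> \<open>The line through \<open>x\<close> and \<open>y\<close> is parametrised from
    opposite ends for \<open>f\<close> and for \<open>g\<close>, hence the reflection.\<close>
  then have "finite ((\<lambda>r. 1 - r) ` {r::real. f (y + r *\<^sub>R (x - y)) = 0} \<union> {r::real. g (x + r *\<^sub>R (y - x)) = 0})"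
    by simp
  then obtain r :: real where r: "r \<notin> (\<lambda>r. 1 - r) ` {r::real. f (y + r *\<^sub>R (x - y)) = 0}"
      "r \<notin> {r::real. g (x + r *\<^sub>R (y - x)) = 0}"
    by (metis UnCI ex_new_if_finite infinite_UNIV_char_0)
  have "y + (1 - r) *\<^sub>R (x - y) = x + r *\<^sub>R (y - x)" by (simp add: algebra_simps)
  moreover have "f (y + (1 - r) *\<^sub>R (x - y)) \<noteq> 0"
    using r(1) by (metis (mono_tags, lifting) diff_diff_eq2 add_diff_cancel_left' image_eqI mem_Collect_eq)
  ultimately have "f (x + r *\<^sub>R (y - x)) \<noteq> 0" by simp
  then show ?thesis using r(2) by blast
qed

text \<open>Any point can be approached along its line towards \<open>y\<close>, on which
  \<open>f\<close> has finitely many zeros.\<close>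

lemma polyfuns_nonzero_dense:
  fixes f :: "'a::real_normed_vector \<Rightarrow> complex"
  assumes lin: "\<And>c. c \<in> C \<Longrightarrow> linear c" and f: "f \<in> polyfuns C" and nz: "f y \<noteq> 0"
  shows "closure {z. f z \<noteq> 0} = UNIV"
proof -
  have "x \<in> closure {z. f z \<noteq> 0}" for x
  proof -
    have "finite {r::real. f (x + r *\<^sub>R (y - x)) = 0}"
      using polyfuns_line_finite_zeros[OF f lin nz] .
    then have "\<forall>\<^sub>F r in at (0::real). f (x + r *\<^sub>R (y - x)) \<noteq> 0"
      using islimpt_finite[of "{r::real. f (x + r *\<^sub>R (y - x)) = 0}" 0] by (simp add: islimpt_iff_eventually)
    moreover have "((\<lambda>r. x + r *\<^sub>R (y - x)) \<longlongrightarrow> x + 0 *\<^sub>R (y - x)) (at (0::real))"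
      by (intro tendsto_intros)
    moreover from calculation(1) have "\<forall>\<^sub>F r in at (0::real). x + r *\<^sub>R (y - x) \<in> closure {z. f z \<noteq> 0}"
      by (rule eventually_mono) (rule subsetD[OF closure_subset], simp)
    ultimately show ?thesis
      using Lim_in_closed_set[of "closure {z. f z \<noteq> 0}" "\<lambda>r. x + r *\<^sub>R (y - x)" "at (0::real)" x] by simp
  qed
  then show ?thesis by blast
qed

section \<open>Extension of characters\<close>

text \<open>Division with remainder where \<open>lead_coeff d\<close> need not be invertible: each
  step multiplies the dividend by it once more.\<close>

lemma polys_over_pseudo_division:
  assumes R: "subring R" and d: "d \<in> polys_over R" "d \<noteq> 0" and "q \<in> polys_over R"
  shows "\<exists>k s r. s \<in> polys_over R \<and> r \<in> polys_over R \<and>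
           smult (lead_coeff d ^ k) q = s * d + r \<and> (r = 0 \<or> degree r < degree d)"
  using assms(4)
proof (induction "degree q" arbitrary: q rule: less_induct)
  case less
  note P = subringD[OF subring_polys_over[OF R]]
  let ?a = "lead_coeff d"
  show ?case
  proof (cases "q = 0 \<or> degree q < degree d")
    case True
    then show ?thesis using less.prems P(2) by (intro exI[of _ 0] exI[of _ q]) auto
  next
    case False
    define t where "t = monom (lead_coeff q) (degree q - degree d)"
    define q' where "q' = smult ?a q - t * d"
    have aR: "?a \<in> R" using d(1) by (simp add: polys_over_def)
    have powR: "?a ^ k \<in> R" for k by (induction k) (auto intro: subringD[OF R] aR)
    have smultP: "smult b p \<in> polys_over R" if "b \<in> R" "p \<in> polys_over R" for b p
      using that by (auto simp: polys_over_def intro: subringD[OF R])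
    have tP: "t \<in> polys_over R"
      using less.prems subringD(2)[OF R] by (auto simp: t_def polys_over_def)
    have q'P: "q' \<in> polys_over R"
      unfolding q'_def by (intro P(3,4) smultP aR less.prems tP d(1))
    have "degree (t * d) \<le> degree q"
      using degree_mult_le[of t d] degree_monom_le[of "lead_coeff q" "degree q - degree d"] False
      unfolding t_def by linarith
    then have "degree q' \<le> degree q"
      unfolding q'_def by (intro degree_diff_le order.trans[OF degree_smult_le]) auto
    moreover have "coeff q' (degree q) = 0"
      using coeff_monom_mult[of "lead_coeff q" "degree q - degree d" d "degree q"] False
      by (simp add: q'_def t_def mult.commute)
    ultimately have "q' = 0 \<or> degree q' < degree q"
      by (metis le_neq_implies_less leading_coeff_0_iff)
    then show ?thesis
    proof
      assume "q' = 0"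
      then have "smult (?a ^ 1) q = t * d + 0" by (simp add: q'_def)
      then show ?thesis using tP P(2) by blast
    next
      assume "degree q' < degree q"
      from less.hyps[OF this q'P] obtain k s r where ksr: "s \<in> polys_over R" "r \<in> polys_over R"
        "smult (?a ^ k) q' = s * d + r" "r = 0 \<or> degree r < degree d" by blast
      have "smult (?a ^ Suc k) q = smult (?a ^ k) q' + smult (?a ^ k) t * d"
        by (simp add: q'_def algebra_simps smult_diff_right)
      also have "\<dots> = (s + smult (?a ^ k) t) * d + r" using ksr(3) by (simp add: algebra_simps)
      finally show ?thesis using ksr smultP[OF powR tP] P(6) by blast
    qed
  qed
qed

text \<open>A homomorphism of complex algebras from \<open>polyfuns C\<close> to the complex
  numbers, with arbitrary values elsewhere. It stands for a point of the variety whose coordinate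
  ring is \<open>polyfuns C\<close>.\<close>

definition character :: "('p \<Rightarrow> complex) set \<Rightarrow> (('p \<Rightarrow> complex) \<Rightarrow> complex) \<Rightarrow> bool" where
  "character C \<phi> \<longleftrightarrow> (\<forall>c. \<phi> (\<lambda>_. c) = c) \<and>
     (\<forall>f\<in>polyfuns C. \<forall>g\<in>polyfuns C. \<phi> (f + g) = \<phi> f + \<phi> g \<and> \<phi> (f * g) = \<phi> f * \<phi> g)"

lemma characterD:
  assumes "character C \<phi>"
  shows "\<phi> (\<lambda>_. c) = c" "\<phi> 0 = 0" "\<phi> 1 = 1"
    "f \<in> polyfuns C \<Longrightarrow> g \<in> polyfuns C \<Longrightarrow> \<phi> (f + g) = \<phi> f + \<phi> g"
    "f \<in> polyfuns C \<Longrightarrow> g \<in> polyfuns C \<Longrightarrow> \<phi> (f * g) = \<phi> f * \<phi> g"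
  using assms by (auto simp: character_def zero_fun_def one_fun_def)

lemma character_sum:
  assumes "character C \<phi>" "\<And>i. i \<in> I \<Longrightarrow> f i \<in> polyfuns C"
  shows "\<phi> (sum f I) = (\<Sum>i\<in>I. \<phi> (f i))"
  using assms(2)
  by (induction I rule: infinite_finite_induct)
    (simp_all add: characterD[OF assms(1)] subring_sum[OF subring_polyfuns] del: plus_fun_apply)

lemma character_map_poly:
  assumes \<phi>: "character C \<phi>" and pq: "p \<in> polys_over (polyfuns C)" "q \<in> polys_over (polyfuns C)"
  shows "map_poly \<phi> (p + q) = map_poly \<phi> p + map_poly \<phi> q"
    "map_poly \<phi> (p * q) = map_poly \<phi> p * map_poly \<phi> q"
proof -
  have R: "coeff p i \<in> polyfuns C" "coeff q i \<in> polyfuns C" for i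
    using pq by (auto simp: polys_over_def)
  note coeff = coeff_map_poly[of \<phi>, OF characterD(2)[OF \<phi>]]
  show "map_poly \<phi> (p + q) = map_poly \<phi> p + map_poly \<phi> q"
    by (rule poly_eqI) (simp add: coeff characterD(4)[OF \<phi>] R)
  have "\<phi> (coeff p i * coeff q j) = \<phi> (coeff p i) * \<phi> (coeff q j)" for i j
    by (intro characterD(5)[OF \<phi>] R)
  moreover have "coeff p i * coeff q j \<in> polyfuns C" for i j
    by (intro subringD(4)[OF subring_polyfuns] R)
  ultimately show "map_poly \<phi> (p * q) = map_poly \<phi> p * map_poly \<phi> q"
    by (intro poly_eqI) (simp add: coeff coeff_mult character_sum[OF \<phi>])
qed

text \<open>Sending \<open>x\<close> to \<open>c\<close> is well defined because two polynomials
  that represent the same function differ by a relation of \<open>x\<close>, and \<open>ker\<close>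
  says that relations are sent to zero.\<close>

lemma character_insert:
  assumes \<phi>: "character C \<phi>"
    and ker: "\<And>q. q \<in> polys_over (polyfuns C) \<Longrightarrow> poly q x = 0 \<Longrightarrow> poly (map_poly \<phi> q) c = 0"
  shows "\<exists>\<psi>. character (insert x C) \<psi> \<and>
           (\<forall>q\<in>polys_over (polyfuns C). \<psi> (poly q x) = poly (map_poly \<phi> q) c)"
proof -
  let ?P = "polys_over (polyfuns C)"
  note P = subringD[OF subring_polys_over[OF subring_polyfuns[of C]]]
  define \<psi> where "\<psi> f = poly (map_poly \<phi> (SOME q. q \<in> ?P \<and> poly q x = f)) c" for f
  have \<psi>: "\<psi> (poly q x) = poly (map_poly \<phi> q) c" if q: "q \<in> ?P" for q
  proof -
    define q' where "q' = (SOME q'. q' \<in> ?P \<and> poly q' x = poly q x)"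
    have q': "q' \<in> ?P" "poly q' x = poly q x"
      unfolding q'_def using someI[of "\<lambda>q'. q' \<in> ?P \<and> poly q' x = poly q x" q] q by auto
    have "poly (map_poly \<phi> (q' - q)) c = 0"
      using q q' by (intro ker P(3)) auto
    moreover have "map_poly \<phi> q' = map_poly \<phi> (q' - q) + map_poly \<phi> q"
      using character_map_poly(1)[OF \<phi> P(3)[OF q'(1) q] q] by simp
    ultimately show ?thesis unfolding \<psi>_def q'_def[symmetric] by simp
  qed
  have "\<psi> (\<lambda>_. a) = a" for a
  proof -
    have "[:\<lambda>_. a:] \<in> ?P"
      using subringD(2)[OF subring_polyfuns[of C]] by (auto simp: polys_over_def coeff_pCons polyfuns.const split: nat.split)
    moreover have "map_poly \<phi> [:\<lambda>_. a:] = [:a:]"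
      by (rule poly_eqI) (simp add: coeff_map_poly characterD[OF \<phi>] coeff_pCons split: nat.split)
    ultimately show ?thesis using \<psi>[of "[:\<lambda>_. a:]"] by simp
  qed
  moreover have "\<psi> (f + g) = \<psi> f + \<psi> g \<and> \<psi> (f * g) = \<psi> f * \<psi> g"
    if fg: "f \<in> polyfuns (insert x C)" "g \<in> polyfuns (insert x C)" for f g
  proof -
    obtain p q where pq: "p \<in> ?P" "q \<in> ?P" "f = poly p x" "g = poly q x"
      using fg unfolding polyfuns_insert by blast
    then show ?thesis
      using \<psi>[OF P(6)[OF pq(1,2)]] \<psi>[OF P(4)[OF pq(1,2)]] \<psi>[OF pq(1)] \<psi>[OF pq(2)]
      by (simp add: character_map_poly[OF \<phi> pq(1,2)])
  qed
  ultimately have "character (insert x C) \<psi>" unfolding character_def by blast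
  with \<psi> show ?thesis by blast
qed

text \<open>
  If \<open>x\<close> is transcendental over \<open>polyfuns C\<close> then its value can be chosen freely. Otherwise it has to
  be a root of the image of a minimal polynomial \<open>m\<close>, and \<open>\<psi> g \<noteq> 0\<close> is ensured by a multiple \<open>g0\<close>
  of \<open>g\<close> that lies in \<open>polyfuns C\<close>.
\<close>

lemma character_extension_step:
  assumes dom: "\<And>f g. f \<in> polyfuns (insert x C) \<Longrightarrow> g \<in> polyfuns (insert x C) \<Longrightarrow> f * g = 0 \<Longrightarrow> f = 0 \<or> g = 0"
    and g: "g \<in> polyfuns (insert x C)" "g \<noteq> 0"
  shows "\<exists>g'\<in>polyfuns C. g' \<noteq> 0 \<and> (\<forall>\<phi>. character C \<phi> \<longrightarrow> \<phi> g' \<noteq> 0 \<longrightarrow>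
           (\<exists>\<psi>. character (insert x C) \<psi> \<and> (\<forall>f\<in>polyfuns C. \<psi> f = \<phi> f) \<and> \<psi> g \<noteq> 0))"
proof -
  let ?R = "polyfuns C" and ?P = "polys_over (polyfuns C)"
  note R = subringD[OF subring_polyfuns[of C]]
  note P = subringD[OF subring_polys_over[OF subring_polyfuns[of C]]]
  have lift: "poly p x \<in> polyfuns (insert x C)" if "p \<in> ?P" for p
    using that unfolding polyfuns_insert by blast
  have RC: "f \<in> polyfuns (insert x C)" if "f \<in> ?R" for f using polyfuns_mono[OF that] by blast
  have constP: "[:f:] \<in> ?P" if "f \<in> ?R" for f
    using that R(2) by (auto simp: polys_over_def coeff_pCons split: nat.split)
  have coeffR: "coeff p i \<in> ?R" if "p \<in> ?P" for p i using that by (simp add: polys_over_def)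
  have power_R: "a ^ k \<in> ?R" if "a \<in> ?R" for a k
    by (induction k) (auto intro: R that simp del: one_fun_apply times_fun_apply)
  have power_nz: "a ^ k \<noteq> 0" if "a \<noteq> 0" "a \<in> ?R" for a k
  proof (induction k)
    case 0
    then show ?case by (metis power_0 zero_neq_one)
  next
    case (Suc k)
    then show ?case using dom[OF RC RC, OF that(2) power_R[OF that(2)]] that(1) by (metis power_Suc)
  qed
  have restrict: "\<forall>f\<in>?R. \<psi> f = \<phi> f"
    if "character C \<phi>" "\<forall>q\<in>?P. \<psi> (poly q x) = poly (map_poly \<phi> q) c" for \<phi> \<psi> c
  proof
    fix f assume "f \<in> ?R"
    moreover have "map_poly \<phi> [:f:] = [:\<phi> f:]"
      by (rule poly_eqI) (simp add: coeff_map_poly characterD(2)[OF that(1)] coeff_pCons split: nat.split)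
    ultimately show "\<psi> f = \<phi> f" using that(2) constP by fastforce
  qed
  show ?thesis
  proof (cases "\<forall>p\<in>?P. poly p x = 0 \<longrightarrow> p = 0")
    case True
    obtain q where q: "q \<in> ?P" "g = poly q x" using g(1) unfolding polyfuns_insert by blast
    then have "q \<noteq> 0" using g(2) by auto
    have "\<exists>\<psi>. character (insert x C) \<psi> \<and> (\<forall>f\<in>?R. \<psi> f = \<phi> f) \<and> \<psi> g \<noteq> 0"
      if \<phi>: "character C \<phi>" "\<phi> (lead_coeff q) \<noteq> 0" for \<phi>
    proof -
      have "coeff (map_poly \<phi> q) (degree q) \<noteq> 0"
        using \<phi> by (simp add: coeff_map_poly characterD(2))
      then have "map_poly \<phi> q \<noteq> 0" by auto
      \<comment> \<open>Any non-root of the image of \<open>q\<close> may be the value of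
        \<open>x\<close>; such a \<open>c\<close> exists because the leading coefficient of
        \<open>q\<close> is not sent to zero.\<close>
      then obtain c where c: "poly (map_poly \<phi> q) c \<noteq> 0" using poly_all_0_iff_0 by blast
      have "poly (map_poly \<phi> p) c = 0" if "p \<in> ?P" "poly p x = 0" for p
        using True that by auto
      then obtain \<psi> where \<psi>: "character (insert x C) \<psi>" "\<forall>q\<in>?P. \<psi> (poly q x) = poly (map_poly \<phi> q) c"
        using character_insert[OF \<phi>(1)] by blast
      then show ?thesis using restrict[OF \<phi>(1) \<psi>(2)] c q by auto
    qed
    moreover have "lead_coeff q \<noteq> 0" using \<open>q \<noteq> 0\<close> by simp
    ultimately show ?thesis using coeffR[OF q(1)] by blast
  next
    case False
    then obtain m where m: "m \<in> ?P" "poly m x = 0" "m \<noteq> 0"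
      and m_le: "\<And>p. p \<in> ?P \<Longrightarrow> poly p x = 0 \<Longrightarrow> p \<noteq> 0 \<Longrightarrow> degree m \<le> degree p"
      using ex_has_least_nat[of "\<lambda>p. p \<in> ?P \<and> poly p x = 0 \<and> p \<noteq> 0" _ degree] by metis
    have m_min: "p = 0" if "p \<in> ?P" "poly p x = 0" "degree p < degree m" for p
      using m_le that by (meson not_le)
    let ?a = "lead_coeff m"
    have a: "?a \<in> ?R" "?a \<noteq> 0" using coeffR[OF m(1)] m(3) by auto
    \<comment> \<open>Up to powers of \<open>?a\<close> the relations of \<open>x\<close> are the
      multiples of \<open>m\<close>. This is enough at characters with
      \<open>\<phi> ?a \<noteq> 0\<close>.\<close>
    have div_m: "\<exists>k s. s \<in> ?P \<and> smult (?a ^ k) q = s * m" if q: "q \<in> ?P" "poly q x = 0" for q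
    proof -
      obtain k s r where ksr: "s \<in> ?P" "r \<in> ?P" "smult (?a ^ k) q = s * m + r" "r = 0 \<or> degree r < degree m"
        using polys_over_pseudo_division[OF subring_polyfuns m(1,3) q(1)] by blast
      have "poly (smult (?a ^ k) q) x = poly (s * m + r) x" using ksr(3) by simp
      then have "poly r x = 0" using q(2) m(2) by simp
      then have "r = 0" using ksr(2,4) m_min by blast
      then show ?thesis using ksr by auto
    qed
    \<comment> \<open>\<open>Q q\<close> says that \<open>q\<close> represents a nonzero multiple of
      \<open>g\<close>. One of least degree turns out to be constant, so it gives a multiple of
      \<open>g\<close> in \<open>polyfuns C\<close>.\<close>
    define Q where "Q q \<longleftrightarrow> q \<in> ?P \<and> poly q x \<noteq> 0 \<and> (\<exists>h\<in>polyfuns (insert x C). poly q x = h * g)" for q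
    have "\<exists>q. Q q"
    proof -
      obtain q where "q \<in> ?P" "g = poly q x" using g(1) unfolding polyfuns_insert by blast
      then show ?thesis unfolding Q_def using g(2) subringD(1)[OF subring_polyfuns]
        by (metis mult_1)
    qed
    then obtain q where "Q q" and q_min: "\<And>p. Q p \<Longrightarrow> degree q \<le> degree p"
      using ex_has_least_nat[of Q _ degree] by metis
    then obtain h where q: "q \<in> ?P" "poly q x \<noteq> 0" "h \<in> polyfuns (insert x C)" "poly q x = h * g"
      unfolding Q_def by blast
    have Q_mult: "Q r" if r: "r \<in> ?P" "poly r x \<noteq> 0" "poly r x = poly t x * poly q x" "t \<in> ?P" for r t
    proof -
      have "poly r x = (poly t x * h) * g" using r(3) q(4) by (simp add: mult.assoc)
      then show ?thesis unfolding Q_def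
        using r subringD(4)[OF subring_polyfuns lift[OF r(4)] q(3)] by blast
    qed
    have qm: "degree q < degree m"
    proof (rule ccontr)
      assume "\<not> degree q < degree m"
      obtain k s r where ksr: "s \<in> ?P" "r \<in> ?P" "smult (?a ^ k) q = s * m + r" "r = 0 \<or> degree r < degree m"
        using polys_over_pseudo_division[OF subring_polyfuns m(1,3) q(1)] by blast
      have "poly (smult (?a ^ k) q) x = poly (s * m + r) x" using ksr(3) by simp
      then have r: "poly r x = ?a ^ k * poly q x" using m(2) by simp
      have ak: "?a ^ k \<in> ?R" using power_R[OF a(1)] .
      have "poly r x \<noteq> 0"
        unfolding r using dom[OF RC[OF ak] lift[OF q(1)]] power_nz[OF a(2,1)] q(2) by blast
      moreover have "poly r x = poly [:?a ^ k:] x * poly q x" using r by simp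
      ultimately have "Q r" using Q_mult[OF ksr(2)] constP[OF ak] by blast
      then have "degree q \<le> degree r" by (rule q_min)
      moreover have "r \<noteq> 0" using \<open>poly r x \<noteq> 0\<close> by auto
      ultimately show False using ksr(4) \<open>\<not> degree q < degree m\<close> by simp
    qed
    have "q \<noteq> 0" using q(2) by auto
    \<comment> \<open>Otherwise divide \<open>m\<close> by \<open>q\<close>. The remainder
      represents a multiple of \<open>poly q x\<close> and has smaller degree, so it is zero; the
      quotient is then a relation of degree below that of \<open>m\<close>, so it is zero too, and
      \<open>m\<close> would vanish.\<close>
    have q0: "degree q = 0"
    proof (rule ccontr)
      assume "degree q \<noteq> 0"
      let ?b = "lead_coeff q"
      have b: "?b \<in> ?R" "?b \<noteq> 0" using coeffR[OF q(1)] \<open>q \<noteq> 0\<close> by auto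
      obtain k s r where ksr: "s \<in> ?P" "r \<in> ?P" "smult (?b ^ k) m = s * q + r" "r = 0 \<or> degree r < degree q"
        using polys_over_pseudo_division[OF subring_polyfuns q(1) \<open>q \<noteq> 0\<close> m(1)] by blast
      have "poly (smult (?b ^ k) m) x = poly (s * q + r) x" using ksr(3) by simp
      then have r: "poly r x = poly (- s) x * poly q x" using m(2) by (simp add: eq_neg_iff_add_eq_0 add.commute)
      have "poly r x = 0"
      proof (rule ccontr)
        assume "poly r x \<noteq> 0"
        then have "Q r" by (rule Q_mult[OF ksr(2) _ r P(5)[OF ksr(1)]])
        then show False using q_min[of r] ksr(4) \<open>poly r x \<noteq> 0\<close> by auto
      qed
      then have "r = 0" using m_min[OF ksr(2)] ksr(4) qm by fastforce
      have "poly s x * poly q x = 0" using r \<open>poly r x = 0\<close> by simp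
      then have "poly s x = 0" using dom[OF lift[OF ksr(1)] lift[OF q(1)]] q(2) by blast
      have "s = 0"
      proof (rule ccontr)
        assume "s \<noteq> 0"
        then have "lead_coeff s * ?b \<noteq> 0"
          using dom[OF RC[OF coeffR[OF ksr(1)]] RC[OF b(1)]] b(2) by (metis leading_coeff_0_iff)
        then have "coeff (smult (?b ^ k) m) (degree s + degree q) \<noteq> 0"
          using ksr(3) \<open>r = 0\<close> by (simp add: coeff_mult_degree_sum)
        then have "degree s + degree q \<le> degree m"
          using le_degree degree_smult_le order.trans by blast
        then show False using m_min[OF ksr(1) \<open>poly s x = 0\<close>] \<open>s \<noteq> 0\<close> \<open>degree q \<noteq> 0\<close> by linarith
      qed
      then have "smult (?b ^ k) m = 0" using ksr(3) \<open>r = 0\<close> by simp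
      then have "?b ^ k * ?a = 0" by (metis coeff_smult coeff_0)
      then show False
        using dom[OF RC[OF power_R[OF b(1)]] RC[OF a(1)]] power_nz[OF b(2,1)] a(2) by blast
    qed
    define g0 where "g0 = coeff q 0"
    have "q = [:g0:]" unfolding g0_def using q0 by (metis degree_0_id)
    then have "poly q x = g0" by simp
    then have g0: "g0 \<in> ?R" "g0 \<noteq> 0" "g0 = h * g"
      using q(2,4) coeffR[OF q(1), of 0] g0_def by metis+
    \<comment> \<open>The factor \<open>?a\<close> keeps the image of \<open>m\<close> nonconstant,
      so that a root \<open>c\<close> exists, and the factor \<open>g0 = h * g\<close> forces
      \<open>\<psi> g \<noteq> 0\<close>.\<close>
    have "\<exists>\<psi>. character (insert x C) \<psi> \<and> (\<forall>f\<in>?R. \<psi> f = \<phi> f) \<and> \<psi> g \<noteq> 0"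
      if \<phi>: "character C \<phi>" "\<phi> (?a * g0) \<noteq> 0" for \<phi>
    proof -
      note \<phi>D = characterD[OF \<phi>(1)]
      have nz: "\<phi> ?a \<noteq> 0" "\<phi> g0 \<noteq> 0" using \<phi>(2) \<phi>D(5)[OF a(1) g0(1)] by auto
      have "degree m \<noteq> 0" using qm by simp
      moreover have "coeff (map_poly \<phi> m) (degree m) \<noteq> 0"
        using nz by (simp add: coeff_map_poly \<phi>D)
      then have "degree m \<le> degree (map_poly \<phi> m)" by (rule le_degree)
      ultimately have "\<not> constant (poly (map_poly \<phi> m))" by (simp add: constant_degree)
      then obtain c where c: "poly (map_poly \<phi> m) c = 0" using fundamental_theorem_of_algebra by blast
      have "poly (map_poly \<phi> p) c = 0" if p: "p \<in> ?P" "poly p x = 0" for p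
      proof -
        obtain k s where ks: "s \<in> ?P" "smult (?a ^ k) p = s * m" using div_m[OF p] by blast
        have ak: "?a ^ k \<in> ?R" "\<phi> (?a ^ k) = \<phi> ?a ^ k" for k
          by (rule power_R[OF a(1)])
            (induction k, metis \<phi>D(3) power_0, metis \<phi>D(5)[OF a(1) power_R[OF a(1)]] power_Suc)
        have "map_poly \<phi> (smult (?a ^ k) p) = smult (\<phi> ?a ^ k) (map_poly \<phi> p)"
          by (rule poly_eqI) (use ak in \<open>simp add: coeff_map_poly \<phi>D(2) \<phi>D(5)[OF _ coeffR[OF p(1)]] del: times_fun_apply\<close>)
        moreover have "poly (map_poly \<phi> (s * m)) c = 0"
          using c by (simp add: character_map_poly[OF \<phi>(1) ks(1) m(1)])
        ultimately show ?thesis using nz(1) ks(2) by simp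
      qed
      then obtain \<psi> where \<psi>: "character (insert x C) \<psi>" "\<forall>q\<in>?P. \<psi> (poly q x) = poly (map_poly \<phi> q) c"
        using character_insert[OF \<phi>(1)] by blast
      have "\<psi> g0 = \<psi> h * \<psi> g" unfolding g0(3) by (rule characterD(5)[OF \<psi>(1) q(3) g(1)])
      then show ?thesis using restrict[OF \<phi>(1) \<psi>(2)] \<psi>(1) nz(2) g0(1) by auto
    qed
    moreover have "?a * g0 \<noteq> 0" using dom[OF RC[OF a(1)] RC[OF g0(1)]] a(2) g0(2) by blast
    ultimately show ?thesis using R(4)[OF a(1) g0(1)] by blast
  qed
qed

text \<open>Each step trades a nonvanishing condition on the larger algebra for one on the smaller
  algebra, so the elements of \<open>D\<close> can be adjoined one by one. Geometrically, the image
  of a dominant map contains the set where \<open>g'\<close> does not vanish.\<close>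

lemma character_extension:
  assumes "finite D"
    and dom: "\<And>f g. f \<in> polyfuns (D \<union> C) \<Longrightarrow> g \<in> polyfuns (D \<union> C) \<Longrightarrow> f * g = 0 \<Longrightarrow> f = 0 \<or> g = 0"
    and g: "g \<in> polyfuns (D \<union> C)" "g \<noteq> 0"
  shows "\<exists>g'\<in>polyfuns C. g' \<noteq> 0 \<and> (\<forall>\<phi>. character C \<phi> \<longrightarrow> \<phi> g' \<noteq> 0 \<longrightarrow>
           (\<exists>\<psi>. character (D \<union> C) \<psi> \<and> (\<forall>f\<in>polyfuns C. \<psi> f = \<phi> f) \<and> \<psi> g \<noteq> 0))"
  using assms
proof (induction D arbitrary: g rule: finite_induct)
  case empty
  then show ?case by auto
next
  case (insert x D)
  have "\<exists>g1\<in>polyfuns (D \<union> C). g1 \<noteq> 0 \<and> (\<forall>\<phi>. character (D \<union> C) \<phi> \<longrightarrow> \<phi> g1 \<noteq> 0 \<longrightarrow>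
      (\<exists>\<psi>. character (insert x (D \<union> C)) \<psi> \<and> (\<forall>f\<in>polyfuns (D \<union> C). \<psi> f = \<phi> f) \<and> \<psi> g \<noteq> 0))"
    by (rule character_extension_step[OF insert.prems[unfolded Un_insert_left]])
  then obtain g1 where g1: "g1 \<in> polyfuns (D \<union> C)" "g1 \<noteq> 0"
    "\<And>\<phi>. character (D \<union> C) \<phi> \<Longrightarrow> \<phi> g1 \<noteq> 0 \<Longrightarrow>
       \<exists>\<psi>. character (insert x (D \<union> C)) \<psi> \<and> (\<forall>f\<in>polyfuns (D \<union> C). \<psi> f = \<phi> f) \<and> \<psi> g \<noteq> 0"
    by metis
  have "f = 0 \<or> g = 0" if "f \<in> polyfuns (D \<union> C)" "g \<in> polyfuns (D \<union> C)" "f * g = 0" for f g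
    using insert.prems(1)[of f g] that polyfuns_mono[of _ "D \<union> C" "insert x D \<union> C"] by blast
  then have "\<exists>g'\<in>polyfuns C. g' \<noteq> 0 \<and> (\<forall>\<phi>. character C \<phi> \<longrightarrow> \<phi> g' \<noteq> 0 \<longrightarrow>
      (\<exists>\<psi>. character (D \<union> C) \<psi> \<and> (\<forall>f\<in>polyfuns C. \<psi> f = \<phi> f) \<and> \<psi> g1 \<noteq> 0))"
    by (rule insert.IH[OF _ g1(1,2)])
  then obtain g' where g': "g' \<in> polyfuns C" "g' \<noteq> 0"
    "\<And>\<phi>. character C \<phi> \<Longrightarrow> \<phi> g' \<noteq> 0 \<Longrightarrow>
       \<exists>\<psi>. character (D \<union> C) \<psi> \<and> (\<forall>f\<in>polyfuns C. \<psi> f = \<phi> f) \<and> \<psi> g1 \<noteq> 0"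
    by metis
  have sub: "f \<in> polyfuns (D \<union> C)" if "f \<in> polyfuns C" for f using polyfuns_mono[OF that] by blast
  have "\<exists>\<psi>. character (insert x (D \<union> C)) \<psi> \<and> (\<forall>f\<in>polyfuns C. \<psi> f = \<phi> f) \<and> \<psi> g \<noteq> 0"
    if "character C \<phi>" "\<phi> g' \<noteq> 0" for \<phi>
  proof -
    obtain \<psi> where \<psi>: "character (D \<union> C) \<psi>" "\<forall>f\<in>polyfuns C. \<psi> f = \<phi> f" "\<psi> g1 \<noteq> 0"
      using g'(3)[OF \<open>character C \<phi>\<close> \<open>\<phi> g' \<noteq> 0\<close>] by blast
    then show ?thesis using g1(3)[OF \<psi>(1,3)] sub by metis
  qed
  then show ?case unfolding Un_insert_left using g'(1,2) by blast
qed

text \<open>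
  If \<open>range F\<close> has an interior point then evaluation at any \<open>y\<close> is a character of the algebra
  generated by the components of \<open>F\<close>. For \<open>y\<close> in a dense set it extends to a character of the
  whole polynomial algebra, and that is evaluation at a preimage of \<open>y\<close>.
\<close>

theorem dense_polynomial_image:
  fixes F :: "'x::real_normed_vector \<Rightarrow> 'y::real_normed_vector"
  assumes CX: "finite CX" "\<And>c. c \<in> CX \<Longrightarrow> linear c" "\<And>\<phi>. \<exists>x. \<forall>c\<in>CX. c x = \<phi> c"
    and CY: "\<And>c. c \<in> CY \<Longrightarrow> linear c" "\<And>y z. (\<And>c. c \<in> CY \<Longrightarrow> c y = c z) \<Longrightarrow> y = z"
    and F: "\<And>c. c \<in> CY \<Longrightarrow> (\<lambda>x. c (F x)) \<in> polyfuns CX"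
    and int: "interior (range F) \<noteq> {}"
    and g: "g \<in> polyfuns CX" "g x0 \<noteq> 0"
  shows "closure (F ` {x. g x \<noteq> 0}) = UNIV"
proof -
  \<comment> \<open>The pulled back coordinates of the target. Adding them to \<open>CX\<close> does
    not enlarge the algebra but exhibits it as an extension of \<open>polyfuns C0\<close>.\<close>
  define C0 where "C0 = (\<lambda>c x. c (F x)) ` CY"
  have C0X: "f \<in> polyfuns CX" if "f \<in> polyfuns (CX \<union> C0)" for f
    using polyfuns_compose[OF that, of "\<lambda>x. x"] F by (auto simp: C0_def intro: polyfuns.coord)
  have dom: "f = 0 \<or> h = 0" if fh: "f \<in> polyfuns (CX \<union> C0)" "h \<in> polyfuns (CX \<union> C0)" "f * h = 0" for f h
  proof (rule ccontr)
    assume "\<not> (f = 0 \<or> h = 0)"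
    then obtain x y where "f x \<noteq> 0" "h y \<noteq> 0" by (auto simp: fun_eq_iff)
    then obtain z where "f z \<noteq> 0" "h z \<noteq> 0"
      using polyfuns_no_zero_divisors[OF CX(2) C0X[OF fh(1)] C0X[OF fh(2)]] by blast
    then have "(f * h) z \<noteq> 0" by simp
    with fh(3) show False by simp
  qed
  have g': "g \<in> polyfuns (CX \<union> C0)" "g \<noteq> 0"
    using polyfuns_mono[OF g(1), of "CX \<union> C0"] g(2) by auto
  have "\<exists>d\<in>polyfuns C0. d \<noteq> 0 \<and> (\<forall>\<phi>. character C0 \<phi> \<longrightarrow> \<phi> d \<noteq> 0 \<longrightarrow>
       (\<exists>\<psi>. character (CX \<union> C0) \<psi> \<and> (\<forall>f\<in>polyfuns C0. \<psi> f = \<phi> f) \<and> \<psi> g \<noteq> 0))"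
    by (rule character_extension[OF CX(1) _ g'(1,2)]) (rule dom)
  then obtain d where d: "d \<in> polyfuns C0" "d \<noteq> 0"
    "\<And>\<phi>. character C0 \<phi> \<Longrightarrow> \<phi> d \<noteq> 0 \<Longrightarrow>
       \<exists>\<psi>. character (CX \<union> C0) \<psi> \<and> (\<forall>f\<in>polyfuns C0. \<psi> f = \<phi> f) \<and> \<psi> g \<noteq> 0"
    by metis
  have pull: "\<exists>G\<in>polyfuns CY. f = (\<lambda>x. G (F x))" if "f \<in> polyfuns C0" for f
    using that
  proof induction
    case (coord f)
    then show ?case unfolding C0_def by (auto intro: polyfuns.coord)
  next
    case (const c)
    then show ?case by (auto intro!: bexI[OF _ polyfuns.const])
  next
    case (add f g)
    then obtain G H where "G \<in> polyfuns CY" "H \<in> polyfuns CY" "f = (\<lambda>x. G (F x))" "g = (\<lambda>x. H (F x))"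
      by blast
    then show ?case by (auto intro!: bexI[OF _ polyfuns.add[of G CY H]])
  next
    case (mult f g)
    then obtain G H where "G \<in> polyfuns CY" "H \<in> polyfuns CY" "f = (\<lambda>x. G (F x))" "g = (\<lambda>x. H (F x))"
      by blast
    then show ?case by (auto intro!: bexI[OF _ polyfuns.mult[of G CY H]])
  qed
  \<comment> \<open>The interior point enters here: a polynomial function that vanishes on a
    nonempty open set is zero, so pulling back along \<open>F\<close> is injective.\<close>
  have inj: "G y = H y" if "G \<in> polyfuns CY" "H \<in> polyfuns CY" "\<And>x. G (F x) = H (F x)" for G H y
  proof (rule ccontr)
    assume "G y \<noteq> H y"
    then have dense: "closure {z. G z - H z \<noteq> 0} = UNIV"
      by (intro polyfuns_nonzero_dense[OF CY(1) polyfuns_diff[OF that(1,2)], of y]) auto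
    have "interior (range F) \<inter> {z. G z - H z \<noteq> 0} = {}"
      using interior_subset[of "range F"] that(3) by auto
    then show False
      using int dense open_Int_closure_eq_empty[OF open_interior] by fastforce
  qed
  obtain \<Delta> where \<Delta>: "\<Delta> \<in> polyfuns CY" "d = (\<lambda>x. \<Delta> (F x))" using pull[OF d(1)] by blast
  from d(2) obtain x1 where "\<Delta> (F x1) \<noteq> 0" unfolding \<Delta>(2) by (auto simp: fun_eq_iff)
  then have dense: "closure {y. \<Delta> y \<noteq> 0} = UNIV"
    using polyfuns_nonzero_dense[OF CY(1) \<Delta>(1)] by blast
  have "y \<in> F ` {x. g x \<noteq> 0}" if y: "\<Delta> y \<noteq> 0" for y
  proof -
    \<comment> \<open>Evaluation at \<open>y\<close>, transported along the pullback;
      \<open>inj\<close> makes the choice of \<open>G\<close> irrelevant.\<close>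
    define \<phi> where "\<phi> f = (SOME G. G \<in> polyfuns CY \<and> f = (\<lambda>x. G (F x))) y" for f
    have \<phi>: "\<phi> (\<lambda>x. G (F x)) = G y" if "G \<in> polyfuns CY" for G
    proof -
      define H where "H = (SOME H. H \<in> polyfuns CY \<and> (\<lambda>x. G (F x)) = (\<lambda>x. H (F x)))"
      have "H \<in> polyfuns CY \<and> (\<lambda>x. G (F x)) = (\<lambda>x. H (F x))"
        unfolding H_def by (rule someI[of _ G]) (use that in simp)
      then have "H y = G y" using inj[of H G] that by metis
      then show ?thesis unfolding \<phi>_def H_def .
    qed
    have "character C0 \<phi>"
      unfolding character_def
    proof (intro conjI allI ballI)
      show "\<phi> (\<lambda>_. c) = c" for c using \<phi>[OF polyfuns.const[of c]] .
      fix f h assume "f \<in> polyfuns C0" "h \<in> polyfuns C0"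
      then obtain G H where GH: "G \<in> polyfuns CY" "H \<in> polyfuns CY" "f = (\<lambda>x. G (F x))" "h = (\<lambda>x. H (F x))"
        using pull by meson
      show "\<phi> (f + h) = \<phi> f + \<phi> h"
        using \<phi>[OF polyfuns.add[OF GH(1,2)]] \<phi>[OF GH(1)] \<phi>[OF GH(2)] unfolding GH(3,4) plus_fun_def by simp
      show "\<phi> (f * h) = \<phi> f * \<phi> h"
        using \<phi>[OF polyfuns.mult[OF GH(1,2)]] \<phi>[OF GH(1)] \<phi>[OF GH(2)] unfolding GH(3,4) times_fun_def by simp
    qed
    moreover have "\<phi> d \<noteq> 0" unfolding \<Delta>(2) \<phi>[OF \<Delta>(1)] using y .
    ultimately obtain \<psi> where \<psi>: "character (CX \<union> C0) \<psi>" "\<forall>f\<in>polyfuns C0. \<psi> f = \<phi> f" "\<psi> g \<noteq> 0"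
      using d(3) by blast
    \<comment> \<open>The coordinates in \<open>CX\<close> take arbitrary values independently of
      each other, so a point with the values prescribed by \<open>\<psi>\<close> exists.\<close>
    obtain x where x: "\<forall>c\<in>CX. c x = \<psi> c" using CX(3) by blast
    have eval: "\<psi> f = f x" if "f \<in> polyfuns CX" for f
      using that
    proof induction
      case (coord f)
      then show ?case using x by simp
    next
      case (const c)
      then show ?case using characterD(1)[OF \<psi>(1)] by simp
    next
      case (add f g)
      then show ?case
        using characterD(4)[OF \<psi>(1), of f g] polyfuns_mono[of _ CX "CX \<union> C0"] by (simp add: plus_fun_def)
    next
      case (mult f g)
      then show ?case
        using characterD(5)[OF \<psi>(1), of f g] polyfuns_mono[of _ CX "CX \<union> C0"] by (simp add: times_fun_def)
    qed
    have "F x = y"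
    proof (rule CY(2))
      fix c assume c: "c \<in> CY"
      have "c (F x) = \<psi> (\<lambda>x. c (F x))" using eval[OF F[OF c]] by simp
      also have "\<dots> = \<phi> (\<lambda>x. c (F x))"
        using \<psi>(2) c by (auto simp: C0_def intro: polyfuns.coord)
      also have "\<dots> = c y" by (rule \<phi>[OF polyfuns.coord[OF c]])
      finally show "c (F x) = c y" .
    qed
    moreover have "g x \<noteq> 0" using eval[OF g(1)] \<psi>(3) by simp
    ultimately show ?thesis by blast
  qed
  then have "{y. \<Delta> y \<noteq> 0} \<subseteq> F ` {x. g x \<noteq> 0}" by blast
  then show ?thesis using dense closure_mono by blast
qed

section \<open>Sums of five rank one tensors\<close>

lemma has_derivative_vec_lambda:
  fixes f :: "'a::real_normed_vector \<Rightarrow> 'n::finite \<Rightarrow> 'b::euclidean_space"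
  assumes "\<And>i. ((\<lambda>x. f x i) has_derivative (\<lambda>h. f' h i)) (at x)"
  shows "((\<lambda>x. \<chi> i. f x i) has_derivative (\<lambda>h. \<chi> i. f' h i)) (at x)"
  unfolding has_derivative_componentwise_within[of "\<lambda>x. \<chi> i. f x i"]
  by (auto simp: Basis_vec_def inner_axis intro!: has_derivative_inner_left assms)

type_synonym tensor_index = "3 \<times> 3 \<times> 3"

text \<open>
  A point of \<open>('i, 'j) config\<close> consists of the factors of rank one tensors \<open>x_i\<close>, of coefficients
  \<open>s_ji\<close> and of linear maps \<open>L_j\<close>. Its image \<open>(T, L, u)\<close> under \<open>config_map\<close> records that the span
  of the \<open>x_i\<close> contains \<open>T\<close> and lies in the hyperplane section given by \<open>L_j\<close> and \<open>u_j\<close>.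
\<close>

type_synonym ('i, 'j) config =
  "(complex^3^3^'i) \<times> (complex^'i^'j) \<times> (complex^(3 \<times> 3 \<times> 3)^'i option^'j)"

type_synonym ('i, 'j) target =
  "(3, 3, 3) tensor \<times> (complex^(3 \<times> 3 \<times> 3)^'i option^'j) \<times> (complex^'i option^'j)"

text \<open>In \<open>\<theta> $ i $ a $ k\<close> the index \<open>a\<close> selects one of the
  three tensor factors and \<open>k\<close> is a coordinate in it.\<close>

definition summand :: "complex^3^3^'i \<Rightarrow> 'i \<Rightarrow> (3, 3, 3) tensor" where
  "summand \<theta> i = tensor_prod (\<theta> $ i $ 1) (\<theta> $ i $ 2) (\<theta> $ i $ 3)"

definition summand_deriv :: "complex^3^3^'i \<Rightarrow> complex^3^3^'i \<Rightarrow> 'i \<Rightarrow> (3, 3, 3) tensor" where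
  "summand_deriv \<theta> h i = tensor_prod (h $ i $ 1) (\<theta> $ i $ 2) (\<theta> $ i $ 3) +
     tensor_prod (\<theta> $ i $ 1) (h $ i $ 2) (\<theta> $ i $ 3) + tensor_prod (\<theta> $ i $ 1) (\<theta> $ i $ 2) (h $ i $ 3)"

definition config_map :: "('i::finite, 'j::finite) config \<Rightarrow> ('i, 'j) target" where
  "config_map = (\<lambda>(\<theta>, s, L). (\<Sum>i\<in>UNIV. summand \<theta> i, L, \<chi> j. L $ j *v (\<Sum>i\<in>UNIV. s $ j $ i *s summand \<theta> i)))"

definition config_deriv :: "('i::finite, 'j::finite) config \<Rightarrow> ('i, 'j) config \<Rightarrow> ('i, 'j) target" where
  "config_deriv = (\<lambda>(\<theta>, s, L) (h, t, M). (\<Sum>i\<in>UNIV. summand_deriv \<theta> h i, M,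
     \<chi> j. M $ j *v (\<Sum>i\<in>UNIV. s $ j $ i *s summand \<theta> i) +
          L $ j *v (\<Sum>i\<in>UNIV. t $ j $ i *s summand \<theta> i + s $ j $ i *s summand_deriv \<theta> h i)))"

section \<open>The differential of the configuration map\<close>

lemma has_derivative_config_coords:
  "((\<lambda>p. fst p $ i $ a $ k) has_derivative (\<lambda>h. fst h $ i $ a $ k)) (at p)"
  "((\<lambda>p. fst (snd p) $ j $ i) has_derivative (\<lambda>h. fst (snd h) $ j $ i)) (at p)"
  "((\<lambda>p. snd (snd p) $ j $ r $ m) has_derivative (\<lambda>h. snd (snd h) $ j $ r $ m)) (at p)"
  for p :: "('i::finite, 'j::finite) config"
proof -
  have 1: "bounded_linear (\<lambda>p :: ('i, 'j) config. fst p)"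
    and 2: "bounded_linear (\<lambda>p :: ('i, 'j) config. fst (snd p))"
    and 3: "bounded_linear (\<lambda>p :: ('i, 'j) config. snd (snd p))"
    by (auto intro: bounded_linear_fst bounded_linear_snd bounded_linear_fst_comp bounded_linear_snd_comp)
  note vn = bounded_linear_compose[OF bounded_linear_vec_nth]
  show "((\<lambda>p. fst p $ i $ a $ k) has_derivative (\<lambda>h. fst h $ i $ a $ k)) (at p)"
    by (intro bounded_linear_imp_has_derivative vn 1)
  show "((\<lambda>p. fst (snd p) $ j $ i) has_derivative (\<lambda>h. fst (snd h) $ j $ i)) (at p)"
    by (intro bounded_linear_imp_has_derivative vn 2)
  show "((\<lambda>p. snd (snd p) $ j $ r $ m) has_derivative (\<lambda>h. snd (snd h) $ j $ r $ m)) (at p)"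
    by (intro bounded_linear_imp_has_derivative vn 3)
qed

lemma has_derivative_summand:
  fixes p :: "('i::finite, 'j::finite) config"
  shows "((\<lambda>p. summand (fst p) i $ m) has_derivative (\<lambda>h. summand_deriv (fst p) (fst h) i $ m)) (at p)"
proof -
  have "((\<lambda>p. fst p $ i $ 1 $ fst m * fst p $ i $ 2 $ fst (snd m) * fst p $ i $ 3 $ snd (snd m)) has_derivative
     (\<lambda>h. (fst p $ i $ 1 $ fst m * fst p $ i $ 2 $ fst (snd m)) * fst h $ i $ 3 $ snd (snd m) +
       (fst p $ i $ 1 $ fst m * fst h $ i $ 2 $ fst (snd m) + fst h $ i $ 1 $ fst m * fst p $ i $ 2 $ fst (snd m))
         * fst p $ i $ 3 $ snd (snd m))) (at p)"
    by (intro has_derivative_mult has_derivative_config_coords)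
  then show ?thesis
    by (simp add: summand_def summand_deriv_def tensor_prod_def algebra_simps)
qed

lemma has_derivative_config_map:
  "(config_map has_derivative config_deriv p) (at p)"
  for p :: "('i::finite, 'j::finite) config"
proof -
  let ?f = "\<lambda>p :: ('i, 'j) config. (\<chi> m. \<Sum>i\<in>UNIV. summand (fst p) i $ m, snd (snd p),
     \<chi> j r. \<Sum>m\<in>UNIV. snd (snd p) $ j $ r $ m * (\<Sum>i\<in>UNIV. fst (snd p) $ j $ i * summand (fst p) i $ m))"
  let ?f' = "\<lambda>h :: ('i, 'j) config. (\<chi> m. \<Sum>i\<in>UNIV. summand_deriv (fst p) (fst h) i $ m, snd (snd h),
     \<chi> j r. \<Sum>m\<in>UNIV. snd (snd p) $ j $ r $ m *
          (\<Sum>i\<in>UNIV. fst (snd p) $ j $ i * summand_deriv (fst p) (fst h) i $ m + fst (snd h) $ j $ i * summand (fst p) i $ m)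
       + snd (snd h) $ j $ r $ m * (\<Sum>i\<in>UNIV. fst (snd p) $ j $ i * summand (fst p) i $ m))"
  have "(?f has_derivative ?f') (at p)"
    by (intro has_derivative_Pair has_derivative_vec_lambda has_derivative_sum has_derivative_mult
        has_derivative_summand has_derivative_config_coords bounded_linear_imp_has_derivative bounded_linear_snd_comp
        bounded_linear_snd)
  moreover have "?f = config_map"
    by (auto simp: fun_eq_iff config_map_def vec_eq_iff matrix_vector_mult_def)
  moreover have "?f' = config_deriv p"
    by (auto simp: fun_eq_iff config_deriv_def vec_eq_iff matrix_vector_mult_def sum.distrib algebra_simps
        split: prod.splits)
  ultimately show ?thesis by simp
qed

section \<open>A point at which the differential is onto\<close>

type_synonym five = "3 + 2"
text \<open>The types mirror the base point. In \<open>five\<close> there are the tensors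
  \<open>ekkk\<close>, then \<open>fff\<close> and \<open>e123\<close>; in \<open>eight\<close>
  there are two directions for each of the three factors of \<open>e123\<close>, then two directions
  at \<open>fff\<close>.\<close>

type_synonym eight = "3 \<times> 2 + 2"

text \<open>
  The differential of \<open>config_map\<close> is onto at \<open>x = (e111, e222, e333, fff, e123)\<close>, where
  \<open>f = e1 + e2 + e3\<close>. The map \<open>L_j\<close> reads off five coordinates that are independent on the span of
  the \<open>x_i\<close> and the coordinate \<open>moved_index j\<close>. Modulo the span, the eight sections then see six
  coordinates of the tangent vector at \<open>e123\<close> and two of the one at \<open>fff\<close>, and these separate the
  eight-dimensional space of first-order deformations that fix the sum of the \<open>x_i\<close>.
\<close>

definition base_factors :: "complex^3^3^five" where
  "base_factors = (\<chi> i a. case i of Inl k \<Rightarrow> axis k 1 | Inr b \<Rightarrow> if b = 1 then 1 else axis a 1)"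

text \<open>Among the five base tensors only \<open>fff\<close> is nonzero at
  \<open>(1, 3, 2)\<close>, and each of the other four coordinates sees exactly one further tensor.
  So the coordinates are independent on the span.\<close>

definition diag_index :: "five \<Rightarrow> tensor_index" where
  "diag_index i = (case i of Inl k \<Rightarrow> (k, k, k) | Inr b \<Rightarrow> if b = 1 then (1, 3, 2) else (1, 2, 3))"

definition moved_summand :: "eight \<Rightarrow> five" where
  "moved_summand j = (case j of Inl _ \<Rightarrow> Inr 2 | Inr _ \<Rightarrow> Inr 1)"

text \<open>Addition in \<open>3\<close> is modulo 3: the first six indices change one entry of
  \<open>(1, 2, 3)\<close>. At all eight indices \<open>fff\<close> is the only nonzero base
  tensor.\<close>

definition moved_index :: "eight \<Rightarrow> tensor_index" where
  "moved_index j = (case j of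
     Inl (a, d) \<Rightarrow> let e = (if d = 1 then 1 else 2) in
       if a = 1 then (1 + e, 2, 3) else if a = 2 then (1, 2 + e, 3) else (1, 2, 3 + e)
   | Inr d \<Rightarrow> if d = 1 then (1, 1, 2) else (1, 1, 3))"


lemma sum_five: "(\<Sum>i\<in>(UNIV :: five set). f i) = f (Inl 1) + f (Inl 2) + f (Inl 3) + f (Inr 1) + f (Inr 2)"
  by (simp add: sum.Plus sum_3 sum_2 algebra_simps flip: UNIV_Plus_UNIV)

lemma three_simps: "(1::3) \<noteq> 2" "(1::3) \<noteq> 3" "(2::3) \<noteq> 3" "(2::3) \<noteq> 1" "(3::3) \<noteq> 1" "(3::3) \<noteq> 2"
  "(1::3) + 1 = 2" "(2::3) + 1 = 3" "(3::3) + 1 = 1" "(1::3) + 2 = 3" "(2::3) + 2 = 1" "(3::3) + 2 = 2"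
  by simp_all

lemma two_simps: "(1::2) \<noteq> 2" "(2::2) \<noteq> 1" by simp_all

text \<open>On the span the moved coordinates agree with the one at \<open>(1, 3, 2)\<close>, so the
  differences are functionals modulo the span. The tangent spaces at \<open>e111\<close>,
  \<open>e222\<close>, \<open>e333\<close> supply all 21 coordinates with a repeated index. The six
  permutations and the eight differences remain, and they are matched by 7 + 7 parameters at
  \<open>fff\<close> and \<open>e123\<close>.\<close>

lemma base_tangent_surjective:
  fixes \<tau> :: "(3, 3, 3) tensor" and \<omega> :: "eight \<Rightarrow> complex"
  shows "\<exists>h. (\<Sum>i\<in>UNIV. summand_deriv base_factors h i) = \<tau> \<and>
    (\<forall>j. summand_deriv base_factors h (moved_summand j) $ moved_index j -
         summand_deriv base_factors h (moved_summand j) $ (1, 3, 2) = \<omega> j)"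
proof -
  \<comment> \<open>The value \<open>\<alpha> 1\<close> is the signed sum of \<open>\<tau>\<close>
    over the six permutations: tensors of the form \<open>p k + q l + r m\<close> have signed sum
    zero, and \<open>y5\<close> is \<open>\<alpha> 1\<close> at \<open>(1, 2, 3)\<close> and zero at
    the other five.\<close>
  define \<alpha> where "\<alpha> k = (if k = 1 then \<tau>$(1,2,3) + \<tau>$(2,3,1) + \<tau>$(3,1,2) - \<tau>$(1,3,2) - \<tau>$(2,1,3) - \<tau>$(3,2,1)
     else if k = 2 then \<omega> (Inl (1, 1)) else \<omega> (Inl (1, 2)))" for k :: 3
  \<comment> \<open>The zeros \<open>\<beta> 2\<close>, \<open>\<gamma> 3\<close>,
    \<open>q 3\<close>, \<open>r 2\<close> remove the freedom to shift multiples of a tensor between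
    its factors. At each moved index of \<open>e123\<close> the tensor \<open>y5\<close> is a single
    entry, which is therefore read off from \<open>\<omega>\<close>.\<close>
  define \<beta> where "\<beta> k = (if k = 2 then 0 else if k = 3 then \<omega> (Inl (2, 1)) else \<omega> (Inl (2, 2)))" for k :: 3
  define \<gamma> where "\<gamma> k = (if k = 3 then 0 else if k = 1 then \<omega> (Inl (3, 1)) else \<omega> (Inl (3, 2)))" for k :: 3
  define w1 w2 where "w1 = \<omega> (Inr 1)" and "w2 = \<omega> (Inr 2)"
  define t where "t = \<tau>$(1,2,3) - \<alpha> 1"
  define p where "p k = (if k = 1 then \<tau>$(1,3,2) else if k = 2 then \<tau>$(2,1,3) - w2 else \<tau>$(3,1,2) - w1)" for k :: 3
  define q where "q k = (if k = 1 then w1 else if k = 2 then t - \<tau>$(1,3,2) - (w2 - w1) else 0)" for k :: 3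
  define r where "r k = (if k = 1 then \<tau>$(2,3,1) - \<tau>$(2,1,3) + w2 else if k = 2 then 0 else w2 - w1)" for k :: 3
  define \<delta> where "\<delta> k l = (if k = l then 1 else 0 :: complex)" for k l :: 3
  define y4 where "y4 k l m = p k + q l + r m" for k l m
  define y5 where "y5 k l m = \<alpha> k * \<delta> l 2 * \<delta> m 3 + \<delta> k 1 * \<beta> l * \<delta> m 3 + \<delta> k 1 * \<delta> l 2 * \<gamma> m" for k l m
  define \<rho> where "\<rho> k l m = \<tau>$(k,l,m) - y4 k l m - y5 k l m" for k l m
  have perms: "\<rho> 1 2 3 = 0" "\<rho> 1 3 2 = 0" "\<rho> 2 1 3 = 0" "\<rho> 2 3 1 = 0" "\<rho> 3 1 2 = 0" "\<rho> 3 2 1 = 0"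
    by (simp_all add: \<rho>_def y4_def y5_def \<delta>_def p_def q_def r_def t_def \<alpha>_def \<beta>_def \<gamma>_def three_simps)
  \<comment> \<open>At \<open>ecc\<close> in the last two factors and its analogues, the residue
    \<open>\<rho>\<close> is copied; the zero for \<open>k = c\<close> keeps
    \<open>\<rho> c c c\<close> from being counted three times.\<close>
  define h :: "complex^3^3^five" where "h = (\<chi> i a k. case i of
      Inl c \<Rightarrow> if a = 1 then \<rho> k c c else if k = c then 0 else if a = 2 then \<rho> c k c else \<rho> c c k
    | Inr b \<Rightarrow> if b = 1 then (if a = 1 then p k else if a = 2 then q k else r k)
        else (if a = 1 then \<alpha> k else if a = 2 then \<beta> k else \<gamma> k))"
  have dInl: "summand_deriv base_factors h (Inl c) $ (k, l, m) = \<rho> k c c * \<delta> l c * \<delta> m c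
      + (if l = c then 0 else \<rho> c l c * \<delta> k c * \<delta> m c) + (if m = c then 0 else \<rho> c c m * \<delta> k c * \<delta> l c)" for c k l m
    by (simp add: summand_deriv_def tensor_prod_def base_factors_def h_def axis_def \<delta>_def three_simps)
  have d4: "summand_deriv base_factors h (Inr 1) $ (k, l, m) = y4 k l m" for k l m
    by (simp add: summand_deriv_def tensor_prod_def base_factors_def h_def y4_def three_simps)
  have d5: "summand_deriv base_factors h (Inr 2) $ (k, l, m) = y5 k l m" for k l m
    by (simp add: summand_deriv_def tensor_prod_def base_factors_def h_def y5_def axis_def \<delta>_def three_simps two_simps)
  have \<tau>: "\<tau> $ (k, l, m) = \<rho> k l m + y4 k l m + y5 k l m" for k l m by (simp add: \<rho>_def)
  have "(\<Sum>i\<in>UNIV. summand_deriv base_factors h i) $ (k, l, m) = \<tau> $ (k, l, m)" for k l m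
  proof -
    have "\<rho> k 1 1 * \<delta> l 1 * \<delta> m 1 + (if l = 1 then 0 else \<rho> 1 l 1 * \<delta> k 1 * \<delta> m 1) + (if m = 1 then 0 else \<rho> 1 1 m * \<delta> k 1 * \<delta> l 1)
      + (\<rho> k 2 2 * \<delta> l 2 * \<delta> m 2 + (if l = 2 then 0 else \<rho> 2 l 2 * \<delta> k 2 * \<delta> m 2) + (if m = 2 then 0 else \<rho> 2 2 m * \<delta> k 2 * \<delta> l 2))
      + (\<rho> k 3 3 * \<delta> l 3 * \<delta> m 3 + (if l = 3 then 0 else \<rho> 3 l 3 * \<delta> k 3 * \<delta> m 3) + (if m = 3 then 0 else \<rho> 3 3 m * \<delta> k 3 * \<delta> l 3))
      = \<rho> k l m"
      using exhaust_3[of k] exhaust_3[of l] exhaust_3[of m]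
      by (elim disjE) (simp_all add: perms \<delta>_def three_simps)
    then show ?thesis
      unfolding \<tau> sum_five vector_add_component dInl d4 d5 by simp
  qed
  then have "(\<Sum>i\<in>UNIV. summand_deriv base_factors h i) = \<tau>" by (auto simp: vec_eq_iff)
  moreover have "summand_deriv base_factors h (moved_summand j) $ moved_index j -
         summand_deriv base_factors h (moved_summand j) $ (1, 3, 2) = \<omega> j" for j
  proof (cases j)
    case (Inl ad)
    obtain a d where ad: "ad = (a, d)" by (cases ad)
    show ?thesis unfolding Inl ad
      using exhaust_3[of a] exhaust_2[of d]
      by (elim disjE) (simp_all add: moved_summand_def moved_index_def d5 y5_def \<delta>_def \<alpha>_def \<beta>_def \<gamma>_def three_simps two_simps Let_def)
  next
    case (Inr d)
    show ?thesis unfolding Inr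
      using exhaust_2[of d]
      by (elim disjE) (simp_all add: moved_summand_def moved_index_def d4 y4_def p_def q_def r_def w1_def w2_def three_simps two_simps Let_def)
  qed
  ultimately show ?thesis by blast
qed

definition coord_row :: "eight \<Rightarrow> five option \<Rightarrow> tensor_index" where
  "coord_row j r = (case r of None \<Rightarrow> moved_index j | Some i \<Rightarrow> diag_index i)"

definition base_config :: "(five, eight) config" where
  "base_config = (base_factors, \<chi> j. axis (moved_summand j) 1, \<chi> j r. axis (coord_row j r) 1)"

lemma summand_base:
  "summand base_factors (Inl c) $ (k, l, m) = (if k = c \<and> l = c \<and> m = c then 1 else 0)"
  "summand base_factors (Inr 1) $ (k, l, m) = 1"
  "summand base_factors (Inr 2) $ (k, l, m) = (if k = 1 \<and> l = 2 \<and> m = 3 then 1 else 0)"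
  by (auto simp: summand_def tensor_prod_def base_factors_def axis_def three_simps two_simps)

text \<open>The assumption is the one compatibility condition on the span: both coordinates read the
  coefficient of \<open>fff\<close>. Subtracting it from the other coordinates gives the remaining
  coefficients.\<close>

lemma base_span_projection:
  fixes v :: "complex^five option"
  assumes "v $ None = v $ Some (Inr 1)"
  shows "\<exists>t. \<forall>r. (\<Sum>i\<in>UNIV. t $ i *s summand base_factors i) $ coord_row j r = v $ r"
proof -
  define t :: "complex^five" where "t = (\<chi> i. if i = Inr 1 then v $ Some i else v $ Some i - v $ Some (Inr 1))"
  have 1: "(\<Sum>i\<in>UNIV. t $ i *s summand base_factors i) $ diag_index i = v $ Some i" for i
  proof (cases i)
    case (Inl c)
    show ?thesis unfolding Inl using exhaust_3[of c]
      by (elim disjE) (simp_all add: sum_five diag_index_def summand_base t_def three_simps two_simps)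
  next
    case (Inr d)
    show ?thesis unfolding Inr using exhaust_2[of d]
      by (elim disjE) (simp_all add: sum_five diag_index_def summand_base t_def three_simps two_simps)
  qed
  have 2: "(\<Sum>i\<in>UNIV. t $ i *s summand base_factors i) $ moved_index j = v $ None"
  proof (cases j)
    case (Inl ad)
    obtain a d where ad: "ad = (a, d)" by (cases ad)
    show ?thesis unfolding Inl ad assms
      using exhaust_3[of a] exhaust_2[of d]
      by (elim disjE) (simp_all add: sum_five moved_index_def summand_base t_def three_simps two_simps Let_def)
  next
    case (Inr d)
    show ?thesis unfolding Inr assms
      using exhaust_2[of d]
      by (elim disjE) (simp_all add: sum_five moved_index_def summand_base t_def three_simps two_simps Let_def)
  qed
  show ?thesis
    using 1 2 by (intro exI[of _ t]) (simp add: coord_row_def split: option.split)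
qed

text \<open>Once \<open>M\<close> is prescribed, \<open>h\<close> solves for the tensor and for the
  component of each section transverse to the span; the variations \<open>t\<close> of the
  coefficients then adjust the components along the span.\<close>

lemma surj_config_deriv_base: "surj (config_deriv base_config)"
proof -
  have ex: "\<exists>x. config_deriv base_config x = (\<tau>, M, w)" for \<tau> M w
  proof -
    define s :: "complex^five^eight" where "s = (\<chi> j. axis (moved_summand j) 1)"
    define L :: "complex^(3 \<times> 3 \<times> 3)^five option^eight" where "L = (\<chi> j r. axis (coord_row j r) 1)"
    have L: "(L $ j *v y) $ r = y $ coord_row j r" for j y r
      by (simp add: L_def matrix_vector_mult_def axis_def mult_if_delta)
    define v where "v = (\<chi> j. w $ j - M $ j *v (\<Sum>i\<in>UNIV. s $ j $ i *s summand base_factors i))"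
    obtain h where h: "(\<Sum>i\<in>UNIV. summand_deriv base_factors h i) = \<tau>"
      "\<And>j. summand_deriv base_factors h (moved_summand j) $ moved_index j -
         summand_deriv base_factors h (moved_summand j) $ (1, 3, 2) = v $ j $ None - v $ j $ Some (Inr 1)"
      using base_tangent_surjective[of \<tau> "\<lambda>j. v $ j $ None - v $ j $ Some (Inr 1)"] by blast
    have ex: "\<exists>t. \<forall>r. (\<Sum>i\<in>UNIV. t $ i *s summand base_factors i) $ coord_row j r =
        (\<chi> r. v $ j $ r - summand_deriv base_factors h (moved_summand j) $ coord_row j r) $ r" for j
      by (rule base_span_projection) (use h(2)[of j] in \<open>simp add: coord_row_def diag_index_def algebra_simps\<close>)
    have "\<forall>j. \<exists>t. \<forall>r. (\<Sum>i\<in>UNIV. t $ i *s summand base_factors i) $ coord_row j r =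
        v $ j $ r - summand_deriv base_factors h (moved_summand j) $ coord_row j r"
      using ex unfolding vec_lambda_beta by (rule allI)
    from choice[OF this] obtain t where t: "\<forall>j r. (\<Sum>i\<in>UNIV. t j $ i *s summand base_factors i) $ coord_row j r =
        v $ j $ r - summand_deriv base_factors h (moved_summand j) $ coord_row j r" ..
    have sel: "(\<Sum>i\<in>UNIV. s $ j $ i *s y i) = y (moved_summand j)" for j and y :: "five \<Rightarrow> (3,3,3) tensor"
      by (simp add: s_def axis_def vec_eq_iff mult_if_delta)
    have "L $ j *v (\<Sum>i\<in>UNIV. t j $ i *s summand base_factors i + s $ j $ i *s summand_deriv base_factors h i) = v $ j" for j
      unfolding sum.distrib sel by (simp add: vec_eq_iff L t del: sum_component)
    then have "config_deriv base_config (h, \<chi> j. t j, M) = (\<tau>, M, w)"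
      unfolding base_config_def config_deriv_def s_def[symmetric] L_def[symmetric] by (simp add: h(1) v_def vec_eq_iff)
    then show ?thesis ..
  qed
  have "\<exists>x. y = config_deriv base_config x" for y
    using ex[of "fst y" "fst (snd y)" "snd (snd y)"] unfolding prod.collapse by (metis (no_types))
  then show ?thesis unfolding surj_def by (rule allI)
qed

lemma interior_range_config_map: "interior (range (config_map :: (five, eight) config \<Rightarrow> _)) \<noteq> {}"
proof -
  have deriv: "(config_map has_derivative config_deriv p) (at p)" for p :: "(five, eight) config"
    by (rule has_derivative_config_map)
  then have lin: "linear (config_deriv base_config)"
    using has_derivative_bounded_linear bounded_linear.linear by blast
  obtain g' where g': "linear g'" "config_deriv base_config \<circ> g' = id"
    using linear_surjective_right_inverse[OF lin surj_config_deriv_base] by blast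
  have "config_map base_config \<in> interior (config_map ` (UNIV :: (five, eight) config set))"
  proof (rule sussmann_open_mapping)
    show "continuous_on UNIV (config_map :: (five, eight) config \<Rightarrow> _)"
      by (rule has_derivative_continuous_on) (use deriv in auto)
    show "(config_map has_derivative config_deriv base_config) (at base_config)" by (rule deriv)
    show "bounded_linear g'" using g'(1) by (simp add: linear_conv_bounded_linear)
  qed (use g'(2) in auto)
  then show ?thesis by blast
qed

section \<open>Frames and hyperplane sections of the Grassmannian\<close>

text \<open>A frame becomes a matrix with rows indexed by a finite type, and its plane is
  \<open>range (row_combination V)\<close>. This makes determinants and limits of frames
  available.\<close>

definition row_combination :: "complex^'n^'i \<Rightarrow> complex^'i \<Rightarrow> complex^'n" where
  "row_combination V c = (\<Sum>i\<in>UNIV. c $ i *s V $ i)"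

definition independent_rows :: "complex^'n^'i \<Rightarrow> bool" where
  "independent_rows V \<longleftrightarrow> (\<forall>c. row_combination V c = 0 \<longrightarrow> c = 0)"

lemma row_combination_component: "row_combination V c $ m = (\<Sum>i\<in>UNIV. c $ i * V $ i $ m)"
  by (simp add: row_combination_def)

lemma transpose_mult_eq_row_combination: "transpose V *v c = row_combination V c"
  by (simp add: vec_eq_iff row_combination_component matrix_vector_mult_def transpose_def mult.commute)

lemma row_combination_axis: "row_combination V (axis i 1) = V $ i"
  by (simp add: vec_eq_iff row_combination_component axis_def mult_if_delta)

lemma row_combination_linear:
  "row_combination V (c + d) = row_combination V c + row_combination V d"
  "row_combination V (a *s c) = a *s row_combination V c"
  "row_combination V 0 = 0"
  by (simp_all add: vec_eq_iff row_combination_component algebra_simps sum.distrib sum_distrib_left)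

lemma vec_span_rows: "vec.span (range (\<lambda>i. V $ i)) = range (row_combination V)"
proof
  have "vec.subspace (range (row_combination V))"
    unfolding vec.subspace_def
  proof (intro conjI ballI allI)
    show "0 \<in> range (row_combination V)" by (rule image_eqI[of _ _ 0]) (simp_all add: row_combination_linear)
    fix x assume x: "x \<in> range (row_combination V)"
    then obtain c where c: "x = row_combination V c" by (rule rangeE)
    show "a *s x \<in> range (row_combination V)" for a
      unfolding c row_combination_linear(2)[symmetric] by (rule rangeI)
    fix y assume "y \<in> range (row_combination V)"
    then obtain d where d: "y = row_combination V d" by (rule rangeE)
    show "x + y \<in> range (row_combination V)"
      unfolding c d row_combination_linear(1)[symmetric] by (rule rangeI)
  qed
  then show "vec.span (range (\<lambda>i. V $ i)) \<subseteq> range (row_combination V)"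
    by (intro vec.span_minimal) (auto simp: row_combination_axis[symmetric])
  show "range (row_combination V) \<subseteq> vec.span (range (\<lambda>i. V $ i))"
    unfolding row_combination_def by (auto intro!: vec.span_sum vec.span_scale intro: vec.span_base)
qed

lemma independent_rows_iff:
  "independent_rows V \<longleftrightarrow> inj (\<lambda>i. V $ i) \<and> vec.independent (range (\<lambda>i. V $ i))"
proof
  assume V: "independent_rows V"
  have inj: "inj (\<lambda>i. V $ i)"
  proof (rule injI, rule ccontr)
    fix i k assume "V $ i = V $ k" "i \<noteq> k"
    have "row_combination V (axis i 1 + (-1) *s axis k 1) = 0"
      unfolding row_combination_linear row_combination_axis using \<open>V $ i = V $ k\<close> by (simp add: vec_eq_iff)
    then have "(axis i 1 + (-1) *s axis k 1 :: complex^'b) $ i = 0"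
      using V unfolding independent_rows_def by (metis zero_index)
    then show False using \<open>i \<noteq> k\<close> by (simp add: axis_def)
  qed
  have "vec.independent (range (\<lambda>i. V $ i))"
  proof
    assume "vec.dependent (range (\<lambda>i. V $ i))"
    then obtain f where f: "\<exists>v\<in>range (\<lambda>i. V $ i). f v \<noteq> 0" "(\<Sum>v\<in>range (\<lambda>i. V $ i). f v *s v) = 0"
      using vec.dependent_finite[of "range (\<lambda>i. V $ i)"] by auto
    have "row_combination V (\<chi> i. f (V $ i)) = 0"
      using f(2) by (simp add: row_combination_def sum.reindex[OF inj])
    then have "(\<chi> i. f (V $ i)) = 0" using V unfolding independent_rows_def by blast
    then show False using f(1) by (auto simp: vec_eq_iff)
  qed
  with inj show "inj (\<lambda>i. V $ i) \<and> vec.independent (range (\<lambda>i. V $ i))" by blast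
next
  assume V: "inj (\<lambda>i. V $ i) \<and> vec.independent (range (\<lambda>i. V $ i))"
  show "independent_rows V" unfolding independent_rows_def
  proof (intro allI impI)
    fix c assume c: "row_combination V c = 0"
    define f where "f v = c $ (inv (\<lambda>i. V $ i) v)" for v
    have f: "f (V $ i) = c $ i" for i using V by (simp add: f_def)
    have "(\<Sum>v\<in>range (\<lambda>i. V $ i). f v *s v) = 0"
      using c V by (simp add: row_combination_def sum.reindex f)
    then have "\<forall>v\<in>range (\<lambda>i. V $ i). f v = 0"
      using V vec.dependent_finite[of "range (\<lambda>i. V $ i)"] by auto
    then show "c = 0" by (simp add: vec_eq_iff f)
  qed
qed

lemma
  assumes d: "bij_betw d (UNIV :: 'i set) {..<r}"
  shows frames_iff_independent_rows: "v \<in> frames r \<longleftrightarrow> independent_rows (\<chi> i::'i::finite. v (d i))"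
    and frame_span_eq_range: "frame_span r v = range (row_combination (\<chi> i::'i. v (d i)))"
proof -
  have img: "d ` UNIV = {..<r}" using d by (simp add: bij_betw_def)
  have rng: "range (\<lambda>i. (\<chi> i. v (d i)) $ i) = v ` {..<r}" unfolding img[symmetric] by auto
  have "inj_on v {..<r} \<longleftrightarrow> inj (\<lambda>i. v (d i))"
    using d comp_inj_on_iff[of d UNIV v] by (simp add: bij_betw_def comp_def)
  moreover have "(\<lambda>i. (\<chi> i. v (d i)) $ i) = (\<lambda>i. v (d i))" by (simp add: fun_eq_iff)
  ultimately show "v \<in> frames r \<longleftrightarrow> independent_rows (\<chi> i::'i. v (d i))"
    unfolding frames_def independent_rows_iff rng by (simp del: vec_lambda_beta)
  show "frame_span r v = range (row_combination (\<chi> i::'i. v (d i)))"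
    unfolding frame_span_def vec_span_rows[symmetric] rng ..
qed

text \<open>
  For subspaces \<open>E\<close> of dimension \<open>r\<close> and \<open>u\<close> in a space of dimension \<open>r + 1\<close> this is a condition of
  codimension one, a hyperplane section of the Grassmannian.
\<close>

definition meets :: "(complex^'n) set \<Rightarrow> complex^'n^'k \<Rightarrow> complex^'k \<Rightarrow> bool" where
  "meets E L u \<longleftrightarrow> (\<exists>e\<in>E. \<exists>c. (e \<noteq> 0 \<or> c \<noteq> 0) \<and> L *v e = c *s u)"

text \<open>The columns are \<open>u\<close> and the images under \<open>L\<close> of the rows of
  \<open>V\<close>; the determinant is the equation of the section on frames.\<close>

definition section_matrix :: "complex^'n^'i \<Rightarrow> complex^'n^'i option \<Rightarrow> complex^'i option \<Rightarrow> complex^'i option^'i option" where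
  "section_matrix V L u = (\<chi> r k. case k of None \<Rightarrow> u $ r | Some i \<Rightarrow> (L *v V $ i) $ r)"

lemma det_eq_0_iff_kernel: "det A = 0 \<longleftrightarrow> (\<exists>z. z \<noteq> 0 \<and> A *v z = 0)" for A :: "complex^'n^'n"
  using invertible_det_nz[of A] invertible_left_inverse[of A] matrix_left_invertible_ker[of A] by blast

lemma sum_option: "(\<Sum>k\<in>(UNIV :: 'i::finite option set). f k) = f None + (\<Sum>i\<in>UNIV. f (Some i))"
  for f :: "_ \<Rightarrow> 'a::comm_monoid_add"
  by (simp add: UNIV_option_conv sum.reindex)

lemma section_matrix_mult:
  "section_matrix V L u *v z = z $ None *s u + L *v row_combination V (\<chi> i. z $ Some i)"
proof -
  have "(L *v row_combination V c) $ r = (\<Sum>i\<in>UNIV. c $ i * (L *v V $ i) $ r)" for c r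
    unfolding matrix_vector_mult_def row_combination_component
    by (simp add: sum_distrib_left sum_distrib_right algebra_simps) (rule sum.swap)
  then show ?thesis
    by (simp add: vec_eq_iff section_matrix_def matrix_vector_mult_def[of "\<chi> r k. _ r k"] sum_option mult.commute)
qed

lemma meets_iff_det:
  assumes V: "independent_rows V"
  shows "meets (range (row_combination V)) L u \<longleftrightarrow> det (section_matrix V L u) = 0"
proof
  assume "meets (range (row_combination V)) L u"
  then obtain a c where ac: "row_combination V a \<noteq> 0 \<or> c \<noteq> 0" "L *v row_combination V a = c *s u"
    unfolding meets_def by blast
  define z where "z = (\<chi> k. case k of None \<Rightarrow> - c | Some i \<Rightarrow> a $ i)"
  have "section_matrix V L u *v z = 0"
    unfolding section_matrix_mult using ac(2) by (simp add: z_def vec_eq_iff)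
  moreover have "z \<noteq> 0"
  proof
    assume "z = 0"
    then have "c = 0" "a = 0" by (auto simp: z_def vec_eq_iff split: option.splits)
    then show False using ac(1) by (simp add: row_combination_linear)
  qed
  ultimately show "det (section_matrix V L u) = 0" using det_eq_0_iff_kernel by blast
next
  assume "det (section_matrix V L u) = 0"
  then obtain z where z: "z \<noteq> 0" "section_matrix V L u *v z = 0" using det_eq_0_iff_kernel by blast
  define e where "e = row_combination V (\<chi> i. z $ Some i)"
  have "e \<noteq> 0 \<or> - z $ None \<noteq> 0"
  proof (rule ccontr)
    assume "\<not> (e \<noteq> 0 \<or> - z $ None \<noteq> 0)"
    then have "z $ None = 0" "(\<chi> i. z $ Some i) = 0" using V unfolding e_def independent_rows_def by auto
    then have "z $ k = 0" for k by (cases k) (auto simp: vec_eq_iff)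
    then show False using z(1) by (simp add: vec_eq_iff)
  qed
  moreover have "L *v e = (- z $ None) *s u"
    using z(2) unfolding section_matrix_mult e_def by (simp add: vec_eq_iff eq_neg_iff_add_eq_0 add.commute)
  ultimately show "meets (range (row_combination V)) L u" unfolding meets_def e_def by blast
qed

lemma independent_rows_left_inverse:
  assumes "independent_rows V"
  shows "\<exists>B :: complex^'n^'i. B ** transpose (V :: complex^'n^'i) = mat 1"
  using assms unfolding matrix_left_invertible_ker independent_rows_def transpose_mult_eq_row_combination .

text \<open>A left inverse as \<open>L\<close>, padded by a zero row, and \<open>u\<close> as the
  unit vector of that row make \<open>section_matrix V L u\<close> the identity.\<close>

lemma exists_section_avoiding:
  assumes "independent_rows (V :: complex^'n^'i)"
  shows "\<exists>L u. det (section_matrix V L u) \<noteq> 0"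
proof -
  obtain B :: "complex^'n^'i" where B: "B ** transpose V = mat 1"
    using independent_rows_left_inverse[OF assms] by blast
  define L where "L = (\<chi> r. case r of None \<Rightarrow> 0 | Some i \<Rightarrow> B $ i)"
  have "(L *v V $ i) $ r = (if r = Some i then 1 else 0)" for i r
  proof (cases r)
    case (Some k)
    have "(B ** transpose V) $ k $ i = (\<Sum>m\<in>UNIV. B $ k $ m * V $ i $ m)"
      by (simp add: matrix_matrix_mult_def transpose_def)
    then show ?thesis using Some unfolding B by (simp add: L_def matrix_vector_mult_def mat_def)
  qed (simp add: L_def matrix_vector_mult_def)
  then have "section_matrix V L (axis None 1) = mat 1"
    by (auto simp: section_matrix_def mat_def vec_eq_iff axis_def split: option.split)
  then show ?thesis by (metis det_I zero_neq_one)
qed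

text \<open>Row rank equals column rank: by the left inverse the columns \<open>w m\<close> span
  everything, and a basis chosen among them gives the minor.\<close>

lemma independent_rows_minor:
  assumes "independent_rows (V :: complex^'n^'i)"
  shows "\<exists>I. det (\<chi> l i. V $ i $ I l) \<noteq> 0"
proof -
  define w :: "'n \<Rightarrow> complex^'i" where "w m = (\<chi> i. V $ i $ m)" for m
  obtain B :: "complex^'n^'i" where B: "B ** transpose V = mat 1"
    using independent_rows_left_inverse[OF assms] by blast
  have "axis l 1 = (\<Sum>m\<in>UNIV. B $ l $ m *s w m)" for l
  proof -
    have "axis l 1 = (B ** transpose V) $ l" unfolding B by (simp add: mat_def axis_def vec_eq_iff eq_commute)
    also have "\<dots> = (\<Sum>m\<in>UNIV. B $ l $ m *s w m)"
      by (simp add: vec_eq_iff matrix_matrix_mult_def transpose_def w_def)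
    finally show ?thesis .
  qed
  then have "axis l 1 \<in> vec.span (range w)" for l
    by (auto intro!: vec.span_sum vec.span_scale intro: vec.span_base)
  then have "(\<Sum>l\<in>UNIV. x $ l *s axis l 1) \<in> vec.span (range w)" for x
    by (intro vec.span_sum vec.span_scale)
  then have "vec.span (range w) = UNIV" unfolding basis_expansion by blast
  then have "vec.dim (range w) = CARD('i)" by (metis vec.dim_span vec_dim_card)
  then obtain S where S: "S \<subseteq> range w" "vec.independent S" "card S = CARD('i)"
    using vec.basis_exists[of "range w"] by metis
  have "finite S" by (rule finite_subset[OF S(1)]) simp
  from finite_same_card_bij[OF finite_class.finite_UNIV this S(3)[symmetric]]
  obtain f where f: "bij_betw f (UNIV :: 'i set) S" ..
  then have "\<forall>l. \<exists>m. f l = w m" using S(1) by (auto simp: bij_betw_def)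
  then obtain I where I: "\<And>l. f l = w (I l)" by metis
  define A where "A = (\<chi> l i. V $ i $ I l)"
  have Af: "(\<lambda>l. A $ l) = f" by (simp add: fun_eq_iff I A_def w_def)
  have "independent_rows A"
    unfolding independent_rows_iff Af using f S(2) by (simp add: bij_betw_def)
  then have "det (transpose A) \<noteq> 0"
    unfolding det_eq_0_iff_kernel independent_rows_def transpose_mult_eq_row_combination by blast
  then have "det A \<noteq> 0" by (simp add: det_transpose)
  then show ?thesis unfolding A_def by (rule exI[of _ I])
qed

lemma minor_imp_independent_rows:
  assumes "det (\<chi> l i. V $ i $ I l) \<noteq> 0"
  shows "independent_rows V"
  unfolding independent_rows_def
proof (intro allI impI)
  fix c assume "row_combination V c = 0"
  then have "(\<chi> l i. V $ i $ I l) *v c = 0"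
    using row_combination_component[of V c] by (simp add: vec_eq_iff matrix_vector_mult_def mult.commute)
  then show "c = 0" using assms det_eq_0_iff_kernel by blast
qed

text \<open>Choosing the minor of largest modulus bounds the entries of the frame, by Cramer's rule.\<close>

lemma normalized_frame:
  assumes V: "independent_rows (V :: complex^'n^'i)"
  shows "\<exists>(W :: complex^'n^'i) I. range (row_combination W) = range (row_combination V) \<and>
    (\<forall>i l. W $ i $ I l = (if i = l then 1 else 0)) \<and> (\<forall>i m. norm (W $ i $ m) \<le> 1)"
proof -
  define D where "D I = det (\<chi> l i. V $ i $ I l)" for I :: "'i \<Rightarrow> 'n"
  obtain I where I: "\<And>J. norm (D J) \<le> norm (D I)"
  proof -
    have "finite (range (\<lambda>I. norm (D I)))" by simp
    then have "Max (range (\<lambda>I. norm (D I))) \<in> range (\<lambda>I. norm (D I))" by (intro Max_in) auto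
    then obtain I where "Max (range (\<lambda>I. norm (D I))) = norm (D I)" by (rule rangeE)
    moreover have "norm (D J) \<le> Max (range (\<lambda>I. norm (D I)))" for J by simp
    ultimately show ?thesis using that[of I] by simp
  qed
  have "D I \<noteq> 0" using independent_rows_minor[OF V] I unfolding D_def by (metis norm_le_zero_iff norm_zero)
  define A where "A = (\<chi> l i. V $ i $ I l)"
  have detA: "det A = D I" by (simp add: A_def D_def)
  then have "invertible A" using \<open>D I \<noteq> 0\<close> invertible_det_nz by metis
  then obtain B where AB: "A ** B = mat 1" "B ** A = mat 1" unfolding invertible_def by blast
  define W where "W = (\<chi> i. row_combination V (\<chi> k. B $ k $ i))"
  have WI: "W $ i $ I l = (if i = l then 1 else 0)" for i l
  proof -
    have "W $ i $ I l = (A ** B) $ l $ i"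
      by (simp add: W_def row_combination_component A_def matrix_matrix_mult_def mult.commute)
    then show ?thesis unfolding AB by (auto simp: mat_def)
  qed
  have VW: "V $ k $ m = (\<Sum>i\<in>UNIV. W $ i $ m * A $ i $ k)" for k m
  proof -
    have "(\<Sum>i\<in>UNIV. W $ i $ m * A $ i $ k) = (\<Sum>i\<in>UNIV. \<Sum>l\<in>UNIV. V $ l $ m * (B $ l $ i * A $ i $ k))"
      by (simp add: W_def row_combination_component sum_distrib_left sum_distrib_right mult_ac)
    also have "\<dots> = (\<Sum>l\<in>UNIV. V $ l $ m * (B ** A) $ l $ k)"
      by (subst sum.swap) (simp add: matrix_matrix_mult_def sum_distrib_left)
    also have "\<dots> = V $ k $ m" unfolding AB by (simp add: mat_def if_distrib cong: if_cong)
    finally show ?thesis ..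
  qed
  have "norm (W $ i $ m) \<le> 1" for i m
  proof -
    \<comment> \<open>\<open>J\<close> exchanges one index of \<open>I\<close>. By Cramer's rule
      \<open>W $ i $ m\<close> is the quotient of the minors \<open>D J\<close> and
      \<open>D I\<close>.\<close>
    define J where "J l = (if l = i then m else I l)" for l
    have "(\<chi> l. if l = i then \<Sum>k\<in>UNIV. (\<chi> i. W $ i $ m) $ k *s row k A else row l A) $ l $ k = V $ k $ J l"
      for l k
      by (cases "l = i") (simp_all add: J_def row_def VW[of k m], simp add: A_def)
    then have "(\<chi> l. if l = i then \<Sum>k\<in>UNIV. (\<chi> i. W $ i $ m) $ k *s row k A else row l A) = (\<chi> l i. V $ i $ J l)"
      unfolding vec_eq_iff vec_lambda_beta by blast
    then have "D J = W $ i $ m * D I"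
      using cramer_lemma_transpose[of i "\<chi> i. W $ i $ m" A] unfolding D_def detA[unfolded D_def] by simp
    then have "norm (W $ i $ m) * norm (D I) \<le> 1 * norm (D I)" using I[of J] by (simp add: norm_mult)
    then show ?thesis using \<open>D I \<noteq> 0\<close> by (simp add: mult_le_cancel_right)
  qed
  moreover have "range (row_combination W) = range (row_combination V)"
  proof
    have "W $ i \<in> range (row_combination V)" for i by (simp add: W_def)
    then show "range (row_combination W) \<subseteq> range (row_combination V)"
      unfolding vec_span_rows[symmetric, of W] vec_span_rows[symmetric, of V]
      by (intro vec.span_minimal) auto
    have "V $ k = row_combination W (\<chi> i. A $ i $ k)" for k
      by (simp add: vec_eq_iff row_combination_component VW mult.commute)
    then have "V $ k \<in> range (row_combination W)" for k by blast
    then show "range (row_combination V) \<subseteq> range (row_combination W)"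
      unfolding vec_span_rows[symmetric, of W] vec_span_rows[symmetric, of V]
      by (intro vec.span_minimal) auto
  qed
  ultimately have "range (row_combination W) = range (row_combination V) \<and>
    (\<forall>i l. W $ i $ I l = (if i = l then 1 else 0)) \<and> (\<forall>i m. norm (W $ i $ m) \<le> 1)"
    using WI by simp
  then show ?thesis by blast
qed

section \<open>Density of the image of the configuration map\<close>

definition config_coords :: "(('i::finite, 'j::finite) config \<Rightarrow> complex) set" where
  "config_coords = range (\<lambda>(i, a, k) p. fst p $ i $ a $ k) \<union> range (\<lambda>(j, i) p. fst (snd p) $ j $ i)
     \<union> range (\<lambda>(j, r, m) p. snd (snd p) $ j $ r $ m)"

definition target_coords :: "(('i::finite, 'j::finite) target \<Rightarrow> complex) set" where
  "target_coords = range (\<lambda>m y. fst y $ m) \<union> range (\<lambda>(j, r, m) y. fst (snd y) $ j $ r $ m)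
     \<union> range (\<lambda>(j, r) y. snd (snd y) $ j $ r)"

lemma polyfuns_config_coords:
  "(\<lambda>p. fst p $ i $ a $ k) \<in> polyfuns config_coords"
  "(\<lambda>p. fst (snd p) $ j $ i) \<in> polyfuns config_coords"
  "(\<lambda>p. snd (snd p) $ j $ r $ m) \<in> polyfuns config_coords"
proof (safe intro!: polyfuns.coord)
  show "(\<lambda>p. fst p $ i $ a $ k) \<in> config_coords"
    unfolding config_coords_def by (rule UnI1, rule UnI1, rule image_eqI[of _ _ "(i, a, k)"]) simp_all
  show "(\<lambda>p. fst (snd p) $ j $ i) \<in> config_coords"
    unfolding config_coords_def by (rule UnI1, rule UnI2, rule image_eqI[of _ _ "(j, i)"]) simp_all
  show "(\<lambda>p. snd (snd p) $ j $ r $ m) \<in> config_coords"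
    unfolding config_coords_def by (rule UnI2, rule image_eqI[of _ _ "(j, r, m)"]) simp_all
qed

lemma polyfuns_summand: "(\<lambda>p. summand (fst p) i $ m) \<in> polyfuns config_coords"
  unfolding summand_def tensor_prod_def vec_lambda_beta
  by (intro polyfuns.mult polyfuns_config_coords)

lemma polyfuns_config_map:
  assumes "c \<in> target_coords"
  shows "(\<lambda>p. c (config_map p)) \<in> polyfuns config_coords"
proof -
  have 1: "fst (config_map p) $ m = (\<Sum>i\<in>UNIV. summand (fst p) i $ m)" for p :: "('a, 'b) config" and m
    by (simp add: config_map_def split: prod.split)
  have 2: "fst (snd (config_map p)) = snd (snd p)" for p :: "('a, 'b) config"
    by (simp add: config_map_def split: prod.split)
  have 3: "snd (snd (config_map p)) $ j $ r =
      (\<Sum>m\<in>UNIV. snd (snd p) $ j $ r $ m * (\<Sum>i\<in>UNIV. fst (snd p) $ j $ i * summand (fst p) i $ m))"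
    for p :: "('a, 'b) config" and j r
    by (simp add: config_map_def matrix_vector_mult_def split: prod.split)
  have "(\<lambda>p :: ('a, 'b) config. fst (config_map p) $ m) \<in> polyfuns config_coords" for m
    unfolding 1 by (intro polyfuns_sum polyfuns_summand)
  moreover have "(\<lambda>p :: ('a, 'b) config. fst (snd (config_map p)) $ j $ r $ m) \<in> polyfuns config_coords" for j r m
    unfolding 2 by (rule polyfuns_config_coords)
  moreover have "(\<lambda>p :: ('a, 'b) config. snd (snd (config_map p)) $ j $ r) \<in> polyfuns config_coords" for j r
    unfolding 3 by (intro polyfuns_sum polyfuns.mult polyfuns_summand polyfuns_config_coords)
  ultimately show ?thesis using assms unfolding target_coords_def by auto
qed

lemma base_minor_nonzero: "det (\<chi> l i. summand base_factors i $ diag_index l) \<noteq> 0"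
proof -
  have "z = 0" if z: "(\<chi> l i. summand base_factors i $ diag_index l) *v z = 0" for z :: "complex^five"
  proof -
    have eq: "(\<Sum>i\<in>UNIV. summand base_factors i $ diag_index l * z $ i) = 0" for l
      using z by (simp add: vec_eq_iff matrix_vector_mult_def)
    have 4: "z $ Inr 1 = 0"
      using eq[of "Inr 1"] by (simp add: sum_five diag_index_def summand_base three_simps two_simps)
    have "z $ Inl c = 0" for c
      using eq[of "Inl c"] 4 exhaust_3[of c]
      by (elim disjE) (simp_all add: sum_five diag_index_def summand_base three_simps two_simps)
    moreover have "z $ Inr 2 = 0"
      using eq[of "Inr 2"] 4 by (simp add: sum_five diag_index_def summand_base three_simps two_simps)
    ultimately have "z $ i = 0" for i
    proof (cases i)
      case (Inr b)
      then show ?thesis using exhaust_2[of b] 4 \<open>z $ Inr 2 = 0\<close> by auto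
    qed (simp add: \<open>\<And>c. z $ Inl c = 0\<close>)
    then show ?thesis by (simp add: vec_eq_iff)
  qed
  then show ?thesis unfolding det_eq_0_iff_kernel by blast
qed

text \<open>The minor is nonzero at the base point, so discarding its zeros keeps the image dense;
  in the remaining configurations the five rank one tensors are independent.\<close>

lemma dense_config_image:
  "closure (config_map ` {p. det (\<chi> l i. summand (fst p) i $ diag_index l) \<noteq> 0}) = (UNIV :: (five, eight) target set)"
proof (rule dense_polynomial_image[where CX = config_coords and CY = target_coords and ?x0.0 = base_config])
  show "finite (config_coords :: ((five, eight) config \<Rightarrow> complex) set)"
    unfolding config_coords_def by simp
  show "linear c" if "c \<in> config_coords" for c :: "(five, eight) config \<Rightarrow> complex"
    using that unfolding config_coords_def by (auto intro!: linearI)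
  show "\<exists>x. \<forall>c\<in>config_coords. c x = \<phi> c" for \<phi> :: "((five, eight) config \<Rightarrow> complex) \<Rightarrow> complex"
    by (rule exI[of _ "(\<chi> i a k. \<phi> (\<lambda>p. fst p $ i $ a $ k), \<chi> j i. \<phi> (\<lambda>p. fst (snd p) $ j $ i),
        \<chi> j r m. \<phi> (\<lambda>p. snd (snd p) $ j $ r $ m))"]) (auto simp: config_coords_def)
  show "linear c" if "c \<in> target_coords" for c :: "(five, eight) target \<Rightarrow> complex"
    using that unfolding target_coords_def by (auto intro!: linearI)
  show "y = z" if "\<And>c. c \<in> target_coords \<Longrightarrow> c y = c z" for y z :: "(five, eight) target"
  proof -
    have "fst y $ m = fst z $ m" for m
      by (rule that) (simp add: target_coords_def)
    moreover have "fst (snd y) $ j $ r $ m = fst (snd z) $ j $ r $ m" for j r m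
      by (rule that, unfold target_coords_def, rule UnI1, rule UnI2, rule image_eqI[of _ _ "(j, r, m)"]) simp_all
    moreover have "snd (snd y) $ j $ r = snd (snd z) $ j $ r" for j r
      by (rule that, unfold target_coords_def, rule UnI2, rule image_eqI[of _ _ "(j, r)"]) simp_all
    ultimately show ?thesis by (simp add: prod_eq_iff vec_eq_iff)
  qed
  show "(\<lambda>x. c (config_map x)) \<in> polyfuns config_coords" if "c \<in> target_coords" for c :: "(five, eight) target \<Rightarrow> complex"
    by (rule polyfuns_config_map[OF that])
  show "interior (range (config_map :: (five, eight) config \<Rightarrow> _)) \<noteq> {}" by (rule interior_range_config_map)
  show "(\<lambda>p. det (\<chi> l i. summand (fst p) i $ diag_index l)) \<in> polyfuns config_coords"
    by (rule polyfuns_det) (simp add: polyfuns_summand)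
  show "det (\<chi> l i. summand (fst base_config) i $ diag_index l) \<noteq> 0"
    using base_minor_nonzero by (simp add: base_config_def)
qed

text \<open>Polynomial functions pass to limits of the coordinates \<open>C\<close>, so a limit of
  lifts that stays in \<open>P\<close> represents a point of the Zariski closure.\<close>

lemma final_topology_closure_ofI:
  assumes "p \<in> P" "\<And>n. ps n \<in> P" "\<And>n. q (ps n) \<in> A"
    and lim: "\<And>c. c \<in> C \<Longrightarrow> (\<lambda>n::nat. c (ps n)) \<longlonglongrightarrow> c p"
  shows "q p \<in> final_topology (subtopology (zariski C) P) q closure_of A"
  unfolding in_closure_of
proof (intro conjI allI impI)
  show "q p \<in> topspace (final_topology (subtopology (zariski C) P) q)" using assms(1) by simp
  fix U assume U: "q p \<in> U \<and> openin (final_topology (subtopology (zariski C) P) q) U"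
  then have "openin (subtopology (zariski C) P) {x \<in> P. q x \<in> U}"
    by (simp add: openin_final_topology)
  then obtain F where F: "F \<subseteq> polyfuns C" "{x \<in> P. q x \<in> U} = {x. \<exists>f\<in>F. f x \<noteq> 0} \<inter> P"
    unfolding openin_subtopology openin_zariski by blast
  from U assms(1) F(2) have "p \<in> {x. \<exists>f\<in>F. f x \<noteq> 0}" by blast
  then obtain f where f: "f \<in> F" "f p \<noteq> 0" by blast
  have "(\<lambda>n. f (ps n)) \<longlonglongrightarrow> f p" using f(1) F(1) lim by (intro polyfuns_tendsto[of f C]) auto
  then have "\<forall>\<^sub>F n in sequentially. f (ps n) \<noteq> 0" using f(2) by (rule tendsto_imp_eventually_ne)
  then obtain n where "f (ps n) \<noteq> 0" by (auto simp: eventually_sequentially)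
  then have "ps n \<in> {x \<in> P. q x \<in> U}" using F(2) f(1) assms(2) by blast
  then show "\<exists>y. y \<in> A \<and> y \<in> U" using assms(3) by blast
qed

section \<open>Rescaled tensors and compactness\<close>

lemma scale_rows:
  assumes "\<And>i. d i \<noteq> 0"
  shows "range (row_combination (\<chi> i. d i *s X $ i)) = range (row_combination X)"
    and "independent_rows X \<Longrightarrow> independent_rows (\<chi> i. d i *s X $ i)"
proof -
  have eq: "row_combination (\<chi> i. d i *s X $ i) c = row_combination X (\<chi> i. c $ i * d i)" for c
    by (simp add: vec_eq_iff row_combination_component mult.assoc)
  have eq': "row_combination X c = row_combination (\<chi> i. d i *s X $ i) (\<chi> i. c $ i / d i)" for c
    unfolding eq using assms by (simp add: vec_eq_iff row_combination_component)
  show "range (row_combination (\<chi> i. d i *s X $ i)) = range (row_combination X)"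
  proof (intro equalityI image_subsetI)
    show "row_combination (\<chi> i. d i *s X $ i) c \<in> range (row_combination X)" for c
      unfolding eq by (rule rangeI)
    show "row_combination X c \<in> range (row_combination (\<chi> i. d i *s X $ i))" for c
      by (subst eq') (rule rangeI)
  qed
  show "independent_rows (\<chi> i. d i *s X $ i)" if X: "independent_rows X"
    unfolding independent_rows_def eq
  proof (intro allI impI)
    fix c assume "row_combination X (\<chi> i. c $ i * d i) = 0"
    then have "(\<chi> i. c $ i * d i) = 0" using X unfolding independent_rows_def by blast
    then show "c = 0" using assms by (simp add: vec_eq_iff)
  qed
qed

lemma norm_vec_le_sum: "norm x \<le> (\<Sum>i\<in>UNIV. norm (x $ i))"
  by (simp add: norm_vec_def L2_set_le_sum)

text \<open>The identity minor is a closed condition for each of the finitely many \<open>I\<close>,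
  and it keeps the rows independent in the limit.\<close>

lemma compact_normalized_frames:
  "compact {W :: complex^'n^'i. (\<exists>I. \<forall>i l. W $ i $ I l = (if i = l then 1 else 0)) \<and> (\<forall>i m. norm (W $ i $ m) \<le> 1)}"
  (is "compact ?K")
proof -
  have "?K = (\<Union>I\<in>UNIV. {W. \<forall>i l. W $ i $ I l = (if i = l then 1 else 0)}) \<inter> {W. \<forall>i m. norm (W $ i $ m) \<le> 1}"
    by blast
  moreover have "closed \<dots>"
    by (intro closed_Int closed_UN ballI closed_Collect_all closed_Collect_eq closed_Collect_le continuous_intros finite)
  ultimately have "closed ?K" by simp
  moreover have "norm W \<le> real (CARD('n) * CARD('i))" if "W \<in> ?K" for W
  proof -
    have "norm (W $ i) \<le> (\<Sum>m\<in>(UNIV :: 'n set). 1)" for i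
      by (rule order.trans[OF norm_vec_le_sum sum_mono]) (use that in auto)
    then have "(\<Sum>i\<in>UNIV. norm (W $ i)) \<le> (\<Sum>i\<in>(UNIV :: 'i set). real CARD('n))"
      by (intro sum_mono) simp
    then show ?thesis using norm_vec_le_sum[of W] by (simp add: mult.commute)
  qed
  then have "bounded ?K" by (rule boundedI)
  ultimately show ?thesis by (simp add: compact_eq_bounded_closed)
qed

text \<open>Factors of norm one cannot tend to zero, so limits of the rank one tensors built from
  them have rank one.\<close>

lemma compact_unit_factors:
  "compact {\<theta> :: complex^'n^'a^'i. \<forall>i a. norm (\<theta> $ i $ a) = 1}" (is "compact ?K")
proof -
  have "closed ?K"
    by (intro closed_Collect_all closed_Collect_eq continuous_intros)
  moreover have "norm W \<le> real (CARD('a) * CARD('i))" if "W \<in> ?K" for W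
  proof -
    have "norm (W $ i) \<le> (\<Sum>m\<in>(UNIV :: 'a set). 1)" for i
      by (rule order.trans[OF norm_vec_le_sum sum_mono]) (use that in auto)
    then have "(\<Sum>i\<in>UNIV. norm (W $ i)) \<le> (\<Sum>i\<in>(UNIV :: 'i set). real CARD('a))"
      by (intro sum_mono) simp
    then show ?thesis using norm_vec_le_sum[of W] by (simp add: mult.commute)
  qed
  then have "bounded ?K" by (rule boundedI)
  ultimately show ?thesis by (simp add: compact_eq_bounded_closed)
qed

section \<open>Limits of decompositions\<close>

text \<open>In a border rank decomposition the rank one tensors may diverge. Only their lines and
  their span matter, and scaling the factors changes neither.\<close>

lemma summand_normalize:
  fixes \<theta> :: "complex^3^3^'i::finite"
  assumes X: "independent_rows (\<chi> i. summand \<theta> i)"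
  shows "\<exists>\<theta>' :: complex^3^3^'i. (\<forall>i a. norm (\<theta>' $ i $ a) = 1) \<and> independent_rows (\<chi> i. summand \<theta>' i) \<and>
    range (row_combination (\<chi> i. summand \<theta>' i)) = range (row_combination (\<chi> i. summand \<theta> i))"
proof -
  have nz: "\<theta> $ i $ a \<noteq> 0" for i a
  proof
    assume "\<theta> $ i $ a = 0"
    then have "summand \<theta> i = 0"
      using exhaust_3[of a] by (auto simp: summand_def tensor_prod_def vec_eq_iff)
    then have "row_combination (\<chi> i. summand \<theta> i) (axis i 1) = 0"
      unfolding row_combination_axis by simp
    then have "(axis i 1 :: complex^_) $ i = 0" using X unfolding independent_rows_def by (metis zero_index)
    then show False by (simp add: axis_def)
  qed
  define \<theta>' where "\<theta>' = (\<chi> i a. (1 / norm (\<theta> $ i $ a)) *\<^sub>R \<theta> $ i $ a)"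
  define d :: "_ \<Rightarrow> complex" where
    "d i = of_real (1 / (norm (\<theta> $ i $ 1) * norm (\<theta> $ i $ 2) * norm (\<theta> $ i $ 3)))" for i
  have "summand \<theta>' i = d i *s summand \<theta> i" for i
    by (simp add: summand_def tensor_prod_def vec_eq_iff \<theta>'_def d_def scaleR_conv_of_real[where 'a = complex])
  then have eq: "(\<chi> i. summand \<theta>' i) = (\<chi> i. d i *s (\<chi> i. summand \<theta> i) $ i)" by (simp add: vec_eq_iff)
  have "d i \<noteq> 0" for i using nz by (simp add: d_def)
  note scale = scale_rows[of d "\<chi> i. summand \<theta> i", OF this]
  have "norm (\<theta>' $ i $ a) = 1" for i a using nz by (simp add: \<theta>'_def)
  then show ?thesis
    using scale(1) scale(2)[OF X] unfolding eq[symmetric] by blast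
qed

lemma summand_rank_one:
  assumes "\<And>a. norm (\<theta> $ i $ a) = 1"
  shows "summand \<theta> i \<in> rank_one"
proof -
  have "\<theta> $ i $ a \<noteq> 0" for a using assms[of a] by auto
  then show ?thesis unfolding rank_one_def summand_def by blast
qed

lemma dim_frame_span: "v \<in> frames r \<Longrightarrow> vec.dim (frame_span r v) = r"
  using frame_span_image_frames[of r] by (auto simp: grassmannian_def)

text \<open>The plane is given by two frames, the rank one tensors \<open>X\<close> and an arbitrary
  \<open>v\<close>, because in the limit the former may become dependent while the latter can be
  kept independent.\<close>

lemma generic_incidence:
  assumes d: "bij_betw d (UNIV :: 'i::finite set) {..<r}"
    and X: "independent_rows X" "\<And>i. X $ i \<in> rank_one"
    and v: "v \<in> frames r" "frame_span r v = range (row_combination (X :: ('a::finite, 'b::finite, 'c::finite) tensor^'i))"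
    and y: "y \<noteq> 0" "y \<in> range (row_combination X)"
  shows "(restrict (\<lambda>j. proj_point (X $ inv d j)) {..<r}, proj_point y, frame_span r v) \<in>
    {(x, y, E). x \<in> {..<r} \<rightarrow>\<^sub>E segre \<and> y \<in> grassmannian 1 \<and> E \<in> grassmannian r \<and>
        vec.dim (\<Union>j<r. x j) = r \<and>
        y \<subseteq> vec.span (\<Union>j<r. x j) \<and> vec.span (\<Union>j<r. x j) \<subseteq> E}"
proof -
  define x where "x j = X $ inv d j" for j
  have "(\<chi> i. x (d i)) = X" using d by (simp add: vec_eq_iff x_def bij_betw_def)
  then have x: "x \<in> frames r" "frame_span r x = range (row_combination X)"
    using frames_iff_independent_rows[OF d, of x] frame_span_eq_range[OF d, of x] X(1) by simp_all
  define U where "U = (\<Union>j<r. restrict (\<lambda>j. proj_point (X $ inv d j)) {..<r} j)"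
  have U: "U = (\<Union>j<r. proj_point (x j))" by (simp add: U_def x_def)
  have "vec.span U = frame_span r x"
    unfolding frame_span_def
  proof (intro equalityI vec.span_minimal vec.subspace_span)
    show "U \<subseteq> vec.span (x ` {..<r})"
      unfolding U by (intro UN_least vec.span_mono) auto
    show "x ` {..<r} \<subseteq> vec.span U"
      unfolding U by (auto intro!: vec.span_base)
  qed
  then have sU: "vec.span U = range (row_combination X)" using x(2) by simp
  have "vec.dim U = r"
    using dim_frame_span[OF x(1)] sU x(2) vec.dim_span by metis
  moreover have "proj_point y \<subseteq> vec.span U"
    using y(2) unfolding sU[symmetric] by (intro vec.span_minimal vec.subspace_span) simp
  moreover have "restrict (\<lambda>j. proj_point (X $ inv d j)) {..<r} \<in> {..<r} \<rightarrow>\<^sub>E segre"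
    using X(2) by (auto simp: segre_def)
  moreover have "proj_point y \<in> grassmannian 1" using y(1) proj_points by blast
  moreover have "frame_span r v \<in> grassmannian r" using v(1) frame_span_image_frames by blast
  ultimately show ?thesis using sU v(2) unfolding U_def by simp
qed

lemma tendsto_section_det:
  assumes "V \<longlonglongrightarrow> V0" "L \<longlonglongrightarrow> L0" "u \<longlonglongrightarrow> u0"
  shows "(\<lambda>n. det (section_matrix (V n) (L n) (u n))) \<longlonglongrightarrow> det (section_matrix V0 L0 u0)"
proof -
  have "(\<lambda>n. section_matrix (V n) (L n) (u n) $ r $ k) \<longlonglongrightarrow> section_matrix V0 L0 u0 $ r $ k" for r k
    by (cases k) (auto simp: section_matrix_def matrix_vector_mult_def intro!: tendsto_intros assms)
  then show ?thesis unfolding det_def by (intro tendsto_sum tendsto_mult tendsto_const tendsto_prod)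
qed

lemma border_vsp_meets_sections:
  fixes T :: "(3, 3, 3) tensor" and L :: "complex^(3 \<times> 3 \<times> 3)^five option^eight" and u :: "complex^five option^eight"
  assumes rank: "border_rank T = 5" and "T \<noteq> 0"
  shows "\<exists>E\<in>border_vsp T. \<forall>j. meets E (L $ j) (u $ j)"
proof -
  have "card (UNIV :: five set) = card {..<5::nat}" by simp
  then obtain d where d: "bij_betw d (UNIV :: five set) {..<5::nat}"
    using finite_same_card_bij[OF finite_class.finite_UNIV finite_lessThan] by blast
  have "(T, L, u) \<in> closure (config_map ` {p :: (five, eight) config. det (\<chi> l i. summand (fst p) i $ diag_index l) \<noteq> 0})"
    unfolding dense_config_image by simp
  then obtain ys where ys: "\<forall>n. ys n \<in> config_map ` {p :: (five, eight) config. det (\<chi> l i. summand (fst p) i $ diag_index l) \<noteq> 0}"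
    "ys \<longlonglongrightarrow> (T, L, u)" unfolding closure_sequential by blast
  have "\<forall>n. \<exists>p :: (five, eight) config. ys n = config_map p \<and> independent_rows (\<chi> i. summand (fst p) i)"
  proof
    fix n
    obtain p :: "(five, eight) config" where "ys n = config_map p" "det (\<chi> l i. summand (fst p) i $ diag_index l) \<noteq> 0"
      using ys(1) by blast
    then show "\<exists>p :: (five, eight) config. ys n = config_map p \<and> independent_rows (\<chi> i. summand (fst p) i)"
      using minor_imp_independent_rows[where I = diag_index and V = "\<chi> i. summand (fst p) i"]
      by (intro exI[of _ p]) simp
  qed
  from choice[OF this] obtain ps :: "nat \<Rightarrow> (five, eight) config" where
    ps: "\<And>n. ys n = config_map (ps n)" "\<And>n. independent_rows (\<chi> i. summand (fst (ps n)) i)" by blast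
  define X where "X n = (\<chi> i. summand (fst (ps n)) i)" for n
  define Tn where "Tn n = fst (ys n)" for n
  define Ln where "Ln n = fst (snd (ys n))" for n
  define un where "un n = snd (snd (ys n))" for n
  have Tn: "Tn \<longlonglongrightarrow> T" and Ln: "Ln \<longlonglongrightarrow> L" and un: "un \<longlonglongrightarrow> u"
    using tendsto_fst[OF ys(2)] tendsto_fst[OF tendsto_snd[OF ys(2)]] tendsto_snd[OF tendsto_snd[OF ys(2)]]
    by (simp_all add: Tn_def[abs_def] Ln_def[abs_def] un_def[abs_def])
  have T_comb: "Tn n = row_combination (X n) 1" for n
    by (simp add: Tn_def ps(1) config_map_def X_def row_combination_def split: prod.split)
  \<comment> \<open>All coefficients of \<open>Tn n\<close> in independent tensors are 1; it must be
    nonzero to represent a point of projective space.\<close>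
  have Tn0: "Tn n \<noteq> 0" for n
    using ps(2)[of n] unfolding T_comb X_def independent_rows_def by (metis one_index zero_index zero_neq_one)
  have u_comb: "un n $ j = Ln n $ j *v row_combination (X n) (fst (snd (ps n)) $ j)" for n j
    by (simp add: un_def Ln_def ps(1) config_map_def X_def row_combination_def split: prod.split)
  define K1 where "K1 = {W :: complex^(3 \<times> 3 \<times> 3)^five.
    (\<exists>I. \<forall>i l. W $ i $ I l = (if i = l then 1 else 0)) \<and> (\<forall>i m. norm (W $ i $ m) \<le> 1)}"
  define K2 where "K2 = {\<theta> :: complex^3^3^five. \<forall>i a. norm (\<theta> $ i $ a) = 1}"
  \<comment> \<open>The same plane is normalized twice: \<open>W\<close> controls its limit as a
    plane, and \<open>\<theta>\<close> controls the limits of its rank one tensors.\<close>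
  have "\<forall>n. \<exists>W. W \<in> K1 \<and> range (row_combination W) = range (row_combination (X n))"
    using normalized_frame[OF ps(2)] unfolding X_def K1_def by blast
  from choice[OF this] obtain W where W: "\<And>n. W n \<in> K1"
    "\<And>n. range (row_combination (W n)) = range (row_combination (X n))" by blast
  have "\<forall>n. \<exists>\<theta>. \<theta> \<in> K2 \<and> independent_rows (\<chi> i. summand \<theta> i) \<and>
      range (row_combination (\<chi> i. summand \<theta> i)) = range (row_combination (X n))"
    using summand_normalize[OF ps(2)] unfolding X_def K2_def by blast
  from choice[OF this] obtain \<theta> where \<theta>: "\<And>n. \<theta> n \<in> K2" "\<And>n. independent_rows (\<chi> i. summand (\<theta> n) i)"
    "\<And>n. range (row_combination (\<chi> i. summand (\<theta> n) i)) = range (row_combination (X n))" by blast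
  have "compact (K1 \<times> K2)"
    unfolding K1_def K2_def by (intro compact_Times compact_normalized_frames compact_unit_factors)
  then have "seq_compact (K1 \<times> K2)" by (simp add: compact_eq_seq_compact_metric)
  then obtain z r where zr: "z \<in> K1 \<times> K2" "strict_mono r" "((\<lambda>n. (W n, \<theta> n)) \<circ> r) \<longlonglongrightarrow> z"
    using W(1) \<theta>(1) seq_compactE[of "K1 \<times> K2" "\<lambda>n. (W n, \<theta> n)"] by blast
  define W0 where "W0 = fst z"
  define \<theta>0 where "\<theta>0 = snd z"
  have W0: "(\<lambda>n. W (r n)) \<longlonglongrightarrow> W0" and \<theta>0: "(\<lambda>n. \<theta> (r n)) \<longlonglongrightarrow> \<theta>0"
    using tendsto_fst[OF zr(3)] tendsto_snd[OF zr(3)] by (simp_all add: W0_def \<theta>0_def comp_def)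
  have K0: "W0 \<in> K1" "\<theta>0 \<in> K2" using zr(1) by (auto simp: W0_def \<theta>0_def)
  have K1_independent: "independent_rows V" if V: "V \<in> K1" for V
  proof -
    obtain I where "\<forall>i l. V $ i $ I l = (if i = l then 1 else 0)" using V unfolding K1_def by blast
    then have "(\<chi> l i. V $ i $ I l) = mat 1" by (auto simp: mat_def vec_eq_iff)
    then show ?thesis using minor_imp_independent_rows[of V I] by simp
  qed
  have rank_one: "summand \<eta> i \<in> rank_one" if "\<eta> \<in> K2" for \<eta> i
    using that by (intro summand_rank_one) (simp add: K2_def)
  define \<xi> where "\<xi> V j = V $ inv d j" for V :: "complex^(3 \<times> 3 \<times> 3)^five" and j
  have dinv: "inv d (d i) = i" for i using d by (simp add: bij_betw_def)
  have \<xi>: "(\<chi> i. \<xi> V (d i)) = V" for V by (simp add: \<xi>_def dinv vec_eq_iff)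
  note frames_\<xi> = frames_iff_independent_rows[OF d, of "\<xi> _", unfolded \<xi>]
  note span_\<xi> = frame_span_eq_range[OF d, of "\<xi> _", unfolded \<xi>]
  define E where "E = range (row_combination W0)"
  have "(restrict (\<lambda>j. proj_point (\<xi> (\<chi> i. summand \<theta>0 i) j)) {..<5}, proj_point T, frame_span 5 (\<xi> W0)) \<in> S_incidence 5"
  proof -
    let ?P = "{(x, y, v). (\<forall>j<5::nat. x j \<in> rank_one) \<and> y \<noteq> 0 \<and> v \<in> frames 5}"
    let ?q = "\<lambda>(x, y, v). (restrict (\<lambda>j. proj_point (x j)) {..<5}, proj_point y, frame_span 5 v)"
    let ?pt = "\<lambda>n. (\<xi> (\<chi> i. summand (\<theta> (r n)) i), Tn (r n), \<xi> (W (r n)))"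
    let ?p = "(\<xi> (\<chi> i. summand \<theta>0 i), T, \<xi> W0)"
    have lim: "(\<lambda>n. c (?pt n)) \<longlonglongrightarrow> c ?p"
      if "c \<in> {\<lambda>(x, y, v). x j $ i | j i. j < 5} \<union> {\<lambda>(x, y, v). y $ i | i. True} \<union> {\<lambda>(x, y, v). v j $ i | j i. j < 5}" for c
    proof -
      have "(\<lambda>n. \<xi> (\<chi> i. summand (\<theta> (r n)) i) j $ i) \<longlonglongrightarrow> \<xi> (\<chi> i. summand \<theta>0 i) j $ i" for j i
        unfolding \<xi>_def summand_def tensor_prod_def vec_lambda_beta
        by (intro tendsto_intros \<theta>0)
      moreover have "(\<lambda>n. Tn (r n) $ i) \<longlonglongrightarrow> T $ i" for i
        using LIMSEQ_subseq_LIMSEQ[OF Tn zr(2)] by (intro tendsto_intros) (simp add: comp_def)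
      moreover have "(\<lambda>n. \<xi> (W (r n)) j $ i) \<longlonglongrightarrow> \<xi> W0 j $ i" for j i
        unfolding \<xi>_def by (intro tendsto_intros W0)
      ultimately show ?thesis using that by auto
    qed
    have "?q ?p \<in> incidence_zariski 5 closure_of {(x, y, E). x \<in> {..<5} \<rightarrow>\<^sub>E segre \<and> y \<in> grassmannian 1 \<and> E \<in> grassmannian 5 \<and>
        vec.dim (\<Union>j<5. x j) = 5 \<and> y \<subseteq> vec.span (\<Union>j<5. x j) \<and> vec.span (\<Union>j<5. x j) \<subseteq> E}"
      unfolding incidence_zariski_def
    proof (rule final_topology_closure_ofI[where ps = ?pt])
      show "?p \<in> ?P"
        using rank_one[OF K0(2)] \<open>T \<noteq> 0\<close> K1_independent[OF K0(1)] frames_\<xi>[of W0] by (simp add: \<xi>_def)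
      show "?pt n \<in> ?P" for n
        using rank_one[OF \<theta>(1)] Tn0 K1_independent[OF W(1)] frames_\<xi>[of "W (r n)"] by (simp add: \<xi>_def)
      show "?q (?pt n) \<in> {(x, y, E). x \<in> {..<5} \<rightarrow>\<^sub>E segre \<and> y \<in> grassmannian 1 \<and> E \<in> grassmannian 5 \<and>
        vec.dim (\<Union>j<5. x j) = 5 \<and> y \<subseteq> vec.span (\<Union>j<5. x j) \<and> vec.span (\<Union>j<5. x j) \<subseteq> E}" for n
        unfolding prod.case \<xi>_def[of "\<chi> i. summand (\<theta> (r n)) i"]
      proof (rule generic_incidence[OF d])
        show "independent_rows (\<chi> i. summand (\<theta> (r n)) i)" by (rule \<theta>(2))
        show "(\<chi> i. summand (\<theta> (r n)) i) $ i \<in> rank_one" for i using rank_one[OF \<theta>(1)] by simp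
        show "\<xi> (W (r n)) \<in> frames 5" using K1_independent[OF W(1)] frames_\<xi> by simp
        show "frame_span 5 (\<xi> (W (r n))) = range (row_combination (\<chi> i. summand (\<theta> (r n)) i))"
          unfolding span_\<xi> W(2) \<theta>(3) ..
        show "Tn (r n) \<noteq> 0" by (rule Tn0)
        show "Tn (r n) \<in> range (row_combination (\<chi> i. summand (\<theta> (r n)) i))"
          unfolding \<theta>(3) T_comb by (rule rangeI)
      qed
    qed (rule lim)
    then show ?thesis unfolding S_incidence_def by simp
  qed
  then have "E \<in> border_vsp T"
    unfolding border_vsp_def rank E_def span_\<xi> by blast
  \<comment> \<open>On the normalized frames the sections are equations that depend continuously on
    frame, \<open>L\<close> and \<open>u\<close>, so they persist in the limit.\<close>
  moreover have "meets E (L $ j) (u $ j)" for j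
  proof -
    have "meets (range (row_combination (W n))) (Ln n $ j) (un n $ j)" for n
      unfolding meets_def W(2) by (intro bexI[of _ "row_combination (X n) (fst (snd (ps n)) $ j)"] exI[of _ 1]) (simp_all add: u_comb)
    then have "det (section_matrix (W n) (Ln n $ j) (un n $ j)) = 0" for n
      using meets_iff_det[OF K1_independent[OF W(1)]] by blast
    moreover have "(\<lambda>n. det (section_matrix (W (r n)) (Ln (r n) $ j) (un (r n) $ j))) \<longlonglongrightarrow> det (section_matrix W0 (L $ j) (u $ j))"
      using LIMSEQ_subseq_LIMSEQ[OF Ln zr(2)] LIMSEQ_subseq_LIMSEQ[OF un zr(2)]
      by (intro tendsto_section_det W0 tendsto_vec_nth) (simp_all add: comp_def)
    ultimately have "det (section_matrix W0 (L $ j) (u $ j)) = 0" by (simp add: LIMSEQ_const_iff)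
    then show ?thesis unfolding E_def using meets_iff_det[OF K1_independent[OF K0(1)]] by blast
  qed
  ultimately show ?thesis by blast
qed

section \<open>The dimension bound\<close>

definition section_coords :: "((complex^'n^'k) \<times> (complex^'k) \<Rightarrow> complex) set" where
  "section_coords = range (\<lambda>(r, m) p. fst p $ r $ m) \<union> range (\<lambda>r p. snd p $ r)"

lemma polyfuns_section_det:
  "(\<lambda>p. det (section_matrix V (fst p) (snd p))) \<in> polyfuns section_coords"
proof (rule polyfuns_det)
  have "(\<lambda>p. fst p $ r $ m) \<in> polyfuns (section_coords :: ((complex^'n^'k) \<times> (complex^'k) \<Rightarrow> complex) set)" for r m
    unfolding section_coords_def by (rule polyfuns.coord, rule UnI1, rule image_eqI[of _ _ "(r, m)"]) simp_all
  moreover have "(\<lambda>p. snd p $ r) \<in> polyfuns (section_coords :: ((complex^'n^'k) \<times> (complex^'k) \<Rightarrow> complex) set)" for r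
    unfolding section_coords_def by (rule polyfuns.coord) simp
  ultimately show "(\<lambda>p. section_matrix V (fst p) (snd p) $ r $ k) \<in> polyfuns section_coords" for r k
    by (cases k) (auto simp: section_matrix_def matrix_vector_mult_def intro!: polyfuns_sum polyfuns.mult polyfuns.const)
qed

lemma linear_section_coords: "c \<in> section_coords \<Longrightarrow> linear c"
  unfolding section_coords_def by (auto intro!: linearI)

lemma grassmannian_frame:
  assumes "E \<in> grassmannian CARD('i)"
  shows "\<exists>V :: complex^'n^'i::finite. independent_rows V \<and> E = range (row_combination V)"
proof -
  obtain d where d: "bij_betw d (UNIV :: 'i set) {..<CARD('i)}"
    using finite_same_card_bij[OF finite_class.finite_UNIV finite_lessThan] by (metis card_lessThan)
  obtain v where v: "v \<in> frames CARD('i)" "E = frame_span CARD('i) v"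
    using assms unfolding frame_span_image_frames[symmetric] by (rule imageE)
  then show ?thesis
    using frames_iff_independent_rows[OF d, of v] frame_span_eq_range[OF d, of v] by metis
qed

text \<open>Each plane excludes only the zeros of one nonzero polynomial in \<open>(L, u)\<close>.
  The induction retains a polynomial as witness, since a product of two nonzero ones is again
  nonzero.\<close>

lemma exists_section_avoiding_finite:
  assumes "finite S" "S \<subseteq> grassmannian CARD('i::finite)"
  shows "\<exists>L u. \<forall>E\<in>S. \<not> meets E (L :: complex^'n^'i option) u"
proof -
  have "\<exists>f\<in>polyfuns section_coords. (\<exists>p. f p \<noteq> 0) \<and> (\<forall>p. f p \<noteq> 0 \<longrightarrow> (\<forall>E\<in>S. \<not> meets E (fst p :: complex^'n^'i option) (snd p)))"
    using assms
  proof induction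
    case empty
    then show ?case by (intro bexI[OF _ polyfuns.const[of 1]]) auto
  next
    case (insert E S)
    then obtain f where f: "f \<in> polyfuns section_coords" "\<exists>p. f p \<noteq> 0"
      "\<forall>p. f p \<noteq> 0 \<longrightarrow> (\<forall>E\<in>S. \<not> meets E (fst p :: complex^'n^'i option) (snd p))" by blast
    have "E \<in> grassmannian CARD('i)" using insert.prems by simp
    then obtain V :: "complex^'n^'i" where V: "independent_rows V" "E = range (row_combination V)"
      using grassmannian_frame by blast
    let ?g = "\<lambda>p. det (section_matrix V (fst p) (snd p))"
    obtain L u where "det (section_matrix V L u) \<noteq> 0" using exists_section_avoiding[OF V(1)] by blast
    then have "?g (L, u) \<noteq> 0" by simp
    moreover obtain p where "f p \<noteq> 0" using f(2) by blast
    ultimately obtain z where "f z \<noteq> 0 \<and> ?g z \<noteq> 0"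
      using polyfuns_no_zero_divisors[OF linear_section_coords f(1) polyfuns_section_det, of p V "(L, u)"] by blast
    then have "\<exists>p. f p * ?g p \<noteq> 0" by (intro exI[of _ z]) simp
    moreover have "\<not> meets E (fst p) (snd p)" if "f p * ?g p \<noteq> 0" for p
      using that unfolding V(2) meets_iff_det[OF V(1)] by auto
    moreover have "(\<lambda>p. f p * ?g p) \<in> polyfuns section_coords"
      by (intro polyfuns.mult f(1) polyfuns_section_det)
    ultimately show ?case using f(3)
      by (intro bexI[of _ "\<lambda>p. f p * ?g p"]) auto
  qed
  then show ?thesis by metis
qed

text \<open>The preimage of a section in the space of frames is the zero set of one polynomial, the
  determinant of \<open>section_matrix\<close>.\<close>

lemma closedin_grassmannian_section:
  fixes L :: "complex^'n^'i::finite option"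
  shows "closedin (grassmannian_zariski CARD('i)) (grassmannian CARD('i) \<inter> {E. meets E L u})"
proof -
  let ?r = "CARD('i)" and ?C = "{\<lambda>v :: nat \<Rightarrow> complex^'n. v j $ i | j i. j < CARD('i)}"
  obtain d where d: "bij_betw d (UNIV :: 'i set) {..<?r}"
    using finite_same_card_bij[OF finite_class.finite_UNIV finite_lessThan] by (metis card_lessThan)
  let ?f = "\<lambda>v :: nat \<Rightarrow> complex^'n. det (section_matrix (\<chi> i::'i. v (d i)) L u)"
  have "d i < ?r" for i using d by (auto simp: bij_betw_def)
  then have "(\<lambda>v. v (d i) $ m) \<in> polyfuns ?C" for i m by (intro polyfuns.coord) blast
  then have "(\<lambda>v. section_matrix (\<chi> i::'i. v (d i)) L u $ r $ k) \<in> polyfuns ?C" for r k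
    by (cases k) (auto simp: section_matrix_def matrix_vector_mult_def intro!: polyfuns_sum polyfuns.mult polyfuns.const)
  then have f: "?f \<in> polyfuns ?C" by (rule polyfuns_det)
  have "meets (frame_span ?r v) L u \<longleftrightarrow> ?f v = 0" if "v \<in> frames ?r" for v
    using meets_iff_det[of "\<chi> i::'i. v (d i)" L u] that
    unfolding frame_span_eq_range[OF d] frames_iff_independent_rows[OF d] by blast
  moreover have "frame_span ?r v \<in> grassmannian ?r" if "v \<in> frames ?r" for v :: "nat \<Rightarrow> complex^'n"
    using that frame_span_image_frames by blast
  ultimately have "{v \<in> frames ?r. frame_span ?r v \<in> grassmannian ?r \<inter> {E. meets E L u}} = {v. \<forall>h\<in>{?f}. h v = 0} \<inter> frames ?r"
    by auto
  moreover have "closedin (zariski ?C) {v. \<forall>h\<in>{?f}. h v = 0}"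
    unfolding closedin_zariski using f by blast
  ultimately have "closedin (subtopology (zariski ?C) (frames ?r))
      {v \<in> frames ?r. frame_span ?r v \<in> grassmannian ?r \<inter> {E. meets E L u}}"
    unfolding closedin_subtopology by blast
  then show ?thesis
    unfolding grassmannian_zariski_def closedin_final_topology
    by (simp add: frame_span_image_frames)
qed

lemma noetherian_grassmannian: "noetherian_space (grassmannian_zariski r :: (complex^'n) set topology)"
proof -
  have "{\<lambda>v :: nat \<Rightarrow> complex^'n. v j $ i | j i. j < r} = (\<lambda>(j, i) v. v j $ i) ` ({..<r} \<times> UNIV)" by auto
  then have "finite {\<lambda>v :: nat \<Rightarrow> complex^'n. v j $ i | j i. j < r}" by simp
  then show ?thesis
    unfolding grassmannian_zariski_def
    by (intro noetherian_space_final_topology noetherian_space_subtopology noetherian_space_zariski)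
qed

lemma border_rank_0: "border_rank 0 = 0"
proof -
  have "(0 :: ('a, 'b, 'c) tensor) \<in> rank_one_sums 0" unfolding rank_one_sums_def by simp
  then have "\<exists>S :: nat \<Rightarrow> ('a, 'b, 'c) tensor. (\<forall>n. S n \<in> rank_one_sums 0) \<and> S \<longlonglongrightarrow> 0"
    by (intro exI[of _ "\<lambda>_. 0"]) simp
  then show ?thesis unfolding border_rank_def by (rule Least_eq_0)
qed

theorem corollary3p2:
  fixes T :: "(3, 3, 3) tensor"
  assumes "border_rank T = 5"
  shows "krull_dim (subtopology (grassmannian_zariski 5) (border_vsp T)) \<ge> 8"
proof -
  let ?X = "subtopology (grassmannian_zariski 5) (border_vsp T)"
  define \<H> where "\<H> = {{E. meets E L u} | (L :: complex^(3 \<times> 3 \<times> 3)^five option) u. True}"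
  have five: "CARD(five) = 5" by simp
  have "T \<noteq> 0" using assms by (auto simp: border_rank_0)
  have vsp: "border_vsp T \<subseteq> grassmannian 5"
  proof
    fix E assume "E \<in> border_vsp T"
    then obtain x where "(x, proj_point T, E) \<in> S_incidence 5" unfolding border_vsp_def assms by blast
    moreover have "S_incidence 5 \<subseteq> topspace (incidence_zariski 5 :: (_ \<times> (3, 3, 3) tensor set \<times> _) topology)"
      unfolding S_incidence_def by (rule closure_of_subset_topspace)
    ultimately show "E \<in> grassmannian 5" unfolding topspace_incidence_zariski by blast
  qed
  then have top: "topspace ?X = border_vsp T" by (auto simp: topspace_grassmannian_zariski)
  have card: "card {..<8::nat} = card (UNIV :: eight set)" by simp
  \<comment> \<open>Chains number their sections by naturals, configurations by
    \<open>eight\<close>; \<open>b\<close> translates between them.\<close>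
  obtain b where b: "bij_betw b {..<8::nat} (UNIV :: eight set)"
    using finite_same_card_bij[OF finite_lessThan finite_class.finite_UNIV card] by blast
  have "\<exists>Z :: nat \<Rightarrow> (3, 3, 3) tensor set set. (\<forall>i\<le>8. irreducible_closedin ?X (Z i) \<and> Z i \<subseteq> topspace ?X) \<and> (\<forall>i<8. Z i \<subset> Z (Suc i))"
  proof (rule irreducible_chain_if_sections_meet)
    show "noetherian_space ?X"
      by (intro noetherian_space_subtopology noetherian_grassmannian)
    show "closedin ?X (topspace ?X \<inter> H)" if mem: "H \<in> \<H>" for H
    proof -
      obtain L :: "complex^(3 \<times> 3 \<times> 3)^five option" and u where H: "H = {E. meets E L u}"
        using mem unfolding \<H>_def by blast
      have "topspace ?X \<inter> H = (grassmannian 5 \<inter> {E. meets E L u}) \<inter> border_vsp T"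
        unfolding top H using vsp by blast
      then show ?thesis
        using closedin_grassmannian_section[of L u] unfolding five closedin_subtopology by blast
    qed
    show "\<exists>H\<in>\<H>. H \<inter> S = {}" if S: "finite S" "S \<subseteq> topspace ?X" for S
    proof -
      have "S \<subseteq> grassmannian CARD(five)" using S(2) vsp unfolding top five by blast
      then obtain L :: "complex^(3 \<times> 3 \<times> 3)^five option" and u where "\<forall>E\<in>S. \<not> meets E L u"
        using exists_section_avoiding_finite[OF S(1)] by blast
      then have "{E. meets E L u} \<inter> S = {}" by blast
      then show ?thesis unfolding \<H>_def by blast
    qed
    show "closedin ?X (topspace ?X)" by (rule closedin_topspace)
    show "topspace ?X \<inter> (\<Inter>i<8. H i) \<noteq> {}" if "\<And>i::nat. i < 8 \<Longrightarrow> H i \<in> \<H>" for H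
    proof -
      have "\<forall>i. \<exists>L u. i < 8 \<longrightarrow> H i = {E. meets E (L :: complex^(3 \<times> 3 \<times> 3)^five option) u}"
        using that unfolding \<H>_def by blast
      then obtain L u where H: "\<And>i. i < 8 \<Longrightarrow> H i = {E. meets E (L i :: complex^(3 \<times> 3 \<times> 3)^five option) (u i)}"
        by metis
      let ?i = "inv_into {..<8} b"
      obtain E where E: "E \<in> border_vsp T" "\<forall>j. meets E ((\<chi> j. L (?i j)) $ j) ((\<chi> j. u (?i j)) $ j)"
        using border_vsp_meets_sections[OF assms \<open>T \<noteq> 0\<close>, of "\<chi> j. L (?i j)" "\<chi> j. u (?i j)"] by blast
      have "E \<in> H i" if "i < 8" for i
        using E(2)[rule_format, of "b i"] H[OF that] that b by (simp add: bij_betw_def)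
      then show ?thesis unfolding top using E(1) by blast
    qed
  qed
  then have "enat 8 \<in> {enat n | n. \<exists>Z :: nat \<Rightarrow> (3, 3, 3) tensor set set.
     (\<forall>i\<le>n. irreducible_closedin ?X (Z i)) \<and> (\<forall>i<n. Z i \<subset> Z (Suc i))}" by blast
  then have "enat 8 \<le> krull_dim ?X" unfolding krull_dim_def by (rule Sup_upper)
  then show ?thesis by (simp add: numeral_eq_enat)
qed

end
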